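(* Let $0<2\alpha<1$, let $D,X,\Gamma$ be as in the context, and let $\rho_2$ be a continuous function on $\overline\Gamma$, written in terms of the parameters. Let $$v_2(x,y,z)=\iint_\Gamma\rho_2(\theta,\vartheta)\,q_2(\xi,\eta,\zeta;x,y,z)\,d\Gamma .$$ For a point $N=(x(s,t),y(s,t),z(s,t))\in\Gamma$ let $n$ be the outer normal to $\Gamma$ at $N$, and let $B_n^\alpha[v_2]_i$ and $B_n^\alpha[v_2]_e$ denote the limits of $B_n^\alpha[v_2(x,y,z)]$ as the point $M=(x,y,z)\notin\Gamma$ tends to $N$ along the normal at $N$ from inside and from outside respectively. Then $$B_n^\alpha[v_2]_i=\frac12\rho_2(s,t)+\iint_\Gamma\rho_2(\theta,\vartheta)K_2(\theta,\vartheta;s,t)\,d\Gamma,$$ $$B_n^\alpha[v_2]_e=-\frac12\rho_2(s,t)+\iint_\Gamma\rho_2(\theta,\vartheta)K_2(\theta,\vartheta;s,t)\,d\Gamma,$$ where $$K_2(\theta,\vartheta;s,t)=B_n^\alpha\left[q_2\left(\xi(\theta,\vartheta),\eta(\theta,\vartheta),\zeta(\theta,\vartheta);x(s,t),y(s,t),z(s,t)\right)\right].$$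
   Context: Domain. $X$ is a simply connected open region of the plane $x=0$ (the $yOz$-plane), $\Gamma$ is a Lyapunov surface lying in $x>0$ (it has a normal at every point; there is $d>0$ such that lines parallel to the normal at $N\in\Gamma$ meet the part of $\Gamma$ inside the ball of radius $d$ about $N$ at most once; the angle between the normals at two points at distance $\rho$ is at most $A\rho^{\lambda}$ with constants $A>0$, $0<\lambda\le1$), and $D$ is the domain bounded by $X$ and $\Gamma$; $\gamma$ is the common boundary curve of $X$ and $\Gamma$. $\Gamma$ is parametrized by $x=x(s,t)$, $y=y(s,t)$, $z=z(s,t)$, $(s,t)\in\overline\Phi$, $\Phi=(s_1,s_2)\times(t_1,t_2)$, and $\gamma$ by $y=y(s,t_0)$, $z=z(s,t_0)$, where $t_0\in[t_1,t_2]$ is fixed with $x(s,t_0)=0$ for all $s\in[s_1,s_2]$. It is assumed that: 1) $x(s,t),y(s,t),z(s,t)$ have continuous first partial derivatives on $\overline\Phi$ with $x_s^2+y_s^2+z_s^2\ne0$ and $x_t^2+y_t^2+z_t^2\ne0$; 2) as points of $\Gamma$ approach $\gamma$, $\Gamma$ forms a right angle with the plane $x=0$. The variable (integration) point of $\Gamma$ is $(\xi,\eta,\zeta)=(\xi(\theta,\vartheta),\eta(\theta,\vartheta),\zeta(\theta,\vartheta))$ in the same parametrization, $(\theta,\vartheta)\in\overline\Phi$; $d\Gamma$ is the surface area element at this point. "Inside"/"outside" and "outer normal" are with respect to $D$. Fundamental solution of $u_{xx}+u_{yy}+u_{zz}+\frac{2\alpha}{x}u_x=0$: with $F$ the (analytically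 continued) Gauss hypergeometric function, $$q_2(x,y,z;\xi,\eta,\zeta)=\frac1{2\pi}r^{2\alpha-3}x^{1-2\alpha}\xi^{1-2\alpha}F\left(\tfrac32-\alpha,1-\alpha;2-2\alpha;1-\tfrac{r_1^2}{r^2}\right),$$ $r^2=(x-\xi)^2+(y-\eta)^2+(z-\zeta)^2$, $r_1^2=(x+\xi)^2+(y-\eta)^2+(z-\zeta)^2$ (symmetric in the two points). Conormal derivative (acting in $(x,y,z)$): $B_n^\alpha=x^{2\alpha}\left(\cos(n,x)\partial_x+\cos(n,y)\partial_y+\cos(n,z)\partial_z\right)$; in $K_2(\theta,\vartheta;s,t)$ it is evaluated at $(x(s,t),y(s,t),z(s,t))$ with $n$ the normal there. *)

theory Defs
  imports "HOL-Analysis.Analysis"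
begin

section \<open>Hypergeometric function and fundamental solution\<close>

text \<open>The principal branch, that is, the continuation of the Gauss series to the plane cut along
  the real half-line from 1 to infinity. On that slit domain it is determined uniquely; its values
  on the cut are unspecified.\<close>

definition hypergeom_2F1 :: "complex \<Rightarrow> complex \<Rightarrow> complex \<Rightarrow> complex \<Rightarrow> complex" where
  "hypergeom_2F1 a b c = (SOME f. f holomorphic_on - (complex_of_real ` {1..}) \<and>
     (\<forall>w\<in>ball 0 1. f w =
        (\<Sum>k. pochhammer a k * pochhammer b k / (pochhammer c k * fact k) * w ^ k)))"

definition real_2F1 :: "real \<Rightarrow> real \<Rightarrow> real \<Rightarrow> real \<Rightarrow> real" where
  "real_2F1 a b c x =
     Re (hypergeom_2F1 (complex_of_real a) (complex_of_real b) (complex_of_real c) (complex_of_real x))"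

definition r_dist :: "real^3 \<Rightarrow> real^3 \<Rightarrow> real" where
  "r_dist P Q = sqrt ((P$1 - Q$1)\<^sup>2 + (P$2 - Q$2)\<^sup>2 + (P$3 - Q$3)\<^sup>2)"

definition r1_dist :: "real^3 \<Rightarrow> real^3 \<Rightarrow> real" where
  "r1_dist P Q = sqrt ((P$1 + Q$1)\<^sup>2 + (P$2 - Q$2)\<^sup>2 + (P$3 - Q$3)\<^sup>2)"

definition q2 :: "real \<Rightarrow> real^3 \<Rightarrow> real^3 \<Rightarrow> real" where
  "q2 \<alpha> P Q = 1 / (2 * pi) * r_dist P Q powr (2 * \<alpha> - 3)
     * (P$1) powr (1 - 2 * \<alpha>) * (Q$1) powr (1 - 2 * \<alpha>)
     * real_2F1 (3/2 - \<alpha>) (1 - \<alpha>) (2 - 2 * \<alpha>) (1 - (r1_dist P Q)\<^sup>2 / (r_dist P Q)\<^sup>2)"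

definition partial_deriv :: "3 \<Rightarrow> (real^3 \<Rightarrow> real) \<Rightarrow> real^3 \<Rightarrow> real" where
  "partial_deriv i u P = deriv (\<lambda>h. u (P + h *\<^sub>R axis i 1)) 0"

text \<open>For a unit vector \<open>n\<close> the components are the direction cosines.\<close>

definition conormal :: "real \<Rightarrow> real^3 \<Rightarrow> (real^3 \<Rightarrow> real) \<Rightarrow> real^3 \<Rightarrow> real" where
  "conormal \<alpha> n u P = (P$1) powr (2 * \<alpha>) *
     (n$1 * partial_deriv 1 u P + n$2 * partial_deriv 2 u P + n$3 * partial_deriv 3 u P)"


section \<open>Surfaces\<close>

text \<open>\<open>n\<close> is a unit vector orthogonal to the tangent plane of \<open>S\<close> at \<open>N\<close>: the angle between \<open>n\<close>
  and the secants \<open>Q - N\<close> tends to a right angle. The notion refers to \<open>S\<close> as a point set, so that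
  points where the two partial derivatives of a parametrization are parallel are covered too.\<close>

definition unit_normal :: "(real^3) set \<Rightarrow> real^3 \<Rightarrow> real^3 \<Rightarrow> bool" where
  "unit_normal S N n \<longleftrightarrow> norm n = 1 \<and>
     ((\<lambda>Q. (n \<bullet> (Q - N)) / norm (Q - N)) \<longlongrightarrow> 0) (at N within S)"

definition topological_surface :: "(real^3) set \<Rightarrow> bool" where
  "topological_surface S \<longleftrightarrow>
     (\<forall>N\<in>S. \<exists>U. openin (top_of_set S) U \<and> N \<in> U \<and> U homeomorphic (ball 0 1 :: (real^2) set))"

definition lyapunov_surface :: "(real^3) set \<Rightarrow> bool" where
  "lyapunov_surface S \<longleftrightarrow> topological_surface S \<and>
     (\<exists>\<nu>. (\<forall>N\<in>S. unit_normal S N (\<nu> N)) \<and>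
        (\<exists>d>0. \<forall>N\<in>S. \<forall>P \<in> S \<inter> ball N d. \<forall>Q \<in> S \<inter> ball N d. \<forall>c.
           Q = P + c *\<^sub>R \<nu> N \<longrightarrow> Q = P) \<and>
        (\<exists>A>0. \<exists>l. 0 < l \<and> l \<le> 1 \<and>
           (\<forall>P\<in>S. \<forall>Q\<in>S. arccos (\<nu> P \<bullet> \<nu> Q) \<le> A * dist P Q powr l)))"

definition outer_normal :: "(real^3) set \<Rightarrow> (real^3) set \<Rightarrow> real^3 \<Rightarrow> real^3 \<Rightarrow> bool" where
  "outer_normal D S N n \<longleftrightarrow> unit_normal S N n \<and>
     (\<forall>\<^sub>F h in at_right 0. N - h *\<^sub>R n \<in> D \<and> N + h *\<^sub>R n \<notin> closure D)"

definition normal_line :: "real^3 \<Rightarrow> real^3 \<Rightarrow> (real^3) set" where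
  "normal_line N n = {N + h *\<^sub>R n | h. True}"


section \<open>Parametrized surfaces\<close>

text \<open>The derivatives are taken within the closed parameter interval, hence one-sided on the
  boundary of the rectangle.\<close>

definition param_ds :: "real \<Rightarrow> real \<Rightarrow> (real \<times> real \<Rightarrow> real^3) \<Rightarrow> real \<times> real \<Rightarrow> real^3" where
  "param_ds s1 s2 \<phi> p = vector_derivative (\<lambda>s. \<phi> (s, snd p)) (at (fst p) within {s1..s2})"

definition param_dt :: "real \<Rightarrow> real \<Rightarrow> (real \<times> real \<Rightarrow> real^3) \<Rightarrow> real \<times> real \<Rightarrow> real^3" where
  "param_dt t1 t2 \<phi> p = vector_derivative (\<lambda>t. \<phi> (fst p, t)) (at (snd p) within {t1..t2})"

definition area_element ::
    "real \<Rightarrow> real \<Rightarrow> real \<Rightarrow> real \<Rightarrow> (real \<times> real \<Rightarrow> real^3) \<Rightarrow> real \<times> real \<Rightarrow> real" where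
  "area_element s1 s2 t1 t2 \<phi> p = norm (cross3 (param_ds s1 s2 \<phi> p) (param_dt t1 t2 \<phi> p))"

definition surface_integrable ::
    "real \<Rightarrow> real \<Rightarrow> real \<Rightarrow> real \<Rightarrow> (real \<times> real \<Rightarrow> real^3) \<Rightarrow> (real \<times> real \<Rightarrow> real) \<Rightarrow> bool" where
  "surface_integrable s1 s2 t1 t2 \<phi> f \<longleftrightarrow>
     set_integrable lebesgue ({s1..s2} \<times> {t1..t2}) (\<lambda>p. f p * area_element s1 s2 t1 t2 \<phi> p)"

definition surface_integral ::
    "real \<Rightarrow> real \<Rightarrow> real \<Rightarrow> real \<Rightarrow> (real \<times> real \<Rightarrow> real^3) \<Rightarrow> (real \<times> real \<Rightarrow> real) \<Rightarrow> real" where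
  "surface_integral s1 s2 t1 t2 \<phi> f =
     set_lebesgue_integral lebesgue ({s1..s2} \<times> {t1..t2}) (\<lambda>p. f p * area_element s1 s2 t1 t2 \<phi> p)"


section \<open>The domain\<close>

text \<open>The open surface \<open>\<Gamma>\<close> lies in \<open>x > 0\<close>; its closure, which adds the boundary curve \<open>\<gamma>\<close>, is the
  image of the closed rectangle. The assumption \<open>simple_cover\<close> makes integration over the parameter
  rectangle integration over the surface: up to a null set, no piece of positive area is covered
  twice. It holds if \<open>\<phi>\<close> is injective on the open rectangle, but seams, edges mapped onto each
  other, and parameter regions that collapse to curves are allowed.\<close>

locale lyapunov_domain =
  fixes D X \<Gamma> \<gamma> :: "(real^3) set"
    and \<phi> :: "real \<times> real \<Rightarrow> real^3"
    and s1 s2 t1 t2 t0 :: real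
  assumes base_plane: "X \<subseteq> {P. P$1 = 0}"
    and base_open: "openin (top_of_set {P. P$1 = 0}) X"
    and base_nonempty: "X \<noteq> {}"
    and base_simply_connected: "simply_connected X"
    and surface_pos: "\<Gamma> \<subseteq> {P. P$1 > 0}"
    and surface_lyapunov: "lyapunov_surface \<Gamma>"
    and domain_nonempty: "D \<noteq> {}"
    and domain_open: "open D"
    and domain_connected: "connected D"
    and domain_bounded: "bounded D"
    and domain_boundary: "frontier D = closure X \<union> closure \<Gamma>"
    and curve_base: "\<gamma> = closure X - X"
    and curve_surface: "\<gamma> = closure \<Gamma> - \<Gamma>"
    and rectangle: "s1 < s2" "t1 < t2"
    and parametrization: "\<phi> ` ({s1..s2} \<times> {t1..t2}) = closure \<Gamma>"
    and simple_cover: "negligible {p \<in> {s1..s2} \<times> {t1..t2}. area_element s1 s2 t1 t2 \<phi> p \<noteq> 0 \<and>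
                         (\<exists>q \<in> {s1..s2} \<times> {t1..t2}. q \<noteq> p \<and> \<phi> q = \<phi> p)}"
    and t0_range: "t1 \<le> t0" "t0 \<le> t2"
    and t0_plane: "\<And>s. s \<in> {s1..s2} \<Longrightarrow> \<phi> (s, t0) $ 1 = 0"
    and curve_parametrization: "(\<lambda>s. \<phi> (s, t0)) ` {s1..s2} = \<gamma>"
    and diff_s: "\<And>s t. s \<in> {s1..s2} \<Longrightarrow> t \<in> {t1..t2} \<Longrightarrow>
                   (\<lambda>s'. \<phi> (s', t)) differentiable (at s within {s1..s2})"
    and diff_t: "\<And>s t. s \<in> {s1..s2} \<Longrightarrow> t \<in> {t1..t2} \<Longrightarrow>
                   (\<lambda>t'. \<phi> (s, t')) differentiable (at t within {t1..t2})"
    and cont_ds: "continuous_on ({s1..s2} \<times> {t1..t2}) (param_ds s1 s2 \<phi>)"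
    and cont_dt: "continuous_on ({s1..s2} \<times> {t1..t2}) (param_dt t1 t2 \<phi>)"
    and ds_nonzero: "\<And>p. p \<in> {s1..s2} \<times> {t1..t2} \<Longrightarrow> param_ds s1 s2 \<phi> p \<noteq> 0"
    and dt_nonzero: "\<And>p. p \<in> {s1..s2} \<times> {t1..t2} \<Longrightarrow> param_dt t1 t2 \<phi> p \<noteq> 0"
    and right_angle: "\<And>e. e > 0 \<Longrightarrow> \<exists>\<delta>>0. \<forall>P\<in>\<Gamma>. \<forall>n.
                        unit_normal \<Gamma> P n \<longrightarrow> infdist P \<gamma> < \<delta> \<longrightarrow> \<bar>n$1\<bar> < e"


section \<open>Single-layer potential\<close>

definition single_layer ::
    "real \<Rightarrow> real \<Rightarrow> real \<Rightarrow> real \<Rightarrow> real \<Rightarrow> (real \<times> real \<Rightarrow> real^3) \<Rightarrow> (real \<times> real \<Rightarrow> real)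
      \<Rightarrow> real^3 \<Rightarrow> real" where
  "single_layer \<alpha> s1 s2 t1 t2 \<phi> \<rho> P =
     surface_integral s1 s2 t1 t2 \<phi> (\<lambda>p. \<rho> p * q2 \<alpha> (\<phi> p) P)"

text \<open>The conormal derivative acts on the second argument of \<open>q2\<close>, that is, at the point of the
  surface with parameters \<open>p\<close>, where \<open>n\<close> is the normal; \<open>\<tau>\<close> is the integration variable.\<close>

definition kernel_K2 ::
    "real \<Rightarrow> (real \<times> real \<Rightarrow> real^3) \<Rightarrow> real^3 \<Rightarrow> real \<times> real \<Rightarrow> real \<times> real \<Rightarrow> real" where
  "kernel_K2 \<alpha> \<phi> n \<tau> p = conormal \<alpha> n (\<lambda>P. q2 \<alpha> (\<phi> \<tau>) P) (\<phi> p)"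

end

theory Submission
  imports Defs "HOL-Complex_Analysis.Complex_Analysis"
begin

no_notation fps_nth (infixl "$" 75)

text \<open>The fundamental solution is elementary:
  \<open>q2 = (2 x \<xi>)^b / (2 \<pi> r r1 (r + r1)^b)\<close> with \<open>b = 1 - 2 \<alpha>\<close>, so its conormal derivative is
  \<open>- 1/(4 \<pi>) n \<bullet> (M - Q) / r^3\<close> up to a continuous factor that is 1 on the diagonal and an
  error of order \<open>1/r\<close>. Near \<open>N\<close> a Lyapunov surface is a graph over its tangent plane whose height
  is of order \<open>|u|^(1 + l)\<close>. On the normal, at height \<open>h\<close>, the kernel therefore differs from that of
  the flat plane by a function dominated by a multiple of \<open>|u|^(l - 2)\<close>, which is integrable, and
  dominated convergence applies to the difference. The flat kernel \<open>h / (|u|^2 + h^2)^(3/2)\<close> is an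
  approximate identity whose mass over a square tends to \<open>\<plusminus> 2 \<pi>\<close>; this is the jump. The integral
  over the parameter rectangle is turned into one over the tangent plane by the change of variables
  formula, Sard's theorem taking care of the parameters where the area element vanishes.\<close>

text \<open>The obstacle is that near \<open>N\<close> the surface is known only as a point set with
  normals: the parametrization may be singular at a parameter of \<open>N\<close>, and several
  parameters may be mapped to \<open>N\<close>. The graph is therefore obtained by topology: the
  condition on lines parallel to the normal makes the projection to the tangent plane injective, and
  invariance of domain makes it open. Differentiability of the height along rays is then read off
  from the normals alone. Since the conormal derivative off the surface is taken in the fixed
  direction \<open>n\<close> of \<open>N\<close>, the singular numerator is just h minus the height
  of the graph. The size of the jump is the diagonal factor 1/(4 pi) times the mass 2 pi, and the
  minus sign of the kernel makes it negative on the side to which \<open>n\<close> points. Away from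
  \<open>N\<close> a constant majorant is enough, also at the edge of the surface, because the
  estimates degenerate only when \<open>M\<close>, and not when \<open>Q\<close>, approaches the
  plane x = 0.\<close>

abbreviation square :: "real \<Rightarrow> (real \<times> real) set" where
  "square d \<equiv> cbox (-d, -d) (d, d)"


section \<open>The hypergeometric function\<close>

abbreviation slit :: "complex set" where "slit \<equiv> - (complex_of_real ` {1..})"

lemma open_slit: "open slit"
proof -
  have "closed (complex_of_real ` {1..})"
    by (intro closed_injective_linear_image) (auto simp: inj_def intro!: linearI)
  then show ?thesis by auto
qed

text \<open>Serves to make the slit plane connected, so that agreement near 0 determines a
  holomorphic function on it. A segment from 0 that meets the cut ends on the cut, further
  out.\<close>

lemma starlike_slit: "starlike slit"
proof -
  have "\<forall>x\<in>slit. closed_segment 0 x \<subseteq> slit"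
  proof (intro ballI subsetI ComplI)
    fix x y assume x: "x \<in> slit" and y: "y \<in> closed_segment 0 x" and "y \<in> complex_of_real ` {1..}"
    then obtain u a where u: "0 \<le> u" "u \<le> 1" "y = u *\<^sub>R x" and a: "a \<ge> 1" "y = complex_of_real a"
      by (auto simp: in_segment)
    then have "u > 0" by (cases "u = 0") auto
    then have "x = complex_of_real (a / u)"
      using u a by (simp add: scaleR_conv_of_real field_simps)
    moreover have "a / u \<in> {1..}" using \<open>u > 0\<close> u a by (simp add: field_simps)
    ultimately show False using x by blast
  qed
  moreover have "0 \<in> slit" by auto
  ultimately show ?thesis unfolding starlike_def by blast
qed

lemma ball_slit: "ball 0 1 \<subseteq> slit"
proof (intro subsetI ComplI)
  fix x assume "x \<in> ball (0::complex) 1" "x \<in> complex_of_real ` {1..}"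
  then obtain a where "a \<ge> 1" "x = of_real a" by auto
  then show False using \<open>x \<in> ball 0 1\<close> by simp
qed

lemma slit_nonpos: "w \<in> slit \<Longrightarrow> 1 - w \<notin> \<real>\<^sub>\<le>\<^sub>0"
proof
  assume w: "w \<in> slit" and "1 - w \<in> \<real>\<^sub>\<le>\<^sub>0"
  then obtain a where a: "1 - w = complex_of_real a" "a \<le> 0" by (auto elim!: nonpos_Reals_cases)
  then have "w = of_real (1 - a)" by (simp add: algebra_simps)
  moreover have "1 - a \<in> {1..}" using a by simp
  ultimately show False using w by blast
qed

text \<open>A principal root with zero real part squares to a non-positive real, which
  \<open>1 - w\<close> is not. Hence \<open>1 + csqrt (1 - w)\<close> stays in the right half-plane,
  off the cut of \<open>powr\<close>.\<close>

lemma Re_csqrt_slit: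
  assumes "w \<in> slit" shows "Re (csqrt (1 - w)) > 0"
proof (rule ccontr)
  assume "\<not> ?thesis"
  then have "Re (csqrt (1 - w)) = 0"
    using csqrt_principal [of "1 - w"] by auto
  then have *: "csqrt (1 - w) = \<i> * of_real (Im (csqrt (1 - w)))"
    by (simp add: complex_eq_iff)
  have "1 - w = (csqrt (1 - w))\<^sup>2" by simp
  also have "\<dots> = - of_real ((Im (csqrt (1 - w)))\<^sup>2)"
    by (subst *) (simp add: power_mult_distrib)
  finally have "1 - w = of_real (- (Im (csqrt (1 - w)))\<^sup>2)" by simp
  then have "1 - w \<in> \<real>\<^sub>\<le>\<^sub>0"
    by (metis neg_le_0_iff_le nonpos_Reals_of_real_iff zero_le_power2)
  then show False using slit_nonpos assms by blast
qed

text \<open>Turns a differential equation valid near 0 into an identity of formal power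
  series.\<close>

lemma fps_expansion_eqI:
  fixes F G :: "complex fps"
  assumes "f has_fps_expansion F" "g has_fps_expansion G" "eventually (\<lambda>w. f w = g w) (nhds 0)"
  shows "F = G"
proof -
  have "f has_fps_expansion G"
    using has_fps_expansion_cong[OF assms(3) refl] assms(2) by blast
  then show ?thesis using assms(1) by (rule fps_expansion_unique_complex[symmetric])
qed

section \<open>Closed form on the slit plane and its differential system\<close>

context
  fixes c :: real
  assumes c: "c > 0"
begin

text \<open>This is \<open>F(c/2, (c+1)/2; c+1; w)\<close>, contiguous to the function that is
  wanted. It serves as the second unknown that closes the first-order system. In the application
  \<open>c\<close> is \<open>1 - 2 * \<alpha>\<close>.\<close>

definition half_power :: "complex \<Rightarrow> complex" where
  "half_power w = ((1 + csqrt (1 - w)) / 2) powr (- of_real c)"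

definition closed_2F1 :: "complex \<Rightarrow> complex" where
  "closed_2F1 w = half_power w / csqrt (1 - w)"

lemma deriv_csqrt_slit:
  assumes "w \<in> slit"
  shows "((\<lambda>w. csqrt (1 - w)) has_field_derivative - 1 / (2 * csqrt (1 - w))) (at w)"
proof -
  have "((\<lambda>w. 1 - w) has_field_derivative - 1) (at w)" by (auto intro!: derivative_eq_intros)
  from DERIV_chain2[OF has_field_derivative_csqrt[OF slit_nonpos[OF assms]] this]
  show ?thesis by (simp add: inverse_eq_divide)
qed

lemma csqrt_slit_nz:
  assumes "w \<in> slit"
  shows "csqrt (1 - w) \<noteq> 0" "1 + csqrt (1 - w) \<noteq> 0" "(1 + csqrt (1 - w)) / 2 \<notin> \<real>\<^sub>\<le>\<^sub>0"
proof -
  have R: "Re (csqrt (1 - w)) > 0" by (rule Re_csqrt_slit[OF assms])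
  show "csqrt (1 - w) \<noteq> 0" using R by (metis less_irrefl zero_complex.sel(1))
  have "Re (1 + csqrt (1 - w)) > 0" using R by (simp del: csqrt.sel)
  then show "1 + csqrt (1 - w) \<noteq> 0" by (metis less_irrefl zero_complex.sel(1))
  have "Re ((1 + csqrt (1 - w)) / 2) > 0" using R by (simp del: csqrt.sel)
  then show "(1 + csqrt (1 - w)) / 2 \<notin> \<real>\<^sub>\<le>\<^sub>0"
    using complex_nonpos_Reals_iff by (meson not_le)
qed

lemma half_power_deriv:
  assumes w: "w \<in> slit"
  shows "(half_power has_field_derivative
     (c / 2) * closed_2F1 w / (1 + csqrt (1 - w))) (at w)"
proof -
  let ?S = "csqrt (1 - w)"
  note nz = csqrt_slit_nz[OF w]
  have "((\<lambda>w. (1 + csqrt (1 - w)) / 2) has_field_derivative ((- 1 / (2 * ?S)) / 2)) (at w)"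
    by (rule DERIV_cdivide, rule DERIV_add[OF DERIV_const deriv_csqrt_slit[OF w], THEN DERIV_cong]) simp
  from DERIV_chain2[OF has_field_derivative_powr[OF nz(3)] this, of "- of_real c"]
  have "(half_power has_field_derivative
     (- of_real c) * ((1 + ?S) / 2) powr (- of_real c - 1) * ((- 1 / (2 * ?S)) / 2)) (at w)"
    by (simp only: half_power_def[abs_def])
  also have "((1 + ?S) / 2) powr (- of_real c - 1) = half_power w / ((1 + ?S) / 2)"
    using nz unfolding half_power_def by (subst powr_diff) auto
  also have "(- of_real c) * (half_power w / ((1 + ?S) / 2)) * ((- 1 / (2 * ?S)) / 2) = (c / 2) * (half_power w / ?S) / (1 + ?S)"
    using nz by simp
  finally show ?thesis unfolding closed_2F1_def .
qed

lemma closed_2F1_deriv_aux: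
  fixes x y z :: complex
  assumes "z \<noteq> 0"
  shows "(x * z - y * (- 1 / (2 * z))) / (z * z) = (x + (y/z) / (2 * z)) / z"
  using assms by (simp add: divide_simps)

lemma closed_2F1_deriv:
  assumes w: "w \<in> slit"
  shows "(closed_2F1 has_field_derivative
     ((c / 2) * closed_2F1 w / (1 + csqrt (1 - w)) + closed_2F1 w / (2 * csqrt (1 - w))) / csqrt (1 - w)) (at w)"
proof -
  let ?S = "csqrt (1 - w)"
  note nz = csqrt_slit_nz[OF w]
  have eq: "closed_2F1 = (\<lambda>w. half_power w / csqrt (1 - w))" by (auto simp: closed_2F1_def)
  have "((\<lambda>w. half_power w / csqrt (1 - w)) has_field_derivative
     ((c / 2) * closed_2F1 w / (1 + ?S) * ?S - half_power w * (- 1 / (2 * ?S))) / (?S * ?S)) (at w)"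
    by (rule DERIV_divide[OF half_power_deriv[OF w] deriv_csqrt_slit[OF w] nz(1)])
  also have "((c / 2) * closed_2F1 w / (1 + ?S) * ?S - half_power w * (- 1 / (2 * ?S))) / (?S * ?S)
     = ((c / 2) * closed_2F1 w / (1 + ?S) + (half_power w / ?S) / (2 * ?S)) / ?S"
    using closed_2F1_deriv_aux[OF nz(1)] .
  finally show ?thesis by (simp only: closed_2F1_def[abs_def])
qed

lemma half_power_holomorphic: "half_power holomorphic_on slit" and closed_2F1_holomorphic: "closed_2F1 holomorphic_on slit"
  using holomorphic_on_open[OF open_slit] half_power_deriv closed_2F1_deriv by meson+

text \<open>The pair \<open>half_power, closed_2F1\<close> solves a first-order linear system with polynomial coefficients; comparing
  power series coefficients there gives the recurrence of the Gauss series.\<close>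

lemma half_power_ode:
  assumes w: "w \<in> slit"
  shows "w * deriv half_power w = (c / 2) * (closed_2F1 w - half_power w)"
proof -
  let ?S = "csqrt (1 - w)"
  note nz = csqrt_slit_nz[OF w]
  have w3: "1 - w = ?S * ?S" by (simp flip: power2_eq_square)
  have w2: "w = (1 - ?S) * (1 + ?S)" using w3 by (simp add: algebra_simps)
  have h: "half_power w = closed_2F1 w * ?S" using nz by (simp add: closed_2F1_def)
  have "w * deriv half_power w = ((1 - ?S) * (1 + ?S)) * ((c / 2) * closed_2F1 w / (1 + ?S))"
    using DERIV_imp_deriv[OF half_power_deriv[OF w]] w2 by metis
  also have "\<dots> = (1 - ?S) * ((1 + ?S) * ((c / 2) * closed_2F1 w / (1 + ?S)))"
    by (simp only: mult.assoc)
  also have "(1 + ?S) * ((c / 2) * closed_2F1 w / (1 + ?S)) = (c / 2) * closed_2F1 w"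
    using nz(2) by (metis nonzero_mult_div_cancel_left times_divide_eq_right)
  also have "(1 - ?S) * ((c / 2) * closed_2F1 w) = (c / 2) * (closed_2F1 w - half_power w)"
    unfolding h by algebra
  finally show ?thesis .
qed

lemma closed_2F1_ode_aux0: "x * y * (u + v) = y * (x * u) + x * (y * v)" for x y u v :: complex
  by algebra

lemma closed_2F1_ode_aux:
  fixes z k g :: complex
  assumes "z \<noteq> 0" "1 + z \<noteq> 0"
  shows "((1 - z) * (1 + z)) * (z * z) * ((k * g / (1 + z) + g / (2 * z)) / z)
    = k * (g * z - (z * z) * g) + ((1 - z) * (1 + z)) * g / 2"
proof -
  have "((1 - z) * (1 + z)) * (z * z) * ((k * g / (1 + z) + g / (2 * z)) / z)
    = (1 - z) * ((1 + z) * z * (z * ((k * g / (1 + z) + g / (2 * z)) / z)))"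
    by (simp only: mult_ac)
  also have "z * ((k * g / (1 + z) + g / (2 * z)) / z) = k * g / (1 + z) + g / (2 * z)"
    using assms(1) by simp
  also have "(1 + z) * z * (k * g / (1 + z) + g / (2 * z))
      = z * ((1 + z) * (k * g / (1 + z))) + (1 + z) * (z * (g / (2 * z)))"
    by (rule closed_2F1_ode_aux0)
  also have "(1 + z) * (k * g / (1 + z)) = k * g"
    using assms(2) by (metis nonzero_mult_div_cancel_left times_divide_eq_right)
  also have "z * (g / (2 * z)) = g / 2" using assms(1) by simp
  finally show ?thesis by (simp add: algebra_simps)
qed

text \<open>With S for the root, the factorizations w = (1 - S) (1 + S) and 1 - w = S^2 cancel all
  denominators. What remains is linear in \<open>closed_2F1 w\<close> and
  \<open>closed_2F1 w * S\<close>, and the latter is \<open>half_power w\<close>.\<close>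

lemma closed_2F1_ode:
  assumes w: "w \<in> slit"
  shows "w * (1 - w) * deriv closed_2F1 w = (c / 2) * (half_power w - (1 - w) * closed_2F1 w) + w * closed_2F1 w / 2"
proof -
  let ?S = "csqrt (1 - w)"
  note nz = csqrt_slit_nz[OF w]
  have w3: "1 - w = ?S * ?S" by (simp flip: power2_eq_square)
  have w2: "w = (1 - ?S) * (1 + ?S)" using w3 by (simp add: algebra_simps)
  have h: "half_power w = closed_2F1 w * ?S" using nz by (simp add: closed_2F1_def)
  have "w * (1 - w) * deriv closed_2F1 w = ((1 - ?S) * (1 + ?S)) * (?S * ?S) *
     (((c / 2) * closed_2F1 w / (1 + ?S) + closed_2F1 w / (2 * ?S)) / ?S)"
    using DERIV_imp_deriv[OF closed_2F1_deriv[OF w]] w2 w3 by metis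
  also have "\<dots> = (c / 2) * (half_power w - (?S*?S) * closed_2F1 w) + ((1 - ?S) * (1 + ?S)) * closed_2F1 w / 2"
    unfolding h by (rule closed_2F1_ode_aux[OF nz(1,2)])
  finally show ?thesis using w2 w3 by metis
qed

section \<open>Comparison with the Gauss series\<close>

definition coeff_2F1 :: "nat \<Rightarrow> complex" where
  "coeff_2F1 k = pochhammer (of_real (1 + c/2)) k * pochhammer (of_real ((1 + c)/2)) k
      / (pochhammer (of_real (1 + c)) k * fact k)"

text \<open>Each equation of the system gives a relation between the coefficients of the two
  functions. The one for \<open>half_power\<close> expresses its coefficient of index
  \<open>Suc n\<close> through that of \<open>closed_2F1\<close>, as 2 (n + 1) + c is not 0.
  Inserted into the other one, it leaves a two-term recurrence whose ratio is that of the Gauss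
  series; the value 1 at 0 starts it.\<close>

lemma closed_2F1_coeffs: "fps_nth (fps_expansion closed_2F1 0) k = coeff_2F1 k"
proof -
  define G where "G = fps_expansion closed_2F1 0"
  define H where "H = fps_expansion half_power 0"
  have sub: "ball 0 1 \<subseteq> slit" by (rule ball_slit)
  have "closed_2F1 analytic_on {0}" "half_power analytic_on {0}"
    using analytic_on_open[OF open_slit] closed_2F1_holomorphic half_power_holomorphic sub
    by (meson analytic_on_subset centre_in_ball empty_subsetI insert_subset subset_trans zero_less_one subsetD)+
  then have G: "closed_2F1 has_fps_expansion G" and H: "half_power has_fps_expansion H"
    unfolding G_def H_def by (auto intro: analytic_at_imp_has_fps_expansion_0)
  have ev: "eventually (\<lambda>w. w \<in> slit) (nhds (0::complex))"
    using open_slit sub by (intro eventually_nhds_in_open) auto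
  have eq1: "fps_X * fps_deriv H = fps_const (of_real (c/2)) * (G - H)"
  proof (rule fps_expansion_eqI)
    show "(\<lambda>w. w * deriv half_power w) has_fps_expansion fps_X * fps_deriv H"
      by (intro fps_expansion_intros H)
    show "(\<lambda>w. of_real (c / 2) * (closed_2F1 w - half_power w)) has_fps_expansion fps_const (of_real (c/2)) * (G - H)"
      by (intro fps_expansion_intros H G)
    show "eventually (\<lambda>w. w * deriv half_power w = of_real (c / 2) * (closed_2F1 w - half_power w)) (nhds 0)"
      using ev by eventually_elim (use half_power_ode in auto)
  qed
  have eq2: "fps_X * (1 - fps_X) * fps_deriv G
     = fps_const (of_real (c/2)) * (H - (1 - fps_X) * G) + fps_const (1/2) * (fps_X * G)"
  proof (rule fps_expansion_eqI)
    show "(\<lambda>w. w * (1 - w) * deriv closed_2F1 w) has_fps_expansion fps_X * (1 - fps_X) * fps_deriv G"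
      by (intro fps_expansion_intros G)
    show "(\<lambda>w. of_real (c / 2) * (half_power w - (1 - w) * closed_2F1 w) + (1/2) * (w * closed_2F1 w))
      has_fps_expansion fps_const (of_real (c/2)) * (H - (1 - fps_X) * G) + fps_const (1/2) * (fps_X * G)"
      by (intro fps_expansion_intros H G)
    show "eventually (\<lambda>w. w * (1 - w) * deriv closed_2F1 w
      = of_real (c / 2) * (half_power w - (1 - w) * closed_2F1 w) + (1/2) * (w * closed_2F1 w)) (nhds 0)"
      using ev by eventually_elim (use closed_2F1_ode in simp)
  qed
  have h: "of_nat n * fps_nth H n = of_real (c/2) * (fps_nth G n - fps_nth H n)" for n
    using arg_cong[OF eq1, of "\<lambda>f. fps_nth f n"] by (cases n) auto
  have g: "of_nat (Suc n) * fps_nth G (Suc n) - of_nat n * fps_nth G n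
      = of_real (c/2) * (fps_nth H (Suc n) - fps_nth G (Suc n) + fps_nth G n) + fps_nth G n / 2" for n
  proof -
    have l: "fps_nth (fps_X * (1 - fps_X) * fps_deriv G) (Suc n)
        = of_nat (Suc n) * fps_nth G (Suc n) - of_nat n * fps_nth G n"
      by (cases n) (simp_all add: mult.assoc left_diff_distrib)
    have r: "fps_nth (fps_const (of_real (c/2)) * (H - (1 - fps_X) * G) + fps_const (1/2) * (fps_X * G)) (Suc n)
        = of_real (c/2) * (fps_nth H (Suc n) - (fps_nth G (Suc n) - fps_nth G n)) + fps_nth G n / 2"
      by (simp add: left_diff_distrib)
    show ?thesis using l r eq2 by (metis diff_diff_eq2 diff_add_eq)
  qed
  have nz: "of_nat n + complex_of_real c \<noteq> 0" "2 * of_nat n + complex_of_real c \<noteq> 0" for n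
  proof -
    have "Re (of_nat n + complex_of_real c) > 0" "Re (2 * of_nat n + complex_of_real c) > 0"
      using c by (auto intro: add_nonneg_pos)
    then show "of_nat n + complex_of_real c \<noteq> 0" "2 * of_nat n + complex_of_real c \<noteq> 0"
      by (metis less_irrefl zero_complex.sel(1))+
  qed
  have G0: "fps_nth G 0 = 1"
    by (simp add: closed_2F1_def half_power_def G_def fps_expansion_def)
  define C where "C = complex_of_real c"
  have rec: "fps_nth G (Suc n) * (of_nat (Suc n) * (of_nat (Suc n) + C))
     = fps_nth G n * ((of_nat (Suc n) + C/2) * (of_nat (Suc n) - 1/2 + C/2))" for n
  proof -
    define m where "m = (of_nat (Suc n) :: complex)"
    define x where "x = fps_nth G (Suc n)"
    define y where "y = fps_nth G n"
    define z where "z = fps_nth H (Suc n)"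
    have nzm: "2 * m + C \<noteq> 0" using nz(2)[of "Suc n"] by (simp add: m_def C_def)
    have "m * z = C/2 * (x - z)" using h[of "Suc n"] by (simp add: m_def C_def x_def z_def)
    then have z: "z = C * x / (2 * m + C)" using nzm by (simp add: field_simps)
    have g': "m * x - (m - 1) * y = C/2 * (z - x + y) + y / 2"
      using g[of n] unfolding m_def C_def x_def z_def y_def by (simp del: of_nat_Suc) simp
    have "x * (m * (m + C)) = y * ((m + C/2) * (m - 1/2 + C/2))"
    proof -
      have z': "z * (2 * m + C) = C * x" using z nzm by simp
      have g2: "2 * (m * x - (m - 1) * y) = C * (z - x + y) + y"
        unfolding g' by simp
      have "x * (m * (m + C)) * 4 = y * ((2 * m + C) * (2 * m - 1 + C))"
        using g2 z' by algebra
      also have "\<dots> = y * ((m + C/2) * (m - 1/2 + C/2)) * 4"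
        by (simp add: field_simps)
      finally show ?thesis by simp
    qed
    then show ?thesis by (simp add: m_def x_def y_def)
  qed
  have "fps_nth G k = coeff_2F1 k"
  proof (induction k)
    case 0 then show ?case using G0 by (simp add: coeff_2F1_def)
  next
    case (Suc n)
    have nn: "of_nat (Suc n) + C \<noteq> 0" using nz(1)[of "Suc n"] by (simp add: C_def)
    have n0: "(of_nat (Suc n) :: complex) \<noteq> 0" by (simp only: of_nat_eq_0_iff)
    have "coeff_2F1 (Suc n) = coeff_2F1 n * ((of_nat (Suc n) + C/2) * (of_nat (Suc n) - 1/2 + C/2))
        / (of_nat (Suc n) * (of_nat (Suc n) + C))"
    proof -
      have e: "complex_of_real (1 + c/2) + of_nat n = of_nat (Suc n) + C/2"
        "complex_of_real ((1 + c)/2) + of_nat n = of_nat (Suc n) - 1/2 + C/2"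
        "complex_of_real (1 + c) + of_nat n = of_nat (Suc n) + C"
        by (auto simp: field_simps C_def)
      show ?thesis
        unfolding coeff_2F1_def pochhammer_Suc fact_Suc e times_divide_eq_right times_divide_times_eq
        by (simp only: mult_ac divide_divide_eq_left times_divide_eq_left of_nat_mult times_divide_eq_right)
    qed
    moreover have "fps_nth G (Suc n) = fps_nth G n * ((of_nat (Suc n) + C/2) * (of_nat (Suc n) - 1/2 + C/2))
        / (of_nat (Suc n) * (of_nat (Suc n) + C))"
      using rec[of n] nn n0 by (intro eq_divide_imp) (simp_all del: of_nat_Suc)
    ultimately show ?case using Suc.IH by simp
  qed
  then show ?thesis by (simp add: G_def)
qed

lemma closed_2F1_series: "w \<in> ball 0 1 \<Longrightarrow> closed_2F1 w = (\<Sum>k. coeff_2F1 k * w ^ k)"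
proof -
  assume w: "w \<in> ball 0 1"
  have "closed_2F1 holomorphic_on ball 0 1" using closed_2F1_holomorphic ball_slit by (rule holomorphic_on_subset)
  from holomorphic_power_series[OF this w]
  have "(\<lambda>n. fps_nth (fps_expansion closed_2F1 0) n * w ^ n) sums closed_2F1 w"
    by (simp add: fps_expansion_def)
  then show ?thesis by (simp add: closed_2F1_coeffs sums_iff)
qed

text \<open>The closed form satisfies the description behind \<open>SOME\<close>, hence so does the
  chosen function. Both are holomorphic on the connected slit plane and agree on the unit disc, so
  they agree everywhere off the cut, whatever was chosen.\<close>

lemma hypergeom_closed_form:
  assumes w: "w \<in> slit"
  shows "hypergeom_2F1 (of_real (1 + c/2)) (of_real ((1 + c)/2)) (of_real (1 + c)) w = closed_2F1 w"
proof -
  define P where "P f \<longleftrightarrow> f holomorphic_on slit \<and> (\<forall>w\<in>ball 0 1. f w = (\<Sum>k. coeff_2F1 k * w ^ k))" for f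
  have hyp: "hypergeom_2F1 (of_real (1 + c/2)) (of_real ((1 + c)/2)) (of_real (1 + c)) = (SOME f. P f)"
    unfolding hypergeom_2F1_def P_def coeff_2F1_def ..
  have "P closed_2F1" unfolding P_def using closed_2F1_holomorphic closed_2F1_series by blast
  then have P: "P (SOME f. P f)" by (rule someI[of P])
  define f where "f = (SOME f. P f)"
  have "f w - closed_2F1 w = 0"
  proof (rule analytic_continuation[of "\<lambda>w. f w - closed_2F1 w" slit "ball 0 1" 0])
    show "connected slit" using starlike_slit starlike_imp_connected by blast
    show "(\<lambda>w. f w - closed_2F1 w) holomorphic_on slit"
      using P closed_2F1_holomorphic by (auto simp: P_def f_def intro!: holomorphic_intros)
    show "f z - closed_2F1 z = 0" if "z \<in> ball 0 1" for z
      using P closed_2F1_series that by (auto simp: P_def f_def)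
    show "(0::complex) islimpt ball 0 1" by (simp add: islimpt_ball)
    show "0 \<in> slit" using ball_slit by auto
  qed (use ball_slit open_slit w in auto)
  then show ?thesis using hyp by (simp add: f_def)
qed

end

text \<open>All x < 1 are needed: in \<open>q2\<close> the argument \<open>1 - r1^2 / r^2\<close>
  tends to minus infinity as the two points merge off the plane x = 0, so the singularity is
  governed by the continuation and not by the series.\<close>

lemma real_2F1_closed_form:
  assumes "c > 0" and x: "x < 1"
  shows "real_2F1 (1 + c/2) ((1 + c)/2) (1 + c) x = ((1 + sqrt (1 - x)) / 2) powr (- c) / sqrt (1 - x)"
proof -
  have "complex_of_real x \<in> slit" using x by auto
  from hypergeom_closed_form[OF assms(1) this]
  have "real_2F1 (1 + c/2) ((1 + c)/2) (1 + c) x = Re (closed_2F1 c (complex_of_real x))"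
    unfolding real_2F1_def by simp
  moreover have "closed_2F1 c (complex_of_real x) = complex_of_real (((1 + sqrt (1 - x)) / 2) powr (- c) / sqrt (1 - x))"
  proof -
    have "csqrt (1 - complex_of_real x) = complex_of_real (sqrt (1 - x))"
      using x by (metis csqrt_of_real_nonneg diff_ge_0_iff_ge less_imp_le of_real_1 of_real_diff Re_complex_of_real Im_complex_of_real)
    moreover have "((1 + complex_of_real (sqrt (1 - x))) / 2) powr (- of_real c) = complex_of_real (((1 + sqrt (1 - x)) / 2) powr (- c))"
      using x powr_of_real[of "(1 + sqrt (1 - x)) / 2" "-c"] by simp
    ultimately show ?thesis using assms by (simp add: closed_2F1_def half_power_def)
  qed
  ultimately show ?thesis by simp
qed


section \<open>The kernel and its conormal derivative\<close>

text \<open>Introduced so that \<open>r1_dist\<close> becomes an ordinary distance, from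
  \<open>M\<close> to the reflection of \<open>Q\<close> in the plane x = 0; norms and their
  derivatives then treat both distances alike.\<close>

definition mirror :: "real^3 \<Rightarrow> real^3" where
  "mirror Q = Q - (2 * Q$1) *\<^sub>R axis 1 1"

lemma mirror_nth: "mirror Q $ 1 = - Q$1" "mirror Q $ 2 = Q$2" "mirror Q $ 3 = Q$3"
  by (auto simp: mirror_def axis_def)

lemma norm_real3: "norm (v :: real^3) = sqrt ((v$1)\<^sup>2 + (v$2)\<^sup>2 + (v$3)\<^sup>2)"
  by (simp add: norm_vec_def L2_set_def sum_3)

lemma r_dist_norm: "r_dist Q M = norm (M - Q)"
proof -
  have "norm (M - Q) = norm (Q - M)" by (rule norm_minus_commute)
  then show ?thesis by (simp add: r_dist_def norm_real3)
qed

lemma r1_dist_norm: "r1_dist Q M = norm (M - mirror Q)"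
proof -
  have "norm (M - mirror Q) = norm (mirror Q - M)" by (rule norm_minus_commute)
  then have "norm (M - mirror Q) = sqrt ((- Q$1 - M$1)\<^sup>2 + (Q$2 - M$2)\<^sup>2 + (Q$3 - M$3)\<^sup>2)"
    by (simp add: norm_real3 mirror_nth)
  moreover have "(- Q$1 - M$1)\<^sup>2 = (Q$1 + M$1)\<^sup>2" by (simp add: power2_eq_square algebra_simps)
  ultimately show ?thesis by (simp add: r1_dist_def)
qed

lemma r1_ge:
  assumes "Q$1 \<ge> 0" "M$1 \<ge> 0"
  shows "norm (M - mirror Q) \<ge> M$1 + Q$1"
  using component_le_norm_cart[of "M - mirror Q" 1] assms by (simp add: mirror_nth)

lemma q2_aux:
  fixes c R q m A B r d :: real
  shows "c * R * q * m * (A * B * r / d) = c * (A * q * m) * (R * B * r) / d"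
proof -
  have "c * R * q * m * (A * B * r) = c * (A * q * m) * (R * B * r)" by algebra
  then show ?thesis by (simp only: times_divide_eq_right)
qed

text \<open>The hypergeometric function is elementary here because its parameters have the form
  \<open>b, b + 1/2; 2b\<close>. Where the two points coincide both sides are 0, as division by 0 gives 0.\<close>

lemma q2_closed_form:
  assumes \<alpha>: "2 * \<alpha> < 1" and Q: "Q$1 \<ge> 0" and M: "M$1 > 0"
  shows "q2 \<alpha> Q M = 1 / (2 * pi) * (2 * Q$1 * M$1) powr (1 - 2*\<alpha>) /
    (norm (M - Q) * norm (M - mirror Q) * (norm (M - Q) + norm (M - mirror Q)) powr (1 - 2*\<alpha>))"
proof (cases "norm (M - Q) = 0")
  case True
  then show ?thesis by (simp add: q2_def r_dist_norm)
next
  case False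
  define r where "r = norm (M - Q)"
  define r1 where "r1 = norm (M - mirror Q)"
  define b where "b = 1 - 2 * \<alpha>"
  have r: "r > 0" using False by (simp add: r_def)
  have r1: "r1 > 0" using r1_ge[of Q M] M Q by (auto simp: r1_def)
  have b: "b > 0" using \<alpha> by (simp add: b_def)
  have "1 - r1\<^sup>2 / r\<^sup>2 < 1" using r r1 by simp
  from real_2F1_closed_form[OF b this]
  have F: "real_2F1 (1 + b/2) ((1 + b)/2) (1 + b) (1 - r1\<^sup>2 / r\<^sup>2) = ((1 + r1 / r) / 2) powr (- b) / (r1 / r)"
    using r r1 by (simp add: real_sqrt_divide)
  have par: "1 + b/2 = 3/2 - \<alpha>" "(1 + b)/2 = 1 - \<alpha>" "1 + b = 2 - 2*\<alpha>"
    by (auto simp: b_def field_simps)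
  note F = F[unfolded par(1,2), unfolded par(3)]
  have "((1 + r1 / r) / 2) powr (- b) = ((r + r1) / (r * 2)) powr (- b)"
    using r by (simp add: add_divide_distrib)
  also have "\<dots> = (r * 2) powr b / (r + r1) powr b"
    using r r1 by (simp only: powr_minus powr_divide) (simp add: inverse_eq_divide)
  also have "(r * 2) powr b = 2 powr b * r powr b" using r by (simp add: powr_mult)
  finally have E: "((1 + r1 / r) / 2) powr (- b) = (2 powr b * r powr b) / (r + r1) powr b" .
  have F2: "real_2F1 (3/2 - \<alpha>) (1 - \<alpha>) (2 - 2*\<alpha>) (1 - r1\<^sup>2 / r\<^sup>2)
      = 2 powr b * r powr b * r / ((r + r1) powr b * r1)" unfolding F E by simp
  have "r powr (2*\<alpha> - 3) * r powr b * r = r powr (2*\<alpha> - 3) * r powr b * r powr 1" using r by simp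
  also have "\<dots> = r powr (- 1)" by (simp only: powr_add[symmetric]) (simp add: b_def)
  also have "\<dots> = 1 / r" using r by (simp add: powr_minus divide_inverse)
  finally have R: "r powr (2*\<alpha> - 3) * r powr b * r = 1 / r" .
  have "q2 \<alpha> Q M = 1 / (2 * pi) * r powr (2 * \<alpha> - 3) * (Q$1) powr b * (M$1) powr b *
      (2 powr b * r powr b * r / ((r + r1) powr b * r1))"
    unfolding q2_def r_dist_norm r1_dist_norm r_def[symmetric] r1_def[symmetric] F2 b_def[symmetric] ..
  also have "\<dots> = 1 / (2 * pi) * (2 powr b * (Q$1) powr b * (M$1) powr b) * (r powr (2*\<alpha> - 3) * r powr b * r)
      / ((r + r1) powr b * r1)" by (rule q2_aux)
  also have "2 powr b * (Q$1) powr b * (M$1) powr b = (2 * Q$1 * M$1) powr b"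
    by (simp only: powr_mult)
  finally show ?thesis unfolding R r_def[symmetric] r1_def[symmetric] b_def[symmetric] by (rule trans) (simp add: mult.commute)
qed

text \<open>\<open>kern\<close> is the conormal derivative of \<open>q2\<close> in its second argument, split into the
  singular part of a Newtonian double layer and a part of order \<open>1/r\<close>.\<close>

definition weight :: "real \<Rightarrow> real^3 \<Rightarrow> real^3 \<Rightarrow> real" where
  "weight \<alpha> Q M = (M$1) powr (2 * \<alpha>) * (1 / (2 * pi)) * (2 * Q$1 * M$1) powr (1 - 2*\<alpha>) /
    (norm (M - mirror Q) * (norm (M - Q) + norm (M - mirror Q)) powr (1 - 2*\<alpha>))"

text \<open>The logarithmic derivative in direction \<open>v\<close> of all factors of
  \<open>q2\<close> other than \<open>1/r\<close>, namely of x^b / (r1 (r + r1)^b) with b = 1 - 2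
  \<alpha> and x the first coordinate of \<open>M\<close>.\<close>

definition regular_part :: "real \<Rightarrow> real^3 \<Rightarrow> real^3 \<Rightarrow> real^3 \<Rightarrow> real" where
  "regular_part \<alpha> v Q M = (1 - 2*\<alpha>) * v$1 / M$1 - (v \<bullet> (M - mirror Q)) / (norm (M - mirror Q))\<^sup>2
     - (1 - 2*\<alpha>) * ((v \<bullet> (M - Q)) / norm (M - Q) + (v \<bullet> (M - mirror Q)) / norm (M - mirror Q))
         / (norm (M - Q) + norm (M - mirror Q))"

definition kern :: "real \<Rightarrow> real^3 \<Rightarrow> real^3 \<Rightarrow> real^3 \<Rightarrow> real" where
  "kern \<alpha> v Q M = weight \<alpha> Q M * (regular_part \<alpha> v Q M / norm (M - Q) - (v \<bullet> (M - Q)) / norm (M - Q) ^ 3)"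

text \<open>With x and y for the first coordinates of \<open>M\<close> and \<open>Q\<close>, the
  numerator is controlled by x \<le> x + y and 2 x y \<le> (x + y)^2, the denominator by x + y \<le>
  r1, and the powers match exactly. The bound is uniform as \<open>Q\<close> tends to the plane x =
  0, that is, up to the edge of the surface.\<close>

lemma weight_bounds:
  assumes \<alpha>: "0 < 2 * \<alpha>" "2 * \<alpha> < 1" and Q: "Q$1 \<ge> 0" and M: "M$1 > 0"
  shows "0 \<le> weight \<alpha> Q M" "weight \<alpha> Q M \<le> 1 / (2 * pi)"
proof -
  define x where "x = M$1" define y where "y = Q$1"
  define r where "r = norm (M - Q)"
  define r1 where "r1 = norm (M - mirror Q)"
  define b where "b = 1 - 2 * \<alpha>"
  have b: "0 < b" "b < 1" using \<alpha> by (auto simp: b_def)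
  have xy: "x > 0" "y \<ge> 0" using Q M by (auto simp: x_def y_def)
  have r1: "r1 \<ge> x + y" using r1_ge[OF Q] M by (simp add: r1_def x_def y_def)
  have r: "r \<ge> 0" by (simp add: r_def)
  have w: "weight \<alpha> Q M = x powr (1 - b) * (1 / (2 * pi)) * (2 * y * x) powr b / (r1 * (r + r1) powr b)"
    by (simp add: weight_def x_def y_def b_def r_def r1_def)
  show "0 \<le> weight \<alpha> Q M" unfolding w using xy r1 by auto
  have "(2 * y * x) powr b \<le> ((x + y) * (x + y)) powr b"
    using xy b by (intro powr_mono2) (auto simp: algebra_simps)
  also have "\<dots> = (x + y) powr b * (x + y) powr b" using xy by (simp add: powr_mult)
  also have "\<dots> \<le> (x + y) powr b * (r + r1) powr b"
    using xy b r r1 by (intro mult_left_mono powr_mono2) auto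
  finally have 1: "(2 * y * x) powr b \<le> (x + y) powr b * (r + r1) powr b" .
  have "x powr (1 - b) \<le> (x + y) powr (1 - b)" using xy b by (intro powr_mono2) auto
  then have "x powr (1 - b) * (2 * y * x) powr b \<le> (x + y) powr (1 - b) * ((x + y) powr b * (r + r1) powr b)"
    using 1 by (intro mult_mono) auto
  also have "\<dots> = (x + y) * (r + r1) powr b"
    using xy by (simp add: mult.assoc[symmetric] flip: powr_add)
  also have "\<dots> \<le> r1 * (r + r1) powr b" using r1 by (intro mult_right_mono) auto
  finally have 2: "x powr (1 - b) * (2 * y * x) powr b \<le> r1 * (r + r1) powr b" .
  have pos: "r1 * (r + r1) powr b > 0" using r r1 xy by simp
  have "weight \<alpha> Q M = (1 / (2 * pi)) * (x powr (1 - b) * (2 * y * x) powr b / (r1 * (r + r1) powr b))"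
    unfolding w by simp
  also have "\<dots> \<le> (1 / (2 * pi)) * 1"
    using 2 pos by (intro mult_left_mono) (auto simp: divide_le_eq)
  finally show "weight \<alpha> Q M \<le> 1 / (2 * pi)" by simp
qed

text \<open>Here r = 0 and r1 = 2 x, so all powers of x cancel. Multiplied by the mass 2 pi of the
  flat kernel this value is the 1/2 of the jump relation.\<close>

lemma weight_diag:
  assumes M: "M$1 > 0"
  shows "weight \<alpha> M M = 1 / (4 * pi)"
proof -
  have "norm (M - mirror M) = 2 * M$1"
    using M by (simp add: mirror_def)
  moreover have "(2 * M$1 * M$1) powr (1 - 2*\<alpha>) = (2 * M$1) powr (1 - 2*\<alpha>) * (M$1) powr (1 - 2*\<alpha>)"
    using M by (simp add: powr_mult)
  moreover have "(M$1) powr (2 * \<alpha>) * (M$1) powr (1 - 2*\<alpha>) = M$1" using M by (simp flip: powr_add)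
  ultimately have "weight \<alpha> M M = ((M$1) powr (2 * \<alpha>) * (M$1) powr (1 - 2*\<alpha>)) * (1 / (2 * pi)) / (2 * M$1)"
    using M by (simp add: weight_def)
  then show ?thesis using M \<open>(M$1) powr (2 * \<alpha>) * (M$1) powr (1 - 2*\<alpha>) = M$1\<close> by simp
qed

lemma abs_triangle3: "\<bar>u\<bar> \<le> A \<Longrightarrow> \<bar>v\<bar> \<le> B \<Longrightarrow> \<bar>w\<bar> \<le> C \<Longrightarrow> \<bar>u - v - w\<bar> \<le> A + B + C"
  for u v w :: real
  by linarith

text \<open>Inner products with the unit vector \<open>v\<close> are at most r and r1 in absolute
  value, and r1 is at least x, the first coordinate of \<open>M\<close>. The three terms thus
  contribute 1, 1 and 2 times 1/x.\<close>

lemma regular_part_bound: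
  assumes \<alpha>: "0 < 2 * \<alpha>" "2 * \<alpha> < 1" and Q: "Q$1 \<ge> 0" and M: "M$1 > 0" and v: "norm v = 1"
  shows "\<bar>regular_part \<alpha> v Q M\<bar> \<le> 4 / M$1"
proof -
  define x where "x = M$1"
  define r where "r = norm (M - Q)"
  define r1 where "r1 = norm (M - mirror Q)"
  define b where "b = 1 - 2 * \<alpha>"
  have b: "0 < b" "b < 1" using \<alpha> by (auto simp: b_def)
  have x: "x > 0" using M by (auto simp: x_def)
  have r1: "r1 \<ge> x" using r1_ge[of Q M] M Q by (simp add: r1_def x_def)
  have r: "r \<ge> 0" by (simp add: r_def)
  define p where "p = v \<bullet> (M - Q)" define p1 where "p1 = v \<bullet> (M - mirror Q)"
  have p: "\<bar>p\<bar> \<le> r" "\<bar>p1\<bar> \<le> r1"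
    using Cauchy_Schwarz_ineq2[of v] v by (auto simp: p_def p1_def r_def r1_def)
  have v1: "\<bar>v$1\<bar> \<le> 1" using component_le_norm_cart[of v 1] v by simp
  have 1: "\<bar>b * v$1 / x\<bar> \<le> 1 / x"
    using b v1 x by (auto simp: abs_mult divide_le_cancel intro!: divide_right_mono mult_le_one)
  have "\<bar>p1 / r1\<^sup>2\<bar> \<le> r1 / r1\<^sup>2" using p by (simp add: divide_right_mono)
  also have "\<dots> = 1 / r1" by (simp add: power2_eq_square)
  also have "\<dots> \<le> 1 / x" using r1 x by (intro divide_left_mono) auto
  finally have 2: "\<bar>p1 / r1\<^sup>2\<bar> \<le> 1 / x" .
  have "\<bar>p / r\<bar> \<le> 1" "\<bar>p1 / r1\<bar> \<le> 1" using p r r1 x by (auto simp: divide_le_eq)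
  then have "\<bar>p / r + p1 / r1\<bar> \<le> 2" by linarith
  then have "\<bar>b * (p / r + p1 / r1)\<bar> \<le> 1 * 2" unfolding abs_mult using b by (intro mult_mono) auto
  then have "\<bar>b * (p / r + p1 / r1) / (r + r1)\<bar> \<le> 2 / (r + r1)"
    using r r1 x by (simp add: divide_right_mono)
  also have "\<dots> \<le> 2 / x" using r r1 x by (intro divide_left_mono) auto
  finally have 3: "\<bar>b * (p / r + p1 / r1) / (r + r1)\<bar> \<le> 2 / x" .
  have "\<bar>regular_part \<alpha> v Q M\<bar> \<le> 1 / x + 1 / x + 2 / x"
    using abs_triangle3[OF 1 2 3] by (simp add: regular_part_def b_def x_def p_def p1_def r_def r1_def)
  then show ?thesis by (simp add: x_def)
qed

text \<open>Gives the constant majorant away from \<open>N\<close>; the factor 1/(2 pi) in the bound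
  of \<open>weight\<close> is simply estimated by 1.\<close>

lemma kern_bound:
  assumes \<alpha>: "0 < 2 * \<alpha>" "2 * \<alpha> < 1" and Q: "Q$1 \<ge> 0" and M: "M$1 > 0" and v: "norm v = 1"
  shows "\<bar>kern \<alpha> v Q M\<bar> \<le> 4 / M$1 / norm (M - Q) + 1 / (norm (M - Q))\<^sup>2"
proof -
  let ?r = "norm (M - Q)"
  have "weight \<alpha> Q M \<le> 1" using weight_bounds[OF \<alpha> Q M] pi_gt3 by (smt (verit) divide_le_eq_1)
  moreover have "\<bar>regular_part \<alpha> v Q M / ?r\<bar> \<le> 4 / M$1 / ?r"
    using divide_right_mono[OF regular_part_bound[OF assms], of ?r] by (simp add: abs_divide)
  moreover have "\<bar>(v \<bullet> (M - Q)) / ?r ^ 3\<bar> \<le> ?r / ?r ^ 3"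
    using Cauchy_Schwarz_ineq2[of v "M - Q"] v by (simp add: divide_right_mono)
  moreover have "?r / ?r ^ 3 = 1 / ?r\<^sup>2" by (simp add: power3_eq_cube power2_eq_square)
  ultimately have "\<bar>weight \<alpha> Q M\<bar> \<le> 1"
     "\<bar>regular_part \<alpha> v Q M / ?r - (v \<bullet> (M - Q)) / ?r ^ 3\<bar> \<le> 4 / M$1 / ?r + 1 / ?r\<^sup>2"
    using weight_bounds[OF \<alpha> Q M] by linarith+
  then have "\<bar>weight \<alpha> Q M\<bar> * \<bar>regular_part \<alpha> v Q M / ?r - (v \<bullet> (M - Q)) / ?r ^ 3\<bar> \<le> 1 * (4 / M$1 / ?r + 1 / ?r\<^sup>2)"
    by (intro mult_mono) auto
  then show ?thesis by (simp add: kern_def abs_mult)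
qed

lemma continuous_on_mirror [continuous_intros]: "continuous_on S f \<Longrightarrow> continuous_on S (\<lambda>x. mirror (f x))"
  unfolding mirror_def by (intro continuous_intros)

lemma mirror_nz:
  assumes "Q$1 \<ge> 0" "M$1 > 0" shows "M \<noteq> mirror Q"
  using assms by (auto simp: mirror_nth vec_eq_iff forall_3)

lemma continuous_on_wt:
  assumes \<alpha>: "0 < 2 * \<alpha>" "2 * \<alpha> < 1"
    and "continuous_on S f" "continuous_on S g" "\<And>x. x \<in> S \<Longrightarrow> f x $ 1 \<ge> 0" "\<And>x. x \<in> S \<Longrightarrow> g x $ 1 > 0"
  shows "continuous_on S (\<lambda>x. weight \<alpha> (f x) (g x))"
proof -
  have nz: "g x \<noteq> mirror (f x)" if "x \<in> S" for x using mirror_nz assms that by blast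
  have "norm (g x - f x) + norm (g x - mirror (f x)) > 0" if "x \<in> S" for x
    using nz[OF that] by (simp add: add_nonneg_pos)
  note pos = this
  have fg1: "continuous_on S (\<lambda>x. f x $ 1)" "continuous_on S (\<lambda>x. g x $ 1)"
    using assms(3,4) by (auto intro!: continuous_intros)
  have n: "continuous_on S (\<lambda>x. norm (g x - f x))" "continuous_on S (\<lambda>x. norm (g x - mirror (f x)))"
    using assms(3,4) by (auto intro!: continuous_intros)
  have 1: "continuous_on S (\<lambda>x. (g x $ 1) powr (2 * \<alpha>))"
    using assms(1,6) fg1 by (intro continuous_on_powr' continuous_on_const) (auto simp: less_imp_le)
  have 2: "continuous_on S (\<lambda>x. (2 * f x $ 1 * g x $ 1) powr (1 - 2 * \<alpha>))"
    using assms(2,5,6) fg1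
    by (intro continuous_on_powr' continuous_on_const continuous_on_mult) (auto simp: less_imp_le)
  have 3: "continuous_on S (\<lambda>x. (norm (g x - f x) + norm (g x - mirror (f x))) powr (1 - 2 * \<alpha>))"
    using assms(2) n by (intro continuous_on_powr' continuous_on_const continuous_on_add) auto
  have "norm (g x - mirror (f x)) * (norm (g x - f x) + norm (g x - mirror (f x))) powr (1 - 2 * \<alpha>) \<noteq> 0"
    if "x \<in> S" for x
    using nz[OF that] pos[OF that] by simp
  then show ?thesis
    unfolding weight_def by (intro continuous_on_divide continuous_on_mult continuous_on_const 1 2 3 n) auto
qed

lemma continuous_on_kern:
  assumes \<alpha>: "0 < 2 * \<alpha>" "2 * \<alpha> < 1"
    and "continuous_on S f" "continuous_on S g" "\<And>x. x \<in> S \<Longrightarrow> f x $ 1 \<ge> 0" "\<And>x. x \<in> S \<Longrightarrow> g x $ 1 > 0"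
    and ne: "\<And>x. x \<in> S \<Longrightarrow> g x \<noteq> f x"
  shows "continuous_on S (\<lambda>x. kern \<alpha> v (f x) (g x))"
proof -
  have nz: "g x \<noteq> mirror (f x)" "g x $ 1 \<noteq> 0" if "x \<in> S" for x using mirror_nz assms that by force+
  have "norm (g x - f x) + norm (g x - mirror (f x)) > 0" if "x \<in> S" for x
    using nz[OF that] by (simp add: add_nonneg_pos)
  then have nz2: "norm (g x - f x) + norm (g x - mirror (f x)) \<noteq> 0" if "x \<in> S" for x
    using that by force
  show ?thesis
    unfolding kern_def regular_part_def using assms nz nz2
    by (intro continuous_intros continuous_on_wt) auto
qed

lemma kern_tendsto:
  assumes \<alpha>: "0 < 2 * \<alpha>" "2 * \<alpha> < 1" and "Q$1 \<ge> 0" "N$1 > 0" "N \<noteq> Q"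
  shows "((\<lambda>h. kern \<alpha> v Q (N + h *\<^sub>R n)) \<longlongrightarrow> kern \<alpha> v Q N) (at 0)"
proof -
  let ?S = "{P :: real^3. P$1 > 0} - {Q}"
  have "open ?S" by (intro open_Diff open_Collect_less continuous_intros)
  moreover have "continuous_on ?S (kern \<alpha> v Q)"
    by (rule continuous_on_kern[OF \<alpha> continuous_on_const continuous_on_id]) (use assms in auto)
  ultimately have "isCont (kern \<alpha> v Q) N"
    using assms by (simp add: continuous_on_eq_continuous_at)
  moreover have "((\<lambda>h. N + h *\<^sub>R n) \<longlongrightarrow> N) (at 0)" by (auto intro!: tendsto_eq_intros)
  ultimately show ?thesis by (rule isCont_tendsto_compose)
qed

lemma first_coordinate_on_normal:
  fixes N n :: "real^3"
  assumes "norm n = 1" "\<bar>h\<bar> < k" "k \<le> N$1 / 2"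
  shows "(N + h *\<^sub>R n) $ 1 > N$1 / 2"
proof -
  have "\<bar>h * n$1\<bar> \<le> \<bar>h\<bar> * 1" unfolding abs_mult
    using component_le_norm_cart[of n 1] assms(1) by (intro mult_left_mono) auto
  then show ?thesis using assms(2,3) by simp
qed

text \<open>\<open>v\<close> enters only through \<open>v$1\<close> and its inner products with
  \<open>M - Q\<close> and \<open>M - mirror Q\<close>. Linearity links directional derivatives with
  \<open>conormal\<close>, which is defined by the three partial derivatives.\<close>

lemma kern_linear:
  "kern \<alpha> v Q M = v$1 * kern \<alpha> (axis 1 1) Q M + v$2 * kern \<alpha> (axis 2 1) Q M + v$3 * kern \<alpha> (axis 3 1) Q M"
proof -
  have v: "v = v$1 *\<^sub>R axis 1 1 + v$2 *\<^sub>R axis 2 1 + v$3 *\<^sub>R axis 3 1"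
    by (simp add: vec_eq_iff forall_3 axis_def)
  have "\<exists>a b c. \<forall>v. kern \<alpha> v Q M = a * v$1 + b * (v \<bullet> (M - Q)) + c * (v \<bullet> (M - mirror Q))"
  proof (intro exI allI)
    let ?r = "norm (M - Q)" and ?r1 = "norm (M - mirror Q)" and ?w = "weight \<alpha> Q M" and ?b = "1 - 2 * \<alpha>"
    show "kern \<alpha> v Q M = (?w * ?b / M$1 / ?r) * v$1
        + (- (?w * (?b / ?r / (?r + ?r1) / ?r + 1 / ?r ^ 3))) * (v \<bullet> (M - Q))
        + (- (?w * (1 / ?r1\<^sup>2 + ?b / ?r1 / (?r + ?r1)) / ?r)) * (v \<bullet> (M - mirror Q))" for v
      unfolding kern_def regular_part_def divide_inverse by algebra
  qed
  then obtain a b c where k: "\<And>v. kern \<alpha> v Q M = a * v$1 + b * (v \<bullet> (M - Q)) + c * (v \<bullet> (M - mirror Q))"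
    by blast
  have add: "kern \<alpha> (u + w) Q M = kern \<alpha> u Q M + kern \<alpha> w Q M" for u w
    by (simp add: k inner_add_left algebra_simps)
  have scale: "kern \<alpha> (t *\<^sub>R u) Q M = t * kern \<alpha> u Q M" for t u
    by (simp add: k algebra_simps)
  show ?thesis by (subst v) (simp only: add scale)
qed

text \<open>Logarithmic differentiation of a quotient: every hypothesis states a derivative as a
  multiple of the value, so the multiples just add and subtract.\<close>

lemma has_real_derivative_log_form:
  fixes X A B S :: "real \<Rightarrow> real"
  assumes X: "(X has_real_derivative X 0 * x) (at 0)" and A: "(A has_real_derivative A 0 * a) (at 0)"
    and B: "(B has_real_derivative B 0 * b) (at 0)" and S: "(S has_real_derivative S 0 * s) (at 0)"
    and nz: "A 0 \<noteq> 0" "B 0 \<noteq> 0" "S 0 \<noteq> 0"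
  shows "((\<lambda>h. K * X h / (A h * B h * S h)) has_real_derivative
     K * X 0 / (A 0 * B 0 * S 0) * (x - a - b - s)) (at 0)"
proof -
  have "((\<lambda>h. A h * B h * S h) has_real_derivative (A 0 * B 0 * S 0) * (a + b + s)) (at 0)"
    by (rule DERIV_cong[OF DERIV_mult[OF DERIV_mult[OF A B] S]]) (simp add: algebra_simps)
  from DERIV_divide[OF DERIV_cmult[OF X, of K] this]
  have "((\<lambda>h. K * X h / (A h * B h * S h)) has_real_derivative
     (K * (X 0 * x) * (A 0 * B 0 * S 0) - K * X 0 * ((A 0 * B 0 * S 0) * (a + b + s)))
        / ((A 0 * B 0 * S 0) * (A 0 * B 0 * S 0))) (at 0)"
    using nz by simp
  then show ?thesis
    by (rule DERIV_cong) (use nz in \<open>simp add: divide_simps right_diff_distrib distrib_left mult_ac\<close>)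
qed

text \<open>Logarithmic differentiation of the closed form along the line through \<open>M\<close>.
  The power of \<open>M$1\<close> in front undoes the conormal factor, which \<open>weight\<close>
  already contains.\<close>

lemma q2_has_derivative:
  assumes \<alpha>: "0 < 2 * \<alpha>" "2 * \<alpha> < 1" and Q: "Q$1 \<ge> 0" and M: "M$1 > 0" and ne: "M \<noteq> Q"
  shows "((\<lambda>h. q2 \<alpha> Q (M + h *\<^sub>R v)) has_real_derivative (M$1) powr (- (2 * \<alpha>)) * kern \<alpha> v Q M) (at 0)"
proof -
  define b where "b = 1 - 2 * \<alpha>"
  define r where "r h = norm (M + h *\<^sub>R v - Q)" for h
  define r1 where "r1 h = norm (M + h *\<^sub>R v - mirror Q)" for h
  define p where "p = v \<bullet> (M - Q)" define p1 where "p1 = v \<bullet> (M - mirror Q)"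
  define x where "x = M$1"
  have x: "x > 0" using M by (simp add: x_def)
  have ne1: "M \<noteq> mirror Q" using mirror_nz Q M by blast
  have nd: "((\<lambda>h. norm (M + h *\<^sub>R v - Z)) has_real_derivative (v \<bullet> (M - Z)) / norm (M - Z)) (at 0)" if "M \<noteq> Z" for Z
  proof -
    have "((\<lambda>h. M + h *\<^sub>R v - Z) has_derivative (\<lambda>h. h *\<^sub>R v)) (at 0)"
      by (auto intro!: derivative_eq_intros)
    from has_derivative_compose[OF this has_derivative_norm]
    have "((\<lambda>h. norm (M + h *\<^sub>R v - Z)) has_derivative (\<lambda>h. (h *\<^sub>R v) \<bullet> sgn (M - Z))) (at 0)"
      using that by simp
    moreover have "(\<lambda>h. (h *\<^sub>R v) \<bullet> sgn (M - Z)) = (*) ((v \<bullet> (M - Z)) / norm (M - Z))"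
      by (simp add: fun_eq_iff sgn_div_norm divide_inverse mult_ac)
    ultimately show ?thesis by (simp add: has_field_derivative_def)
  qed
  have r0: "r 0 > 0" "r1 0 > 0" using ne ne1 by (auto simp: r_def r1_def)
  have d: "(r has_real_derivative p / r 0) (at 0)" "(r1 has_real_derivative p1 / r1 0) (at 0)"
    using nd[OF ne] nd[OF ne1] by (simp_all add: r_def[abs_def] r1_def[abs_def] p_def p1_def)
  have dx: "((\<lambda>h. x + h * v$1) has_real_derivative v$1) (at 0)"
    by (auto intro!: derivative_eq_intros)
  define K where "K = 1 / (2 * pi) * (2 * Q$1) powr b"
  \<comment> \<open>The closed form requires a positive first coordinate, so along the line it is
    available only for small h.\<close>
  have ev: "eventually (\<lambda>h. x + h * v$1 > 0) (nhds 0)"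
  proof (rule order_tendstoD(1)[of _ x])
    have "continuous_on UNIV (\<lambda>h. x + h * v $ 1)" by (intro continuous_intros)
    then show "((\<lambda>h. x + h * v $ 1) \<longlongrightarrow> x) (nhds 0)"
      by (metis (mono_tags, lifting) UNIV_I add.right_neutral continuous_on_eq_continuous_at isCont_def mult_zero_left open_UNIV tendsto_nhds_iff)
  qed (use x in simp)
  have eq: "eventually (\<lambda>h. q2 \<alpha> Q (M + h *\<^sub>R v) = K * (x + h * v$1) powr b / (r h * r1 h * (r h + r1 h) powr b)) (nhds 0)"
    using ev
  proof eventually_elim
    case (elim h)
    have "(M + h *\<^sub>R v) $ 1 > 0" using elim by (simp add: x_def)
    note q = q2_closed_form[OF \<alpha>(2) Q this]
    have "(2 * Q $ 1 * (x + h * v $ 1)) powr b = (2 * Q $ 1) powr b * (x + h * v $ 1) powr b"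
      by (rule powr_mult)
    then show ?case unfolding q by (simp add: K_def r_def r1_def x_def flip: b_def)
  qed
  let ?G = "\<lambda>h. K * (x + h * v$1) powr b / (r h * r1 h * (r h + r1 h) powr b)"
  define D where "D = (v$1 * b / x - p / (r 0)\<^sup>2 - p1 / (r1 0)\<^sup>2 - b * (p / r 0 + p1 / r1 0) / (r 0 + r1 0))"
  have "((\<lambda>h. (x + h * v$1) powr b) has_real_derivative x powr b * (v$1 * b / x)) (at 0)"
    using DERIV_powr[OF dx _ DERIV_const, of b] x by simp
  moreover have "((\<lambda>h. (r h + r1 h) powr b) has_real_derivative
       (r 0 + r1 0) powr b * (b * (p / r 0 + p1 / r1 0) / (r 0 + r1 0))) (at 0)"
    using DERIV_powr[OF DERIV_add[OF d] _ DERIV_const, of b] r0 by (simp add: mult.commute[of b])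
  ultimately have "(?G has_real_derivative ?G 0 * D) (at 0)"
    using r0 x d unfolding D_def
    by (intro has_real_derivative_log_form) (simp_all add: power2_eq_square)
  then have "((\<lambda>h. q2 \<alpha> Q (M + h *\<^sub>R v)) has_real_derivative ?G 0 * D) (at 0)"
    using DERIV_cong_ev[OF refl eq refl] by simp
  moreover have "?G 0 * D = x powr (- (2 * \<alpha>)) * kern \<alpha> v Q M"
  proof -
    have "(2 * Q $ 1 * x) powr b = (2 * Q $ 1) powr b * x powr b"
      by (rule powr_mult)
    then have w: "weight \<alpha> Q M = x powr (2*\<alpha>) * ?G 0 * r 0"
      using r0 by (simp add: weight_def K_def r_def r1_def flip: x_def b_def)
    have regular_part_eq: "regular_part \<alpha> v Q M = v$1 * b / x - p1 / (r1 0)\<^sup>2 - b * (p / r 0 + p1 / r1 0) / (r 0 + r1 0)"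
      by (simp add: regular_part_def p_def p1_def r_def r1_def b_def x_def mult.commute[of "v$1"])
    have "regular_part \<alpha> v Q M / r 0 - p / r 0 ^ 3 = D / r 0"
      unfolding regular_part_eq D_def by (simp add: diff_divide_distrib power3_eq_cube power2_eq_square)
    then have "kern \<alpha> v Q M = weight \<alpha> Q M * (D / r 0)"
      by (simp add: kern_def p_def r_def)
    also have "\<dots> = x powr (2*\<alpha>) * (?G 0 * D)" using r0 unfolding w by (simp add: mult_ac)
    finally show ?thesis using x by (simp add: powr_minus)
  qed
  ultimately show ?thesis by (simp add: x_def)
qed

lemma partial_deriv_q2:
  assumes "0 < 2 * \<alpha>" "2 * \<alpha> < 1" "Q$1 \<ge> 0" "M$1 > 0" "M \<noteq> Q"
  shows "partial_deriv i (q2 \<alpha> Q) M = (M$1) powr (- (2 * \<alpha>)) * kern \<alpha> (axis i 1) Q M"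
  unfolding partial_deriv_def by (rule DERIV_imp_deriv[OF q2_has_derivative[OF assms]])

lemma conormal_aux:
  fixes A B a b c k l m :: real
  assumes "A * B = 1"
  shows "A * (a * (B * k) + b * (B * l) + c * (B * m)) = a * k + b * l + c * m"
proof -
  have "A * (a * (B * k) + b * (B * l) + c * (B * m)) = (A * B) * (a * k + b * l + c * m)"
    by (simp add: distrib_left)
  then show ?thesis by (simp add: assms)
qed

lemma conormal_q2:
  assumes "0 < 2 * \<alpha>" "2 * \<alpha> < 1" "Q$1 \<ge> 0" "M$1 > 0" "M \<noteq> Q"
  shows "conormal \<alpha> n (q2 \<alpha> Q) M = kern \<alpha> n Q M"
proof -
  have "(M$1) powr (2*\<alpha>) \<noteq> 0" using assms(4) by simp
  then have "(M$1) powr (2*\<alpha>) * (M$1) powr (- (2*\<alpha>)) = 1"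
    unfolding powr_minus by (rule right_inverse)
  from conormal_aux[OF this] have "conormal \<alpha> n (q2 \<alpha> Q) M =
      n$1 * kern \<alpha> (axis 1 1) Q M + n$2 * kern \<alpha> (axis 2 1) Q M + n$3 * kern \<alpha> (axis 3 1) Q M"
    unfolding conormal_def partial_deriv_q2[OF assms] .
  then show ?thesis by (rule trans[OF _ kern_linear[symmetric]])
qed


section \<open>Change of variables in the plane\<close>

text \<open>The change of variables formula and Sard's theorem speak of maps on
  \<open>real^2\<close>, whereas parameters and points of the tangent plane are pairs; this
  isomorphism carries the results across.\<close>

definition vec2 :: "real \<times> real \<Rightarrow> real^2" where "vec2 p = vector [fst p, snd p]"
definition unvec2 :: "real^2 \<Rightarrow> real \<times> real" where "unvec2 v = (v$1, v$2)"

lemma vec2_nth [simp]: "vec2 p $ 1 = fst p" "vec2 p $ 2 = snd p"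
  by (simp_all add: vec2_def)

lemma vec2_inverse [simp]: "unvec2 (vec2 p) = p" "vec2 (unvec2 v) = v"
  by (auto simp: unvec2_def vec_eq_iff forall_2)

lemma linear_vec2: "linear vec2" and linear_unvec2: "linear unvec2"
  by (auto intro!: linearI simp: unvec2_def vec_eq_iff forall_2)

lemma bounded_linear_vec2: "bounded_linear vec2" and bounded_linear_unvec2: "bounded_linear unvec2"
  using linear_vec2 linear_unvec2 by (auto simp: linear_conv_bounded_linear)

lemma vec2_cbox: "vec2 ` cbox u v = cbox (vec2 u) (vec2 v)"
proof -
  have "w \<in> vec2 ` cbox u v \<longleftrightarrow> w \<in> cbox (vec2 u) (vec2 v)" for w
  proof -
    have "w \<in> vec2 ` cbox u v \<longleftrightarrow> unvec2 w \<in> cbox u v"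
      by (metis imageE image_eqI vec2_inverse)
    also have "\<dots> \<longleftrightarrow> w \<in> cbox (vec2 u) (vec2 v)"
      by (cases u; cases v) (auto simp: unvec2_def mem_box_cart forall_2 cbox_Pair_eq)
    finally show ?thesis .
  qed
  then show ?thesis by blast
qed

lemma unvec2_cbox: "unvec2 ` cbox u v = cbox (unvec2 u) (unvec2 v)"
proof -
  have "cbox u v = vec2 ` cbox (unvec2 u) (unvec2 v)" by (simp add: vec2_cbox)
  then show ?thesis by (simp add: image_image)
qed

lemma content_vec2: "measure lborel (vec2 ` cbox u v) = measure lborel (cbox u v)"
proof (cases "cbox u v = {}")
  case False
  obtain a b c d where uv: "u = (a, b)" "v = (c, d)" by (cases u; cases v)
  have "cbox (vec2 u) (vec2 v) \<noteq> {}" using False by (simp flip: vec2_cbox)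
  then have "measure lborel (cbox (vec2 u) (vec2 v)) = (c - a) * (d - b)"
    by (simp add: content_cbox_if_cart UNIV_2 uv)
  moreover have "measure lborel (cbox u v) = (c - a) * (d - b)"
  proof -
    have "a \<le> c" "b \<le> d" using False by (auto simp: uv cbox_Pair_eq)
    then show ?thesis by (simp add: uv content_Pair)
  qed
  ultimately show ?thesis by (simp add: vec2_cbox)
qed simp

lemma vec2_cbox_ex: "\<exists>w z. vec2 ` cbox u v = cbox w z" and unvec2_cbox_ex: "\<exists>w z. unvec2 ` cbox x y = cbox w z"
  using vec2_cbox unvec2_cbox by blast+

text \<open>The substitution rule \<open>has_integral_twiddle\<close> works on boxes, so
  \<open>f\<close> is extended by 0 to a box around \<open>S\<close>. The factor is 1 because
  \<open>vec2\<close> preserves the content of boxes.\<close>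

lemma has_integral_vec2:
  fixes f :: "real^2 \<Rightarrow> real"
  assumes "(f has_integral i) (vec2 ` S)" "bounded S"
  shows "((\<lambda>p. f (vec2 p)) has_integral i) S"
proof -
  obtain a where a: "S \<subseteq> cbox (-a) a"
    using bounded_subset_cbox_symmetric[OF assms(2)] by blast
  define F where "F v = (if v \<in> vec2 ` S then f v else 0)" for v
  have mem: "vec2 p \<in> vec2 ` S \<longleftrightarrow> p \<in> S" for p by (metis imageE image_eqI vec2_inverse(1))
  have "(F has_integral i) (cbox (vec2 (-a)) (vec2 a))"
    unfolding F_def using assms(1) a by (subst has_integral_restrict) (auto simp flip: vec2_cbox)
  then have "((\<lambda>x. F (vec2 x)) has_integral (1 / 1) *\<^sub>R i) (unvec2 ` cbox (vec2 (-a)) (vec2 a))"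
    using vec2_cbox_ex unvec2_cbox_ex
    by (intro has_integral_twiddle)
       (auto simp: content_vec2 linear_continuous_at bounded_linear_vec2 simp del: One_nat_def)
  then have "((\<lambda>x. F (vec2 x)) has_integral i) (cbox (-a) a)"
    by (simp add: unvec2_cbox)
  then show ?thesis
    unfolding F_def mem using a by (subst (asm) has_integral_restrict) auto
qed

lemma has_integral_unvec2:
  fixes f :: "real \<times> real \<Rightarrow> real"
  assumes "(f has_integral i) S" "bounded S"
  shows "((\<lambda>v. f (unvec2 v)) has_integral i) (vec2 ` S)"
proof -
  obtain a where a: "S \<subseteq> cbox (-a) a"
    using bounded_subset_cbox_symmetric[OF assms(2)] by blast
  define F where "F v = (if v \<in> S then f v else 0)" for v
  have mem: "unvec2 v \<in> S \<longleftrightarrow> v \<in> vec2 ` S" for v by (metis imageE image_eqI vec2_inverse)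
  have "(F has_integral i) (cbox (-a) a)"
    unfolding F_def using assms(1) a by (subst has_integral_restrict) auto
  moreover have "measure lborel (unvec2 ` cbox u v) = measure lborel (cbox u v)" for u v
    using content_vec2[of "unvec2 u" "unvec2 v"] by (simp add: unvec2_cbox vec2_cbox)
  ultimately have "((\<lambda>x. F (unvec2 x)) has_integral (1 / 1) *\<^sub>R i) (vec2 ` cbox (-a) a)"
    using vec2_cbox_ex unvec2_cbox_ex
    by (intro has_integral_twiddle)
       (auto simp: linear_continuous_at bounded_linear_unvec2 simp del: One_nat_def)
  then have "((\<lambda>x. F (unvec2 x)) has_integral i) (vec2 ` cbox (-a) a)"
    by simp
  moreover have "vec2 ` S \<subseteq> vec2 ` cbox (-a) a" using a by blast
  ultimately show ?thesis
    unfolding F_def mem by (subst (asm) has_integral_restrict) auto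
qed

lemma absolutely_integrable_vec2:
  fixes f :: "real^2 \<Rightarrow> real"
  assumes "f absolutely_integrable_on (vec2 ` S)" "bounded S"
  shows "(\<lambda>p. f (vec2 p)) absolutely_integrable_on S"
    and "integral S (\<lambda>p. f (vec2 p)) = integral (vec2 ` S) f"
  using assms has_integral_vec2[of f _ S] has_integral_vec2[of "\<lambda>v. norm (f v)" _ S]
  by (auto simp: absolutely_integrable_on_def integrable_on_def integral_unique)

lemma absolutely_integrable_unvec2:
  fixes f :: "real \<times> real \<Rightarrow> real"
  assumes "f absolutely_integrable_on S" "bounded S"
  shows "(\<lambda>p. f (unvec2 p)) absolutely_integrable_on vec2 ` S"
    and "integral (vec2 ` S) (\<lambda>p. f (unvec2 p)) = integral S f"
  using assms has_integral_unvec2[of f _ S] has_integral_unvec2[of "\<lambda>v. norm (f v)" _ S]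
  by (auto simp: absolutely_integrable_on_def integrable_on_def integral_unique)

section \<open>Change of variables and Sard's theorem for pairs\<close>

definition det_pair :: "(real \<times> real \<Rightarrow> real \<times> real) \<Rightarrow> real" where
  "det_pair L = fst (L (1, 0)) * snd (L (0, 1)) - fst (L (0, 1)) * snd (L (1, 0))"

lemma unvec2_axis: "unvec2 (axis 1 1) = (1, 0)" "unvec2 (axis 2 1) = (0, 1)"
  by (auto simp: unvec2_def axis_def)

lemma det_matrix_pair: "det (matrix (\<lambda>v. vec2 (L (unvec2 v)))) = det_pair L"
  by (simp add: det_2 matrix_def det_pair_def unvec2_axis)

lemma has_derivative_vec2_conj:
  assumes "(g has_derivative g') (at p within S)"
  shows "((\<lambda>v. vec2 (g (unvec2 v))) has_derivative (\<lambda>v. vec2 (g' (unvec2 v)))) (at (vec2 p) within vec2 ` S)"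
proof -
  have "unvec2 ` vec2 ` S = S" by (simp add: image_image)
  then have "(g has_derivative g') (at (unvec2 (vec2 p)) within unvec2 ` vec2 ` S)" using assms by simp
  then have "((\<lambda>v. g (unvec2 v)) has_derivative (\<lambda>v. g' (unvec2 v))) (at (vec2 p) within vec2 ` S)"
    using has_derivative_in_compose[OF bounded_linear_imp_has_derivative[OF bounded_linear_unvec2]] by blast
  then show ?thesis
    by (rule bounded_linear.has_derivative[OF bounded_linear_vec2])
qed

lemma change_of_variables_pair:
  fixes f :: "real \<times> real \<Rightarrow> real" and g :: "real \<times> real \<Rightarrow> real \<times> real"
  assumes S: "S \<in> sets lebesgue" "bounded S" "bounded (g ` S)"
    and der: "\<And>p. p \<in> S \<Longrightarrow> (g has_derivative g' p) (at p within S)"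
    and inj: "inj_on g S"
    and f: "f absolutely_integrable_on g ` S"
  shows "(\<lambda>p. \<bar>det_pair (g' p)\<bar> * f (g p)) absolutely_integrable_on S"
    and "integral S (\<lambda>p. \<bar>det_pair (g' p)\<bar> * f (g p)) = integral (g ` S) f"
proof -
  let ?g = "\<lambda>v. vec2 (g (unvec2 v))"
  let ?g' = "\<lambda>v w. vec2 (g' (unvec2 v) (unvec2 w))"
  \<comment> \<open>The change of variables theorem takes vector values, hence the detour through
    \<open>real^1\<close>.\<close>
  let ?f = "\<lambda>v. vec (f (unvec2 v)) :: real^1"
  have im: "?g ` vec2 ` S = vec2 ` g ` S" by (auto simp: image_image)
  have S2: "vec2 ` S \<in> sets lebesgue"
    by (rule differentiable_image_in_sets_lebesgue[OF S(1)])
       (auto intro: bounded_linear_imp_differentiable_on bounded_linear_vec2)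
  have der2: "(?g has_derivative ?g' v) (at v within vec2 ` S)" if "v \<in> vec2 ` S" for v
    using that has_derivative_vec2_conj[OF der] by auto
  have inj2: "inj_on ?g (vec2 ` S)"
  proof (rule inj_onI)
    fix x y assume xy: "x \<in> vec2 ` S" "y \<in> vec2 ` S" "?g x = ?g y"
    then have "g (unvec2 x) = g (unvec2 y)" by (metis vec2_inverse(1))
    then show "x = y" using xy inj by (auto dest!: inj_onD)
  qed
  have f2: "?f absolutely_integrable_on ?g ` vec2 ` S"
    unfolding im using absolutely_integrable_unvec2(1)[OF f S(3)]
    by (simp add: absolutely_integrable_on_1_iff)
  have f3: "integral (?g ` vec2 ` S) ?f = vec (integral (g ` S) f)"
    unfolding im using absolutely_integrable_unvec2(2)[OF f S(3)]
    by (simp add: integral_on_1_eq)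
  have "(\<lambda>v. \<bar>det (matrix (?g' v))\<bar> *\<^sub>R ?f (?g v)) absolutely_integrable_on vec2 ` S \<and>
      integral (vec2 ` S) (\<lambda>v. \<bar>det (matrix (?g' v))\<bar> *\<^sub>R ?f (?g v)) = vec (integral (g ` S) f)"
    using has_absolute_integral_change_of_variables[where f="?f", OF S2 der2 inj2] f2 f3 by simp
  then have h: "(\<lambda>v. \<bar>det_pair (g' (unvec2 v))\<bar> * f (g (unvec2 v))) absolutely_integrable_on vec2 ` S"
    "integral (vec2 ` S) (\<lambda>v. \<bar>det_pair (g' (unvec2 v))\<bar> * f (g (unvec2 v))) = integral (g ` S) f"
    unfolding det_matrix_pair
    by (auto simp: absolutely_integrable_on_1_iff integral_on_1_eq vec_eq_iff)
  show "(\<lambda>p. \<bar>det_pair (g' p)\<bar> * f (g p)) absolutely_integrable_on S"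
    and "integral S (\<lambda>p. \<bar>det_pair (g' p)\<bar> * f (g p)) = integral (g ` S) f"
    using absolutely_integrable_vec2[OF h(1) S(2)] h(2) by auto
qed

lemma Sard_pair:
  fixes g :: "real \<times> real \<Rightarrow> real \<times> real"
  assumes der: "\<And>p. p \<in> S \<Longrightarrow> (g has_derivative g' p) (at p within S)"
    and det: "\<And>p. p \<in> S \<Longrightarrow> det_pair (g' p) = 0"
  shows "negligible (g ` S)"
proof -
  let ?g = "\<lambda>v. vec2 (g (unvec2 v))"
  let ?g' = "\<lambda>v w. vec2 (g' (unvec2 v) (unvec2 w))"
  have "negligible (?g ` vec2 ` S)"
  proof (rule baby_Sard)
    fix v assume v: "v \<in> vec2 ` S"
    then show "(?g has_derivative ?g' v) (at v within vec2 ` S)"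
      using has_derivative_vec2_conj[OF der] by auto
    have "det (matrix (?g' v)) = 0"
      using v det unfolding det_matrix_pair by auto
    then show "rank (matrix (?g' v)) < CARD(2)"
      by (simp add: det_eq_0_rank)
  qed simp
  then have "negligible (unvec2 ` ?g ` vec2 ` S)"
    by (rule negligible_differentiable_image_negligible[rotated])
       (auto intro: bounded_linear_imp_differentiable_on bounded_linear_unvec2)
  then show ?thesis by (simp add: image_image)
qed


section \<open>The flat jump kernel\<close>

text \<open>First half of an iterated integration of the flat kernel; there a^2 is h^2 plus the
  square of the other coordinate.\<close>

lemma plane_kernel_inner:
  fixes a d :: real
  assumes "a > 0" "d > 0"
  shows "((\<lambda>v. 1 / (sqrt (a\<^sup>2 + v\<^sup>2)) ^ 3) has_integral 2 * d / (a\<^sup>2 * sqrt (a\<^sup>2 + d\<^sup>2))) {-d..d}"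
proof -
  have "((\<lambda>v. 1 / (sqrt (a\<^sup>2 + v\<^sup>2)) ^ 3) has_integral
      d / (a\<^sup>2 * sqrt (a\<^sup>2 + d\<^sup>2)) - (- d) / (a\<^sup>2 * sqrt (a\<^sup>2 + (- d)\<^sup>2))) {-d..d}"
  proof (rule fundamental_theorem_of_calculus)
    fix v assume "v \<in> {-d..d}"
    define s where "s = sqrt (a\<^sup>2 + v\<^sup>2)"
    have pos: "a\<^sup>2 + v\<^sup>2 > 0" using assms by (simp add: add_pos_nonneg)
    then have s: "s > 0" "s\<^sup>2 = a\<^sup>2 + v\<^sup>2" by (auto simp: s_def)
    have ds: "((\<lambda>v. sqrt (a\<^sup>2 + v\<^sup>2)) has_real_derivative v / s) (at v)"
      using pos by (auto intro!: derivative_eq_intros simp: s_def field_simps)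
    have "((\<lambda>v. v / (a\<^sup>2 * sqrt (a\<^sup>2 + v\<^sup>2))) has_real_derivative
        (1 * (a\<^sup>2 * s) - v * (a\<^sup>2 * (v / s))) / ((a\<^sup>2 * s) * (a\<^sup>2 * s))) (at v)"
      using DERIV_divide[OF DERIV_ident DERIV_cmult[OF ds, of "a\<^sup>2"]] s assms by (simp add: s_def)
    also have "(1 * (a\<^sup>2 * s) - v * (a\<^sup>2 * (v / s))) / ((a\<^sup>2 * s) * (a\<^sup>2 * s)) = (s\<^sup>2 - v\<^sup>2) / (a\<^sup>2 * s ^ 3)"
      using s(1) assms by (simp add: divide_simps) (simp add: power2_eq_square power3_eq_cube algebra_simps)
    also have "\<dots> = 1 / s ^ 3" using s(2) assms by simp
    finally show "((\<lambda>v. v / (a\<^sup>2 * sqrt (a\<^sup>2 + v\<^sup>2))) has_vector_derivative 1 / (sqrt (a\<^sup>2 + v\<^sup>2)) ^ 3)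
        (at v within {-d..d})"
      unfolding s_def by (simp add: has_real_derivative_iff_has_vector_derivative has_vector_derivative_at_within)
  qed (use assms in auto)
  then show ?thesis by simp
qed

text \<open>The antiderivative comes from the solid angle of a rectangle seen from a point above its
  corner.\<close>

lemma plane_kernel_outer:
  fixes h d :: real
  assumes "h > 0" "d > 0"
  shows "((\<lambda>u. h * (2 * d / ((h\<^sup>2 + u\<^sup>2) * sqrt (h\<^sup>2 + u\<^sup>2 + d\<^sup>2)))) has_integral
      4 * arctan (d\<^sup>2 / (h * sqrt (h\<^sup>2 + d\<^sup>2 + d\<^sup>2)))) {-d..d}"
proof -
  let ?F = "\<lambda>u. 2 * arctan (d * u / (h * sqrt (h\<^sup>2 + u\<^sup>2 + d\<^sup>2)))"
  have "((\<lambda>u. h * (2 * d / ((h\<^sup>2 + u\<^sup>2) * sqrt (h\<^sup>2 + u\<^sup>2 + d\<^sup>2)))) has_integral ?F d - ?F (-d)) {-d..d}"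
  proof (rule fundamental_theorem_of_calculus)
    fix u assume "u \<in> {-d..d}"
    define s where "s = sqrt (h\<^sup>2 + u\<^sup>2 + d\<^sup>2)"
    have pos: "h\<^sup>2 + u\<^sup>2 + d\<^sup>2 > 0" using assms by (simp add: add_pos_nonneg)
    then have s: "s > 0" "s\<^sup>2 = h\<^sup>2 + u\<^sup>2 + d\<^sup>2" by (auto simp: s_def)
    have ds: "((\<lambda>u. sqrt (h\<^sup>2 + u\<^sup>2 + d\<^sup>2)) has_real_derivative u / s) (at u)"
      using pos by (auto intro!: derivative_eq_intros simp: s_def field_simps)
    define w where "w = d * u / (h * s)"
    have dw: "((\<lambda>u. d * u / (h * sqrt (h\<^sup>2 + u\<^sup>2 + d\<^sup>2))) has_real_derivative
        (d * (h * s) - d * u * (h * (u / s))) / ((h * s) * (h * s))) (at u)"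
      using DERIV_divide[OF DERIV_cmult[OF DERIV_ident, of d] DERIV_cmult[OF ds, of h]] s assms by (simp add: s_def)
    have "(d * (h * s) - d * u * (h * (u / s))) / ((h * s) * (h * s)) = d * (s\<^sup>2 - u\<^sup>2) / (h * s ^ 3)"
      using s(1) assms by (simp add: divide_simps) (simp add: power2_eq_square power3_eq_cube algebra_simps)
    also have "\<dots> = d * (h\<^sup>2 + d\<^sup>2) / (h * s ^ 3)" using s(2) by simp
    finally have e1: "(d * (h * s) - d * u * (h * (u / s))) / ((h * s) * (h * s)) = d * (h\<^sup>2 + d\<^sup>2) / (h * s ^ 3)" .
    \<comment> \<open>This factorization makes the arctangent work: the factor h^2 + d^2 cancels
      against the derivative of the argument, and h^2 + u^2 is left in the denominator.\<close>
    have fac: "h\<^sup>2 * s\<^sup>2 + d\<^sup>2 * u\<^sup>2 = (h\<^sup>2 + u\<^sup>2) * (h\<^sup>2 + d\<^sup>2)"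
      unfolding s(2) by (simp add: algebra_simps)
    have "1 + w\<^sup>2 = (h\<^sup>2 * s\<^sup>2 + d\<^sup>2 * u\<^sup>2) / (h\<^sup>2 * s\<^sup>2)"
      using s(1) assms by (simp add: w_def power_divide power_mult_distrib add_divide_distrib)
    then have e2: "1 + w\<^sup>2 = (h\<^sup>2 + u\<^sup>2) * (h\<^sup>2 + d\<^sup>2) / (h\<^sup>2 * s\<^sup>2)" unfolding fac .
    have hp: "h\<^sup>2 + u\<^sup>2 > 0" "h\<^sup>2 + d\<^sup>2 > 0" using assms by (simp_all add: add_pos_nonneg)
    have "(?F has_real_derivative 2 * (inverse (1 + w\<^sup>2) * (d * (h\<^sup>2 + d\<^sup>2) / (h * s ^ 3)))) (at u)"
      using DERIV_cmult[OF DERIV_chain2[OF DERIV_arctan dw[unfolded e1]], of 2] by (simp add: w_def s_def)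
    also have "2 * (inverse (1 + w\<^sup>2) * (d * (h\<^sup>2 + d\<^sup>2) / (h * s ^ 3))) = h * (2 * d / ((h\<^sup>2 + u\<^sup>2) * s))"
      unfolding e2 using s(1) assms hp
      by (simp add: divide_simps) (simp add: power2_eq_square power3_eq_cube algebra_simps)
    finally show "(?F has_vector_derivative h * (2 * d / ((h\<^sup>2 + u\<^sup>2) * sqrt (h\<^sup>2 + u\<^sup>2 + d\<^sup>2)))) (at u within {-d..d})"
      unfolding s_def by (simp add: has_real_derivative_iff_has_vector_derivative has_vector_derivative_at_within)
  qed (use assms in auto)
  then show ?thesis by (simp add: power2_eq_square arctan_minus)
qed

text \<open>2 pi times the Poisson kernel of the half-space. It is odd in h, which is why the two
  sides of the surface receive opposite jumps.\<close>

definition plane_kernel :: "real \<Rightarrow> real \<times> real \<Rightarrow> real" where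
  "plane_kernel h u = h / (sqrt ((norm u)\<^sup>2 + h\<^sup>2)) ^ 3"

lemma norm_pair_sq: "(norm (u :: real \<times> real))\<^sup>2 = (fst u)\<^sup>2 + (snd u)\<^sup>2"
  by (cases u) (simp add: norm_Pair)

lemma continuous_on_plane_kernel:
  "h \<noteq> 0 \<Longrightarrow> continuous_on S (plane_kernel h)"
  unfolding plane_kernel_def
  by (intro continuous_intros) (auto simp: add_nonneg_eq_0_iff)

lemma integral_plane_kernel:
  assumes "h > 0" "d > 0"
  shows "integral (square d) (plane_kernel h) = 4 * arctan (d\<^sup>2 / (h * sqrt (h\<^sup>2 + d\<^sup>2 + d\<^sup>2)))"
proof -
  have "integral (square d) (plane_kernel h)
      = integral (cbox (-d) d) (\<lambda>x. integral (cbox (-d) d) (\<lambda>y. plane_kernel h (x, y)))"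
    by (rule integral_prod_continuous) (use assms continuous_on_plane_kernel in auto)
  also have "\<dots> = integral {-d..d} (\<lambda>u. h * (2 * d / ((h\<^sup>2 + u\<^sup>2) * sqrt (h\<^sup>2 + u\<^sup>2 + d\<^sup>2))))"
  proof (simp only: cbox_interval, rule integral_cong)
    fix x
    define a where "a = sqrt (h\<^sup>2 + x\<^sup>2)"
    have a: "a > 0" "a\<^sup>2 = h\<^sup>2 + x\<^sup>2" using assms by (auto simp: a_def add_pos_nonneg)
    have "plane_kernel h (x, y) = h * (1 / (sqrt (a\<^sup>2 + y\<^sup>2)) ^ 3)" for y
      unfolding plane_kernel_def norm_pair_sq a(2) by (simp add: add_ac)
    then show "integral {-d..d} (\<lambda>y. plane_kernel h (x, y)) = h * (2 * d / ((h\<^sup>2 + x\<^sup>2) * sqrt (h\<^sup>2 + x\<^sup>2 + d\<^sup>2)))"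
      using has_integral_mult_right[OF plane_kernel_inner[OF a(1) assms(2)], of h]
      by (auto intro!: integral_unique simp: a(2))
  qed
  also have "\<dots> = 4 * arctan (d\<^sup>2 / (h * sqrt (h\<^sup>2 + d\<^sup>2 + d\<^sup>2)))"
    by (rule integral_unique[OF plane_kernel_outer[OF assms]])
  finally show ?thesis .
qed

lemma integral_plane_kernel_tendsto:
  assumes "d > 0"
  shows "((\<lambda>h. integral (square d) (plane_kernel h)) \<longlongrightarrow> 2 * pi) (at_right 0)"
proof -
  have "((\<lambda>h. 4 * arctan (d\<^sup>2 / (h * sqrt (h\<^sup>2 + d\<^sup>2 + d\<^sup>2)))) \<longlongrightarrow> 4 * (pi / 2)) (at_right 0)"
  proof (intro tendsto_mult tendsto_const filterlim_compose[OF tendsto_arctan_at_top])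
    have "((\<lambda>h. h * sqrt (h\<^sup>2 + d\<^sup>2 + d\<^sup>2)) \<longlongrightarrow> 0 * sqrt (0\<^sup>2 + d\<^sup>2 + d\<^sup>2)) (at_right 0)"
      by (intro tendsto_intros)
    moreover have "eventually (\<lambda>h::real. h * sqrt (h\<^sup>2 + d\<^sup>2 + d\<^sup>2) > 0) (at_right 0)"
      using eventually_at_right_less[of 0]
      by eventually_elim (use assms in \<open>auto intro!: mult_pos_pos add_pos_pos add_nonneg_pos\<close>)
    ultimately have "filterlim (\<lambda>h. h * sqrt (h\<^sup>2 + d\<^sup>2 + d\<^sup>2)) (at_right 0) (at_right 0)"
      by (intro tendsto_imp_filterlim_at_right) simp_all
    moreover have "filterlim (\<lambda>y. d\<^sup>2 / y) at_top (at_right 0)"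
      using filterlim_tendsto_pos_mult_at_top[OF tendsto_const[of "d\<^sup>2"] _ filterlim_inverse_at_top_right] assms
      by (simp add: divide_inverse)
    ultimately show "filterlim (\<lambda>h. d\<^sup>2 / (h * sqrt (h\<^sup>2 + d\<^sup>2 + d\<^sup>2))) at_top (at_right 0)"
      by (rule filterlim_compose[rotated])
  qed
  moreover have "eventually (\<lambda>h::real. 4 * arctan (d\<^sup>2 / (h * sqrt (h\<^sup>2 + d\<^sup>2 + d\<^sup>2))) =
      integral (square d) (plane_kernel h)) (at_right 0)"
    using eventually_at_right_less[of 0]
    by eventually_elim (use assms integral_plane_kernel in auto)
  ultimately show ?thesis by (simp add: filterlim_cong)
qed

lemma integral_plane_kernel_abs_le:
  assumes "h \<noteq> 0" "d > 0"
  shows "integral (square d) (\<lambda>u. \<bar>plane_kernel h u\<bar>) \<le> 2 * pi"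
proof -
  have "(\<lambda>u. \<bar>plane_kernel h u\<bar>) = plane_kernel \<bar>h\<bar>"
    by (auto simp: plane_kernel_def fun_eq_iff abs_divide power_abs[symmetric])
  then have "integral (square d) (\<lambda>u. \<bar>plane_kernel h u\<bar>)
      = 4 * arctan (d\<^sup>2 / (\<bar>h\<bar> * sqrt (\<bar>h\<bar>\<^sup>2 + d\<^sup>2 + d\<^sup>2)))"
    using integral_plane_kernel[of "\<bar>h\<bar>" d] assms by simp
  also have "\<dots> \<le> 4 * (pi / 2)" using arctan_ubound by (intro mult_left_mono) (auto simp: less_imp_le)
  finally show ?thesis by simp
qed

section \<open>Dominated convergence and the approximate identity\<close>

lemma dominated_convergence_at_0:
  fixes I :: "real \<Rightarrow> 'a::euclidean_space \<Rightarrow> real"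
  assumes h0: "h0 > 0"
    and int: "\<And>h. 0 < \<bar>h\<bar> \<Longrightarrow> \<bar>h\<bar> < h0 \<Longrightarrow> I h integrable_on S"
    and g: "g integrable_on S"
    and le: "\<And>h x. 0 < \<bar>h\<bar> \<Longrightarrow> \<bar>h\<bar> < h0 \<Longrightarrow> x \<in> S \<Longrightarrow> \<bar>I h x\<bar> \<le> g x"
    and lim: "\<And>x. x \<in> S \<Longrightarrow> ((\<lambda>h. I h x) \<longlongrightarrow> L x) (at 0)"
  shows "L absolutely_integrable_on S" "((\<lambda>h. integral S (I h)) \<longlongrightarrow> integral S L) (at 0)"
proof -
  have at: "at 0 within {-h0<..<h0} = at (0::real)"
    using h0 by (intro at_within_open) auto
  have seq: "L integrable_on S \<and> (\<lambda>k. integral S (I (X k))) \<longlonglongrightarrow> integral S L"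
    if X: "\<And>k. X k \<in> {-h0<..<h0} - {0}" "X \<longlonglongrightarrow> 0" for X
  proof -
    have X': "0 < \<bar>X k\<bar>" "\<bar>X k\<bar> < h0" for k using X(1)[of k] by auto
    have "filterlim X (at 0) sequentially"
      using X by (auto simp: filterlim_at)
    then have conv: "(\<lambda>k. I (X k) x) \<longlonglongrightarrow> L x" if "x \<in> S" for x
      using lim[OF that] by (rule filterlim_compose[rotated])
    show ?thesis
      using dominated_convergence[of "\<lambda>k. I (X k)" S g L] int[OF X'] g le[OF X'] conv
      by (metis real_norm_def)
  qed
  \<comment> \<open>Integrability of \<open>L\<close> does not depend on the sequence, so one
    admissible sequence suffices; the shift by 2 keeps it strictly below \<open>h0\<close>.\<close>
  define X0 where "X0 k = h0 / real (k + 2)" for k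
  have X0: "0 < X0 k" "X0 k < h0" for k using h0 by (auto simp: X0_def divide_less_eq)
  have "X0 k \<in> {-h0<..<h0} - {0}" for k using X0[of k] h0 by simp
  moreover have "X0 \<longlonglongrightarrow> 0" unfolding X0_def by (rule LIMSEQ_ignore_initial_segment[OF lim_const_over_n, of h0 2])
  ultimately have L: "L integrable_on S" using seq[of X0] by blast
  have "\<bar>L x\<bar> \<le> g x" if "x \<in> S" for x
  proof (rule tendsto_upperbound)
    show "((\<lambda>h. \<bar>I h x\<bar>) \<longlongrightarrow> \<bar>L x\<bar>) (at 0)" using lim[OF that] by (rule tendsto_rabs)
    show "\<forall>\<^sub>F h in at 0. \<bar>I h x\<bar> \<le> g x"
      unfolding eventually_at using h0 le that by (intro exI[of _ h0]) auto
  qed simp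
  then show "L absolutely_integrable_on S"
    using L g by (intro absolutely_integrable_integrable_bound[of S L g]) auto
  show "((\<lambda>h. integral S (I h)) \<longlongrightarrow> integral S L) (at 0)"
    unfolding at[symmetric] tendsto_at_iff_sequentially using seq by (auto simp: o_def)
qed

lemma integrable_abs_powr:
  assumes "a > -1" "d \<ge> 0"
  shows "(\<lambda>x::real. \<bar>x\<bar> powr a) absolutely_integrable_on {-d..d}"
proof -
  have p: "(\<lambda>x. \<bar>x\<bar> powr a) integrable_on {0..d}"
    using has_integral_powr_from_0[OF assms] by (auto intro: integrable_eq[of "\<lambda>x. x powr a"])
  have "(\<lambda>x. \<bar>- x\<bar> powr a) integrable_on {-d..-0}"
    by (rule Henstock_Kurzweil_Integration.integrable_reflect_real[where f="\<lambda>x. \<bar>x\<bar> powr a" and a=0 and b=d, THEN iffD2, OF p])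
  then have n: "(\<lambda>x. \<bar>x\<bar> powr a) integrable_on {-d..0}" by simp
  have "(\<lambda>x. \<bar>x\<bar> powr a) integrable_on {-d..d}"
    using Henstock_Kurzweil_Integration.integrable_combine[OF _ _ n p] assms by simp
  then show ?thesis by (intro nonnegative_absolutely_integrable_1) auto
qed

text \<open>Since both coordinates are at most \<open>norm u\<close> in absolute value, the function
  is dominated by the product of their powers with exponent -q/2 > -1, and Fubini reduces this
  product to one dimension.\<close>

lemma integrable_norm_powr_square:
  assumes q: "0 \<le> q" "q < 2" and d: "d \<ge> 0"
  shows "(\<lambda>u :: real \<times> real. norm u powr (- q)) integrable_on square d"
proof -
  define f where "f x = indicator {-d..d} x * \<bar>x\<bar> powr (- q / 2)" for x :: real
  have f_meas [measurable]: "f \<in> borel_measurable borel" unfolding f_def by measurable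
  have "integrable lebesgue f"
    using integrable_abs_powr[of "- q / 2" d] q d unfolding set_integrable_def f_def by simp
  then have fi: "integrable lborel f" by (simp add: integrable_completion)
  have f0: "f x \<ge> 0" for x by (simp add: f_def)
  have "integrable (lborel \<Otimes>\<^sub>M lborel) (\<lambda>(x, y). f x * f y)"
    by (rule lborel_pair.Fubini_integrable) (use fi f0 in \<open>auto simp: abs_mult\<close>)
  then have "(\<lambda>(x, y). f x * f y) integrable_on UNIV"
    unfolding lborel_prod by (rule integrable_on_lborel)
  moreover have "(\<lambda>(x, y). f x * f y) =
      (\<lambda>u. if u \<in> square d then \<bar>fst u\<bar> powr (- q / 2) * \<bar>snd u\<bar> powr (- q / 2) else 0)"
    by (auto simp: fun_eq_iff f_def cbox_Pair_eq indicator_def)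
  ultimately have prod: "(\<lambda>u. \<bar>fst u\<bar> powr (- q / 2) * \<bar>snd u\<bar> powr (- q / 2)) integrable_on square d"
    by (simp only: integrable_restrict_UNIV)
  \<comment> \<open>On the axes the domination can fail, because \<open>0 powr a = 0\<close> makes
    the product vanish there; they are a null set and are removed.\<close>
  define Z where "Z = {u :: real \<times> real. (1, 0) \<bullet> u = 0} \<union> {u. (0, 1) \<bullet> u = 0}"
  have Z: "negligible Z" unfolding Z_def by (intro negligible_Un negligible_hyperplane) (auto simp: zero_prod_def)
  let ?S = "square d - Z"
  have Zneg: "negligible ((square d - ?S) \<union> (?S - square d))"
    by (rule negligible_subset[OF Z]) auto
  have S: "?S \<in> sets lebesgue" using Z by (simp add: negligible_imp_sets sets.Diff)
  have prodS: "(\<lambda>u. \<bar>fst u\<bar> powr (- q / 2) * \<bar>snd u\<bar> powr (- q / 2)) integrable_on ?S"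
    using prod by (rule integrable_spike_set) (auto intro: negligible_subset[OF Z])
  have "(\<lambda>u. norm u powr (- q)) integrable_on ?S"
  proof (rule measurable_bounded_by_integrable_imp_integrable_real[OF _ prodS _ S])
    show "(\<lambda>u :: real \<times> real. norm u powr (- q)) \<in> borel_measurable (lebesgue_on ?S)"
      by (rule measurable_restrict_space1, rule measurable_completion) measurable
    fix u :: "real \<times> real" assume u: "u \<in> ?S"
    then have nz: "fst u \<noteq> 0" "snd u \<noteq> 0" by (auto simp: Z_def inner_prod_def)
    have "norm u powr (- q) = norm u powr (- q / 2) * norm u powr (- q / 2)"
      using nz by (simp flip: powr_add)
    also have "\<dots> \<le> \<bar>fst u\<bar> powr (- q / 2) * \<bar>snd u\<bar> powr (- q / 2)"
      using nz q norm_fst_le[of "fst u" "snd u"] norm_snd_le[of "snd u" "fst u"]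
      by (intro mult_mono powr_mono2') auto
    finally show "\<bar>norm u powr (- q)\<bar> \<le> \<bar>fst u\<bar> powr (- q / 2) * \<bar>snd u\<bar> powr (- q / 2)" by simp
  qed
  then show ?thesis
    by (rule integrable_spike_set) (auto intro: negligible_subset[OF Z])
qed

text \<open>Mean value theorem for s / w^3 with w^2 = a^2 + s^2: the derivative (w^2 - 3 s^2) / w^5
  is at most 2 / w^3 in absolute value, hence at most 2 / a^3, uniformly in h. With a = |u| and f of
  order a^(1 + l) the result is of order a^(l - 2).\<close>

lemma plane_kernel_diff_bound:
  fixes a f h :: real
  assumes a: "a > 0"
  shows "\<bar>(h - f) / (sqrt (a\<^sup>2 + (h - f)\<^sup>2)) ^ 3 - h / (sqrt (a\<^sup>2 + h\<^sup>2)) ^ 3\<bar> \<le> 2 * \<bar>f\<bar> / a ^ 3"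
proof -
  let ?k = "\<lambda>s. s / (sqrt (a\<^sup>2 + s\<^sup>2)) ^ 3"
  have der: "(?k has_real_derivative ((sqrt (a\<^sup>2 + s\<^sup>2))\<^sup>2 - 3 * s\<^sup>2) / (sqrt (a\<^sup>2 + s\<^sup>2)) ^ 5) (at s)" for s
  proof -
    define w where "w = sqrt (a\<^sup>2 + s\<^sup>2)"
    have pos: "a\<^sup>2 + s\<^sup>2 > 0" using a by (simp add: add_pos_nonneg)
    then have w: "w > 0" by (simp add: w_def)
    have "((\<lambda>s. sqrt (a\<^sup>2 + s\<^sup>2)) has_real_derivative s / w) (at s)"
      using pos by (auto intro!: derivative_eq_intros simp: w_def field_simps)
    from DERIV_power[OF this, of 3]
    have "((\<lambda>s. sqrt (a\<^sup>2 + s\<^sup>2) ^ 3) has_real_derivative 3 * w\<^sup>2 * (s / w)) (at s)"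
      by (rule DERIV_cong) (simp add: w_def power2_eq_square numeral_3_eq_3)
    from DERIV_divide[OF DERIV_ident this]
    have "(?k has_real_derivative (1 * w ^ 3 - s * (3 * w\<^sup>2 * (s / w))) / (w ^ 3 * w ^ 3)) (at s)"
      using w a by (simp add: w_def)
    also have "(1 * w ^ 3 - s * (3 * w\<^sup>2 * (s / w))) / (w ^ 3 * w ^ 3) = (w\<^sup>2 - 3 * s\<^sup>2) / w ^ 5"
      using w by (simp add: divide_simps) (simp add: eval_nat_numeral algebra_simps)
    finally show ?thesis by (simp add: w_def)
  qed
  have bound: "norm (((sqrt (a\<^sup>2 + s\<^sup>2))\<^sup>2 - 3 * s\<^sup>2) / (sqrt (a\<^sup>2 + s\<^sup>2)) ^ 5) \<le> 2 / a ^ 3" for s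
  proof -
    define w where "w = sqrt (a\<^sup>2 + s\<^sup>2)"
    have w: "w \<ge> a" "w\<^sup>2 = a\<^sup>2 + s\<^sup>2" using a by (auto simp: w_def real_le_rsqrt)
    have w0: "w > 0" using w a by simp
    have "\<bar>w\<^sup>2 - 3 * s\<^sup>2\<bar> \<le> 2 * w\<^sup>2" unfolding w(2) by (simp add: abs_le_iff)
    then have "\<bar>w\<^sup>2 - 3 * s\<^sup>2\<bar> / w ^ 5 \<le> 2 * w\<^sup>2 / w ^ 5" using w0 by (intro divide_right_mono) auto
    also have "\<dots> = 2 / w ^ 3" using w0 by (simp add: eval_nat_numeral)
    also have "\<dots> \<le> 2 / a ^ 3" using w a by (intro divide_left_mono power_mono) auto
    finally show ?thesis using w0 by (simp add: w_def)
  qed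
  have "norm (?k (h - f) - ?k h) \<le> 2 / a ^ 3 * norm ((h - f) - h)"
    by (rule field_differentiable_bound[of UNIV ?k]) (use der bound in auto)
  then show ?thesis by simp
qed

lemma plane_kernel_minus: "plane_kernel (- h) u = - plane_kernel h u"
  by (simp add: plane_kernel_def)

lemma abs_plane_kernel_le:
  assumes "norm u \<ge> e" "e > 0"
  shows "\<bar>plane_kernel h u\<bar> \<le> \<bar>h\<bar> / e ^ 3"
proof -
  have "e \<le> sqrt ((norm u)\<^sup>2 + h\<^sup>2)"
    using assms by (intro real_le_rsqrt) (smt (verit) power_mono zero_le_power2)
  then have "e ^ 3 \<le> sqrt ((norm u)\<^sup>2 + h\<^sup>2) ^ 3" using assms by (intro power_mono) auto
  then show ?thesis
    unfolding plane_kernel_def abs_divide using assms by (intro frac_le) auto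
qed

text \<open>The square is split at radius \<eta>. Inside, \<open>m\<close> is small and the kernel
  has mass at most 2 pi; outside, \<open>m\<close> is bounded and the kernel is at most |h| /
  \<eta>^3. The smallness of \<open>m\<close> is required jointly in h and u, since the kernel
  concentrates at u = 0 while h tends to 0.\<close>

lemma plane_kernel_approximate_identity:
  fixes m :: "real \<Rightarrow> real \<times> real \<Rightarrow> real"
  assumes d: "d > 0" and h0: "h0 > 0"
    and meas: "\<And>h. 0 < \<bar>h\<bar> \<Longrightarrow> \<bar>h\<bar> < h0 \<Longrightarrow> continuous_on (square d) (m h)"
    and bdd: "\<And>h u. 0 < \<bar>h\<bar> \<Longrightarrow> \<bar>h\<bar> < h0 \<Longrightarrow> u \<in> square d \<Longrightarrow> \<bar>m h u\<bar> \<le> B"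
    and small: "\<And>e. e > 0 \<Longrightarrow> \<exists>\<eta>>0. \<forall>h u. 0 < \<bar>h\<bar> \<longrightarrow> \<bar>h\<bar> < \<eta> \<longrightarrow> u \<in> square d \<longrightarrow> norm u < \<eta> \<longrightarrow> \<bar>m h u\<bar> \<le> e"
  shows "((\<lambda>h. integral (square d) (\<lambda>u. m h u * plane_kernel h u)) \<longlongrightarrow> 0) (at 0)"
proof (rule tendstoI)
  fix e :: real assume e: "e > 0"
  let ?E = "square d"
  \<comment> \<open>Chosen so that \<open>e1\<close> times the mass bound 2 pi is
    \<open>e / 2\<close>.\<close>
  define e1 where "e1 = e / (2 * pi) / 2"
  have e1: "e1 > 0" using e by (simp add: e1_def)
  obtain \<eta> where \<eta>: "\<eta> > 0" "\<And>h u. 0 < \<bar>h\<bar> \<Longrightarrow> \<bar>h\<bar> < \<eta> \<Longrightarrow> u \<in> ?E \<Longrightarrow> norm u < \<eta> \<Longrightarrow> \<bar>m h u\<bar> \<le> e1"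
    using small[OF e1] by blast
  define K where "K = \<bar>B\<bar> / \<eta> ^ 3 * measure lborel ?E"
  have K: "K \<ge> 0" using \<eta> by (simp add: K_def)
  \<comment> \<open>The last entry keeps the outer contribution, at most
    \<open>\<bar>h\<bar> * K\<close>, below \<open>e / 2\<close>; adding 1 to \<open>K\<close>
    avoids a division by 0.\<close>
  define h1 where "h1 = Min {h0, \<eta>, e / 2 / (K + 1)}"
  have h1: "h1 > 0" "h1 \<le> h0" "h1 \<le> \<eta>" "h1 \<le> e / 2 / (K + 1)"
    using h0 \<eta> e K by (auto simp: h1_def)
  have "\<bar>integral ?E (\<lambda>u. m h u * plane_kernel h u)\<bar> < e" if h: "0 < \<bar>h\<bar>" "\<bar>h\<bar> < h1" for h
  proof -
    have hh: "\<bar>h\<bar> < h0" "\<bar>h\<bar> < \<eta>" "h \<noteq> 0" using h h1 by auto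
    have c1: "continuous_on ?E (plane_kernel h)" by (rule continuous_on_plane_kernel[OF hh(3)])
    have c2: "continuous_on ?E (\<lambda>u. m h u * plane_kernel h u)"
      using meas[OF h(1) hh(1)] c1 by (intro continuous_on_mult)
    have c3: "continuous_on ?E (\<lambda>u. e1 * \<bar>plane_kernel h u\<bar> + \<bar>B\<bar> * (\<bar>h\<bar> / \<eta> ^ 3))"
      using c1 by (intro continuous_intros)
    have i3: "(\<lambda>u. e1 * \<bar>plane_kernel h u\<bar>) integrable_on ?E"
      using c1 by (intro integrable_continuous continuous_intros)
    have "norm (m h u * plane_kernel h u) \<le> e1 * \<bar>plane_kernel h u\<bar> + \<bar>B\<bar> * (\<bar>h\<bar> / \<eta> ^ 3)" if u: "u \<in> ?E" for u
    proof (cases "norm u < \<eta>")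
      case True
      then have "\<bar>m h u\<bar> * \<bar>plane_kernel h u\<bar> \<le> e1 * \<bar>plane_kernel h u\<bar>"
        using \<eta>(2)[OF h(1) hh(2) u] by (intro mult_right_mono) auto
      moreover have "0 \<le> \<bar>B\<bar> * (\<bar>h\<bar> / \<eta> ^ 3)" using \<eta>(1) by simp
      ultimately show ?thesis by (simp add: abs_mult)
    next
      case False
      have "\<bar>m h u\<bar> * \<bar>plane_kernel h u\<bar> \<le> \<bar>B\<bar> * (\<bar>h\<bar> / \<eta> ^ 3)"
        using bdd[OF h(1) hh(1) u] abs_plane_kernel_le[of \<eta> u h] False \<eta>(1)
        by (intro mult_mono) auto
      moreover have "0 \<le> e1 * \<bar>plane_kernel h u\<bar>" using e1 by simp
      ultimately show ?thesis by (simp add: abs_mult)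
    qed
    then have "norm (integral ?E (\<lambda>u. m h u * plane_kernel h u))
        \<le> integral ?E (\<lambda>u. e1 * \<bar>plane_kernel h u\<bar> + \<bar>B\<bar> * (\<bar>h\<bar> / \<eta> ^ 3))"
      by (intro integral_norm_bound_integral integrable_continuous c2 c3)
    also have "\<dots> = e1 * integral ?E (\<lambda>u. \<bar>plane_kernel h u\<bar>) + measure lborel ?E * (\<bar>B\<bar> * (\<bar>h\<bar> / \<eta> ^ 3))"
      using i3 by (subst integral_add) (auto simp: integral_mult_right)
    also have "\<dots> \<le> e1 * (2 * pi) + \<bar>h\<bar> * K"
      using integral_plane_kernel_abs_le[OF hh(3) d] e1
      by (intro add_mono mult_left_mono) (auto simp: K_def mult_ac)
    also have "e1 * (2 * pi) = e / 2" by (simp add: e1_def)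
    also have "\<bar>h\<bar> * K < e / 2"
    proof -
      have "\<bar>h\<bar> * K \<le> \<bar>h\<bar> * (K + 1)" by (simp add: algebra_simps)
      also have "\<dots> < h1 * (K + 1)" using h K by (intro mult_strict_right_mono) auto
      also have "\<dots> \<le> e / 2" using h1(4) K pos_le_divide_eq[of "K + 1" h1 "e / 2"] by linarith
      finally show ?thesis .
    qed
    finally show ?thesis by simp
  qed
  then show "\<forall>\<^sub>F h in at 0. dist (integral ?E (\<lambda>u. m h u * plane_kernel h u)) 0 < e"
    unfolding eventually_at using h1(1) by (intro exI[of _ h1]) auto
qed

text \<open>Three limits are combined. \<open>I + m * plane_kernel\<close> is dominated, and for u
  \<noteq> 0 the added term vanishes in the limit, so its integral tends to that of
  \<open>L\<close>; the integral of \<open>(m - m0) * plane_kernel\<close> tends to 0; that of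
  \<open>m0 * plane_kernel\<close> tends to 2 pi \<open>m0\<close> from the right and, the kernel
  being odd in h, to its negative from the left.\<close>

lemma local_jump:
  fixes I m :: "real \<Rightarrow> real \<times> real \<Rightarrow> real"
  defines "E \<equiv> \<lambda>d. square d"
  assumes d: "d > 0" and h0: "h0 > 0"
    and I: "\<And>h. 0 < \<bar>h\<bar> \<Longrightarrow> \<bar>h\<bar> < h0 \<Longrightarrow> continuous_on (E d) (I h)"
    and m: "\<And>h. 0 < \<bar>h\<bar> \<Longrightarrow> \<bar>h\<bar> < h0 \<Longrightarrow> continuous_on (E d) (m h)"
    and bdd: "\<And>h u. 0 < \<bar>h\<bar> \<Longrightarrow> \<bar>h\<bar> < h0 \<Longrightarrow> u \<in> E d \<Longrightarrow> \<bar>m h u\<bar> \<le> B"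
    and g: "g integrable_on E d"
    and dom: "\<And>h u. 0 < \<bar>h\<bar> \<Longrightarrow> \<bar>h\<bar> < h0 \<Longrightarrow> u \<in> E d \<Longrightarrow> u \<noteq> 0 \<Longrightarrow> \<bar>I h u + m h u * plane_kernel h u\<bar> \<le> g u"
    and lim: "\<And>u. u \<in> E d \<Longrightarrow> u \<noteq> 0 \<Longrightarrow> ((\<lambda>h. I h u) \<longlongrightarrow> L u) (at 0)"
    and m0: "\<And>e. e > 0 \<Longrightarrow> \<exists>\<eta>>0. \<forall>h u. 0 < \<bar>h\<bar> \<longrightarrow> \<bar>h\<bar> < \<eta> \<longrightarrow> u \<in> E d \<longrightarrow> norm u < \<eta> \<longrightarrow> \<bar>m h u - m0\<bar> \<le> e"
  shows "L absolutely_integrable_on E d"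
    and "((\<lambda>h. integral (E d) (I h)) \<longlongrightarrow> integral (E d) L - 2 * pi * m0) (at_right 0)"
    and "((\<lambda>h. integral (E d) (I h)) \<longlongrightarrow> integral (E d) L + 2 * pi * m0) (at_left 0)"
proof -
  \<comment> \<open>The majorant and the pointwise limit are available only for u \<noteq> 0, so
    dominated convergence is applied on the punctured square, with the same integrals.\<close>
  let ?E = "E d" and ?S = "E d - {0}"
  let ?J = "\<lambda>h u. I h u + m h u * plane_kernel h u"
  have pk: "continuous_on ?E (plane_kernel h)" if "h \<noteq> 0" for h
    using continuous_on_plane_kernel[OF that] .
  have iJ: "?J h integrable_on ?E" if "0 < \<bar>h\<bar>" "\<bar>h\<bar> < h0" for h
    unfolding E_def by (rule integrable_continuous)
      (use that I m pk in \<open>auto simp: E_def intro!: continuous_intros\<close>)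
  have spike: "f integrable_on ?S \<longleftrightarrow> f integrable_on ?E" "integral ?S f = integral ?E f"
    "f absolutely_integrable_on ?S \<longleftrightarrow> f absolutely_integrable_on ?E" for f :: "real \<times> real \<Rightarrow> real"
  proof -
    have n: "negligible {x \<in> ?S - ?E. f x \<noteq> 0}" "negligible {x \<in> ?E - ?S. f x \<noteq> 0}"
      by (auto intro: negligible_subset[OF negligible_sing[of 0]])
    show "f integrable_on ?S \<longleftrightarrow> f integrable_on ?E" by (rule integrable_spike_set_eq) (use n in \<open>auto intro: negligible_subset[OF negligible_sing[of 0]]\<close>)
    show "integral ?S f = integral ?E f" by (rule integral_spike_set[OF n])
    show "f absolutely_integrable_on ?S \<longleftrightarrow> f absolutely_integrable_on ?E" by (rule absolutely_integrable_spike_set_eq[OF n])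
  qed
  have limJ: "((\<lambda>h. ?J h u) \<longlongrightarrow> L u) (at 0)" if u: "u \<in> ?S" for u
  proof -
    have nu: "norm u > 0" using u by auto
    have "((\<lambda>h. m h u * plane_kernel h u) \<longlongrightarrow> 0) (at 0)"
    proof (rule tendsto_0_le[of "\<lambda>h::real. h" _ _ "\<bar>B\<bar> / norm u ^ 3"])
      have "norm (m h u * plane_kernel h u) \<le> norm h * (\<bar>B\<bar> / norm u ^ 3)" if h: "0 < \<bar>h\<bar>" "\<bar>h\<bar> < h0" for h
      proof -
        have "\<bar>m h u\<bar> * \<bar>plane_kernel h u\<bar> \<le> \<bar>B\<bar> * (\<bar>h\<bar> / norm u ^ 3)"
          using bdd[OF h, of u] u abs_plane_kernel_le[OF order_refl nu] by (intro mult_mono) auto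
        then show ?thesis by (simp add: abs_mult mult.commute)
      qed
      then show "\<forall>\<^sub>F h in at 0. norm (m h u * plane_kernel h u) \<le> norm h * (\<bar>B\<bar> / norm u ^ 3)"
        unfolding eventually_at using h0 by (intro exI[of _ h0]) auto
    qed simp
    from tendsto_add[OF lim this] u show ?thesis by simp
  qed
  have J: "L absolutely_integrable_on ?S" "((\<lambda>h. integral ?S (?J h)) \<longlongrightarrow> integral ?S L) (at 0)"
    using dominated_convergence_at_0[of h0 ?J ?S g L] h0 iJ spike(1) g dom limJ by auto
  then show "L absolutely_integrable_on E d" using spike by blast
  have "((\<lambda>h. integral ?E (\<lambda>u. (m h u - m0) * plane_kernel h u)) \<longlongrightarrow> 0) (at 0)"
    unfolding E_def
  proof (rule plane_kernel_approximate_identity[OF d h0, of "\<lambda>h u. m h u - m0" "\<bar>B\<bar> + \<bar>m0\<bar>"])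
    show "\<bar>m h u - m0\<bar> \<le> \<bar>B\<bar> + \<bar>m0\<bar>" if "0 < \<bar>h\<bar>" "\<bar>h\<bar> < h0" "u \<in> square d" for h u
      using bdd[of h u] that unfolding E_def by force
  qed (use m m0 in \<open>auto simp: E_def intro!: continuous_intros\<close>)
  from tendsto_diff[OF J(2)[unfolded spike] this]
  have lim0: "((\<lambda>h. integral ?E (?J h) - integral ?E (\<lambda>u. (m h u - m0) * plane_kernel h u)) \<longlongrightarrow> integral ?E L) (at 0)"
    by simp
  have eq: "integral ?E (?J h) - integral ?E (\<lambda>u. (m h u - m0) * plane_kernel h u)
      = integral ?E (I h) + m0 * integral ?E (plane_kernel h)" if h: "0 < \<bar>h\<bar>" "\<bar>h\<bar> < h0" for h
  proof -
    have h': "h \<noteq> 0" using h by auto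
    have c: "I h integrable_on ?E" "(\<lambda>u. m h u * plane_kernel h u) integrable_on ?E"
      "(\<lambda>u. m0 * plane_kernel h u) integrable_on ?E"
      using I[OF h] m[OF h] pk[OF h'] unfolding E_def
      by (auto intro!: integrable_continuous continuous_intros)
    have "integral ?E (?J h) = integral ?E (I h) + integral ?E (\<lambda>u. m h u * plane_kernel h u)"
      using c by (intro integral_add)
    moreover have "integral ?E (\<lambda>u. (m h u - m0) * plane_kernel h u)
        = integral ?E (\<lambda>u. m h u * plane_kernel h u) - integral ?E (\<lambda>u. m0 * plane_kernel h u)"
      using c by (simp add: left_diff_distrib integral_diff)
    ultimately show ?thesis by simp
  qed
  have lim1: "((\<lambda>h. integral ?E (I h) + m0 * integral ?E (plane_kernel h)) \<longlongrightarrow> integral ?E L) (at 0)"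
  proof (rule Lim_transform_eventually[OF lim0])
    show "\<forall>\<^sub>F h in at 0. integral ?E (?J h) - integral ?E (\<lambda>u. (m h u - m0) * plane_kernel h u)
      = integral ?E (I h) + m0 * integral ?E (plane_kernel h)"
      unfolding eventually_at using h0 eq by (intro exI[of _ h0]) auto
  qed
  have pr: "((\<lambda>h. integral ?E (plane_kernel h)) \<longlongrightarrow> 2 * pi) (at_right 0)"
    using integral_plane_kernel_tendsto[OF d] unfolding E_def .
  have "plane_kernel (- h) = (\<lambda>u. - plane_kernel h u)" for h
    by (simp add: fun_eq_iff plane_kernel_minus)
  then have pl: "((\<lambda>h. integral ?E (plane_kernel h)) \<longlongrightarrow> - (2 * pi)) (at_left 0)"
    using tendsto_minus[OF pr] unfolding filterlim_at_left_to_right by simp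
  have lr: "((\<lambda>h. integral ?E (I h) + m0 * integral ?E (plane_kernel h)) \<longlongrightarrow> integral ?E L) (at_right 0)"
    "((\<lambda>h. integral ?E (I h) + m0 * integral ?E (plane_kernel h)) \<longlongrightarrow> integral ?E L) (at_left 0)"
    using lim1 by (auto simp: filterlim_at_split)
  show "((\<lambda>h. integral ?E (I h)) \<longlongrightarrow> integral ?E L - 2 * pi * m0) (at_right 0)"
    using tendsto_diff[OF lr(1) tendsto_mult[OF tendsto_const[of m0] pr]] by (simp add: mult.commute)
  show "((\<lambda>h. integral ?E (I h)) \<longlongrightarrow> integral ?E L + 2 * pi * m0) (at_left 0)"
    using tendsto_diff[OF lr(2) tendsto_mult[OF tendsto_const[of m0] pl]] by (simp add: mult.commute)
qed


section \<open>Lyapunov surfaces as local graphs\<close>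

lemma unit_normal_minus: "unit_normal S N (- n) \<longleftrightarrow> unit_normal S N n"
  unfolding unit_normal_def
  using tendsto_minus_cancel_left[of "\<lambda>Q. (n \<bullet> (Q - N)) / norm (Q - N)" 0] by auto

text \<open>Connects the set-theoretic normal with tangent vectors. If \<open>v\<close> is not 0,
  then \<open>c y\<close> differs from \<open>c x\<close> near \<open>x\<close>, so the curve tends
  to \<open>c x\<close> through other points of \<open>S\<close> and the limit defining the normal
  applies to its secants. Multiplied by the norms of the difference quotients, it yields the inner
  product with \<open>v\<close> up to sign.\<close>

lemma unit_normal_tangent:
  fixes c :: "real \<Rightarrow> real^3"
  assumes v: "(c has_vector_derivative v) (at x within I)" and ev: "\<forall>\<^sub>F y in at x within I. c y \<in> S"
    and n: "unit_normal S (c x) n" and nb: "at x within I \<noteq> bot"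
  shows "n \<bullet> v = 0"
proof (cases "v = 0")
  case False
  let ?F = "at x within I"
  have lim: "((\<lambda>y. (1 / (y - x)) *\<^sub>R (c y - c x)) \<longlongrightarrow> v) ?F"
  proof -
    have "((\<lambda>y. norm ((c y - c x) - (y - x) *\<^sub>R v) / norm (y - x)) \<longlongrightarrow> 0) ?F"
      using v unfolding has_vector_derivative_def has_derivative_iff_norm by simp
    moreover have "\<forall>\<^sub>F y in ?F. norm ((c y - c x) - (y - x) *\<^sub>R v) / norm (y - x)
        = norm ((1 / (y - x)) *\<^sub>R (c y - c x) - v)"
      unfolding eventually_at
    proof (intro exI[of _ 1] conjI ballI impI)
      fix y assume "y \<in> I" "y \<noteq> x \<and> dist y x < 1"
      then have "(1 / (y - x)) *\<^sub>R (c y - c x) - v = (1 / (y - x)) *\<^sub>R ((c y - c x) - (y - x) *\<^sub>R v)"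
        by (simp add: scaleR_diff_right)
      then show "norm ((c y - c x) - (y - x) *\<^sub>R v) / norm (y - x) = norm ((1 / (y - x)) *\<^sub>R (c y - c x) - v)"
        by (simp only: norm_scaleR) simp
    qed simp
    ultimately have "((\<lambda>y. norm ((1 / (y - x)) *\<^sub>R (c y - c x) - v)) \<longlongrightarrow> 0) ?F"
      by (rule Lim_transform_eventually)
    then show ?thesis by (simp add: tendsto_norm_zero_iff LIM_zero_iff)
  qed
  have "\<forall>\<^sub>F y in ?F. (1 / (y - x)) *\<^sub>R (c y - c x) \<noteq> 0"
    using tendsto_imp_eventually_ne[OF lim False] .
  then have ne: "\<forall>\<^sub>F y in ?F. c y \<noteq> c x" by eventually_elim auto
  have "(c \<longlongrightarrow> c x) ?F"
    using has_vector_derivative_continuous[OF v] by (simp add: continuous_within)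
  then have "filterlim c (at (c x) within S) ?F"
    unfolding filterlim_at using eventually_conj[OF ev ne] by blast
  then have r: "((\<lambda>y. (n \<bullet> (c y - c x)) / norm (c y - c x)) \<longlongrightarrow> 0) ?F"
    using n unfolding unit_normal_def by (auto intro: filterlim_compose[rotated])
  have "((\<lambda>y. (n \<bullet> (c y - c x)) / norm (c y - c x) * norm ((1 / (y - x)) *\<^sub>R (c y - c x))) \<longlongrightarrow> 0 * norm v) ?F"
    by (intro tendsto_mult r tendsto_norm lim)
  then have "((\<lambda>y. \<bar>(n \<bullet> (c y - c x)) / norm (c y - c x) * norm ((1 / (y - x)) *\<^sub>R (c y - c x))\<bar>) \<longlongrightarrow> \<bar>0 * norm v\<bar>) ?F"
    by (rule tendsto_rabs)
  moreover have "\<forall>\<^sub>F y in ?F. \<bar>(n \<bullet> (c y - c x)) / norm (c y - c x) * norm ((1 / (y - x)) *\<^sub>R (c y - c x))\<bar>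
      = \<bar>n \<bullet> ((1 / (y - x)) *\<^sub>R (c y - c x))\<bar>"
    using ne by eventually_elim (simp add: abs_mult)
  ultimately have "((\<lambda>y. \<bar>n \<bullet> ((1 / (y - x)) *\<^sub>R (c y - c x))\<bar>) \<longlongrightarrow> \<bar>0 * norm v\<bar>) ?F"
    by (rule Lim_transform_eventually)
  moreover have "((\<lambda>y. \<bar>n \<bullet> ((1 / (y - x)) *\<^sub>R (c y - c x))\<bar>) \<longlongrightarrow> \<bar>n \<bullet> v\<bar>) ?F"
    by (intro tendsto_intros lim)
  ultimately have "\<bar>n \<bullet> v\<bar> = \<bar>0 * norm v\<bar>" using tendsto_unique[OF nb] by blast
  then show ?thesis by simp
qed simp

definition orthonormal_frame :: "real^3 \<Rightarrow> real^3 \<Rightarrow> real^3 \<Rightarrow> bool" where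
  "orthonormal_frame e1 e2 m \<longleftrightarrow> e1 \<bullet> e1 = 1 \<and> e2 \<bullet> e2 = 1 \<and> m \<bullet> m = 1 \<and> e1 \<bullet> e2 = 0 \<and> e1 \<bullet> m = 0 \<and> e2 \<bullet> m = 0"

lemma orthonormal_frame_exists:
  assumes "norm (m :: real^3) = 1"
  obtains e1 e2 where "orthonormal_frame e1 e2 m"
proof -
  have "norm (axis (3::3) (1::real)) = 1" by simp
  from orthogonal_transformation_exists_1[OF this assms]
  obtain T where T: "orthogonal_transformation T" "T (axis (3::3) (1::real)) = m" .
  have i: "T v \<bullet> T w = v \<bullet> w" for v w using T(1) by (simp add: orthogonal_transformation_def)
  have "orthonormal_frame (T (axis 1 1)) (T (axis 2 1)) (T (axis (3::3) 1))"
    unfolding orthonormal_frame_def i by (simp add: inner_axis_axis)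
  then show ?thesis using that T(2) by simp
qed

lemma orthonormal_frame_expand:
  assumes "orthonormal_frame e1 e2 m"
  shows "v = (v \<bullet> e1) *\<^sub>R e1 + (v \<bullet> e2) *\<^sub>R e2 + (v \<bullet> m) *\<^sub>R m"
proof -
  let ?B = "{e1, e2, m}"
  have ne: "e1 \<noteq> e2" "e1 \<noteq> m" "e2 \<noteq> m" "0 \<notin> ?B"
    using assms by (auto simp: orthonormal_frame_def)
  have po: "pairwise orthogonal ?B"
    using assms by (auto simp: orthonormal_frame_def pairwise_def orthogonal_def inner_commute)
  have ind: "independent ?B" using pairwise_orthogonal_independent[OF po ne(4)] .
  have "card ?B = 3" using ne by simp
  then have "span ?B = UNIV"
    using independent_card_le_dim[of ?B UNIV] card_eq_dim[of ?B UNIV] ind by (auto simp: dim_UNIV)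
  then have "v \<in> span ?B" by simp
  then obtain a b c where v: "v = a *\<^sub>R e1 + b *\<^sub>R e2 + c *\<^sub>R m"
    unfolding span_insert span_empty by (auto simp: algebra_simps)
  have "e2 \<bullet> e1 = 0" "m \<bullet> e1 = 0" "m \<bullet> e2 = 0"
    using assms by (simp_all add: orthonormal_frame_def inner_commute)
  then have "v \<bullet> e1 = a" "v \<bullet> e2 = b" "v \<bullet> m = c"
    using assms unfolding v by (simp_all add: orthonormal_frame_def inner_add_left)
  then show ?thesis using v by simp
qed

lemma quarter_bound: "x \<le> y + z \<Longrightarrow> y \<le> 1 / 4 * w \<Longrightarrow> w \<le> v \<Longrightarrow> x \<le> 1 / 4 * v + z"
  for x y z w v :: real
  by linarith

lemma quarter_absorb:
  fixes x y z w :: real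
  assumes "x * (1 / 2) \<le> y" "y \<le> 1 / 4 * (z + x) + z" "w \<le> z + x"
  shows "w \<le> 6 * z"
proof -
  have "x \<le> 2 * y" using assms(1) by simp
  moreover have "4 * y \<le> 5 * z + x"
  proof -
    have "4 * y \<le> 4 * (1 / 4 * (z + x) + z)" using assms(2) by (intro mult_left_mono) auto
    also have "\<dots> = 5 * z + x" by (simp add: algebra_simps)
    finally show ?thesis .
  qed
  ultimately show ?thesis using assms(3) by linarith
qed

text \<open>The data around one point \<open>N\<close>. The radius \<open>\<kappa>0\<close> lets the
  user shrink the patch; it will be half the distance of \<open>N\<close> from the plane x =
  0.\<close>

locale lyapunov_chart =
  fixes S :: "(real^3) set" and \<nu> :: "real^3 \<Rightarrow> real^3" and d0 A l \<kappa>0 :: real and N e1 e2 :: "real^3"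
    and U :: "(real^3) set"
  assumes N: "N \<in> S"
    and normal: "\<And>Q. Q \<in> S \<Longrightarrow> unit_normal S Q (\<nu> Q)"
    and line: "\<And>P Q c. P \<in> S \<inter> ball N d0 \<Longrightarrow> Q \<in> S \<inter> ball N d0 \<Longrightarrow> Q = P + c *\<^sub>R \<nu> N \<Longrightarrow> Q = P"
    and angle: "\<And>Q. Q \<in> S \<Longrightarrow> arccos (\<nu> N \<bullet> \<nu> Q) \<le> A * dist N Q powr l"
    and pos: "0 < d0" "0 < A" "0 < l" "l \<le> 1" "0 < \<kappa>0"
    and frame: "orthonormal_frame e1 e2 (\<nu> N)"
    and U: "openin (top_of_set S) U" "N \<in> U" "U homeomorphic (ball 0 1 :: (real^2) set)"
begin

abbreviation "m \<equiv> \<nu> N"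

text \<open>Over the tangent plane at \<open>N\<close> the patch \<open>W\<close> of \<open>S\<close> is the graph of the height function \<open>f\<close>;
  \<open>sg\<close> inverts the projection \<open>pr\<close> on it. The radius \<open>r0\<close> keeps the angle between the normals on
  \<open>W\<close> and the normal at \<open>N\<close> below 1/2.\<close>

definition pr :: "real^3 \<Rightarrow> real \<times> real" where "pr P = ((P - N) \<bullet> e1, (P - N) \<bullet> e2)"

definition tang :: "real \<times> real \<Rightarrow> real^3" where "tang u = fst u *\<^sub>R e1 + snd u *\<^sub>R e2"

definition r0 :: real where "r0 = min d0 (min \<kappa>0 ((1 / (2 * A)) powr (1 / l)))"

definition W :: "(real^3) set" where "W = U \<inter> ball N r0"

definition sg :: "real \<times> real \<Rightarrow> real^3" where "sg u = inv_into W pr u"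

definition f :: "real \<times> real \<Rightarrow> real" where "f u = (sg u - N) \<bullet> m"

lemma fr: "e1 \<bullet> e1 = 1" "e2 \<bullet> e2 = 1" "m \<bullet> m = 1" "e1 \<bullet> e2 = 0" "e2 \<bullet> e1 = 0" "e1 \<bullet> m = 0" "e2 \<bullet> m = 0"
    "m \<bullet> e1 = 0" "m \<bullet> e2 = 0"
  using frame by (auto simp: orthonormal_frame_def inner_commute)

lemma r0_pos: "r0 > 0" "r0 \<le> d0" "r0 \<le> \<kappa>0"
  using pos by (auto simp: r0_def)

lemma r0_angle:
  assumes "dist N Q < r0" shows "A * dist N Q powr l \<le> 1 / 2"
proof -
  have "dist N Q powr l \<le> r0 powr l" using assms pos by (intro powr_mono2) auto
  also have "\<dots> \<le> ((1 / (2 * A)) powr (1 / l)) powr l"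
    using pos r0_pos by (intro powr_mono2) (auto simp: r0_def)
  also have "\<dots> = 1 / (2 * A)" using pos by (simp add: powr_powr)
  finally show ?thesis using pos by (simp add: field_simps)
qed

lemma unit_nu: "Q \<in> S \<Longrightarrow> norm (\<nu> Q) = 1"
  using normal by (simp add: unit_normal_def)

text \<open>Within \<open>r0\<close> the angle is at most 1/2, less than pi/3, so its cosine is at
  least 1/2. The component of \<open>\<nu> Q\<close> tangential at \<open>N\<close> has the sine of
  the angle as its length, which is at most the angle.\<close>

lemma nu_bounds:
  assumes Q: "Q \<in> S" "dist N Q < r0"
  shows "m \<bullet> \<nu> Q \<ge> 1 / 2" "norm (\<nu> Q - (m \<bullet> \<nu> Q) *\<^sub>R m) \<le> A * dist N Q powr l"
proof -
  define c where "c = m \<bullet> \<nu> Q"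
  have c: "-1 \<le> c" "c \<le> 1"
    using Cauchy_Schwarz_ineq2[of m "\<nu> Q"] unit_nu[OF Q(1)] unit_nu[OF N] by (auto simp: c_def)
  define th where "th = arccos c"
  have th: "th \<le> A * dist N Q powr l" "0 \<le> th" "cos th = c"
    using angle[OF Q(1)] c by (auto simp: th_def c_def arccos_lbound)
  have th2: "th \<le> 1 / 2" using th(1) r0_angle[OF Q(2)] by simp
  have "1 / 2 = cos (pi / 3)" by (simp add: cos_60)
  also have "\<dots> \<le> cos th" using th th2 pi_gt3 by (intro cos_monotone_0_pi_le) auto
  finally show "m \<bullet> \<nu> Q \<ge> 1 / 2" using th by (simp add: c_def)
  have "(norm (\<nu> Q - c *\<^sub>R m))\<^sup>2 = \<nu> Q \<bullet> \<nu> Q - 2 * c * (m \<bullet> \<nu> Q) + c\<^sup>2 * (m \<bullet> m)"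
    unfolding power2_norm_eq_inner by (simp add: algebra_simps inner_commute power2_eq_square)
  also have "\<dots> = 1 - c\<^sup>2" using unit_nu[OF Q(1)] fr by (simp add: c_def[symmetric] norm_eq_1 power2_eq_square)
  also have "\<dots> = (sin th)\<^sup>2" using th(3) by (simp add: sin_squared_eq)
  also have "\<dots> \<le> th\<^sup>2" using abs_sin_x_le_abs_x[of th] by (rule abs_le_square_iff[THEN iffD1])
  finally have "norm (\<nu> Q - c *\<^sub>R m) \<le> th" using th(2) by (rule power2_le_imp_le)
  then show "norm (\<nu> Q - (m \<bullet> \<nu> Q) *\<^sub>R m) \<le> A * dist N Q powr l"
    using th(1) by (simp add: c_def)
qed

lemma W_sub: "W \<subseteq> S" "W \<subseteq> U" "W \<subseteq> ball N r0" and N_W: "N \<in> W" and openin_W: "openin (top_of_set S) W"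
  using U r0_pos openin_subset[OF U(1)] openin_Int_open[OF U(1) open_ball] by (auto simp: W_def)

lemma pr_eq: "pr P = pr Q \<Longrightarrow> Q = P + ((Q - P) \<bullet> m) *\<^sub>R m"
proof -
  assume "pr P = pr Q"
  then have "(Q - P) \<bullet> e1 = 0" "(Q - P) \<bullet> e2 = 0"
    by (auto simp: pr_def inner_diff_left)
  then have "Q - P = ((Q - P) \<bullet> m) *\<^sub>R m"
    using orthonormal_frame_expand[OF frame, of "Q - P"] by simp
  then show ?thesis by (metis add_diff_cancel_left' diff_add_cancel add.commute)
qed

lemma inj_pr: "inj_on pr W"
proof (rule inj_onI)
  fix P Q assume PQ: "P \<in> W" "Q \<in> W" "pr P = pr Q"
  have b: "P \<in> S \<inter> ball N d0" "Q \<in> S \<inter> ball N d0" using PQ W_sub r0_pos by auto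
  show "P = Q" using line[OF b pr_eq[OF PQ(3)]] by simp
qed

lemma continuous_pr: "continuous_on T pr"
  unfolding pr_def by (intro continuous_intros)

text \<open>The place where the surface being a topological manifold enters: in a local chart to the
  plane the injective projection becomes a continuous injective map between planes, and invariance
  of domain makes it open. This also yields the continuity of \<open>sg\<close>.\<close>

lemma open_pr_image:
  assumes W': "openin (top_of_set S) W'" "W' \<subseteq> W"
  shows "open (pr ` W')"
proof -
  obtain a b where ab: "homeomorphism U (ball 0 1 :: (real^2) set) a b"
    using U(3) by (auto simp: homeomorphic_def)
  have W'U: "W' \<subseteq> U" using W' W_sub by blast
  have "openin (top_of_set U) W'"
    using W'(1) W'U openin_subset[OF U(1)] by (meson openin_subset_trans topspace_euclidean_subtopology subset_trans inf_le1 openin_imp_subset U(1))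
  then have "openin (top_of_set (ball 0 1)) (a ` W')"
    using ab homeomorphism_imp_open_map by blast
  then have oa: "open (a ` W')" using openin_open_trans by blast
  have ba: "b (a x) = x" if "x \<in> W'" for x using ab W'U that by (auto simp: homeomorphism_def)
  have "open ((\<lambda>x. pr (b x)) ` a ` W')"
  proof (rule invariance_of_domain_gen[OF oa])
    have "a ` W' \<subseteq> ball 0 1" using \<open>openin (top_of_set (ball 0 1)) (a ` W')\<close> by (rule openin_imp_subset)
    then have "continuous_on (a ` W') b"
      by (rule continuous_on_subset[OF homeomorphism_cont2[OF ab]])
    then show "continuous_on (a ` W') (\<lambda>x. pr (b x))"
      by (rule continuous_on_compose2[OF continuous_pr]) auto
    show "inj_on (\<lambda>x. pr (b x)) (a ` W')"
      using inj_pr W'(2) by (auto simp: inj_on_def ba subset_iff)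
  qed simp
  also have "(\<lambda>x. pr (b x)) ` a ` W' = pr ` W'" using ba by (force simp: image_image)
  finally show ?thesis .
qed

lemma sg_pr: "Q \<in> W \<Longrightarrow> sg (pr Q) = Q"
  unfolding sg_def using inj_pr by simp

lemma sg_in: "u \<in> pr ` W \<Longrightarrow> sg u \<in> W" and pr_sg: "u \<in> pr ` W \<Longrightarrow> pr (sg u) = u"
  unfolding sg_def by (auto simp: inv_into_into f_inv_into_f)

lemma continuous_sg: "continuous_on (pr ` W) sg"
  unfolding continuous_on_topological
proof (intro ballI allI impI)
  fix u B assume u: "u \<in> pr ` W" "open B" "sg u \<in> B"
  have "openin (top_of_set S) (W \<inter> B)"
    using openin_W u(2) by (meson openin_Int openin_open_Int openin_Int_open)
  then have "open (pr ` (W \<inter> B))" by (rule open_pr_image) auto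
  moreover have "u \<in> pr ` (W \<inter> B)" using u sg_in[OF u(1)] pr_sg[OF u(1)] by (metis IntI imageI)
  moreover have "sg y \<in> B" if "y \<in> pr ` (W \<inter> B)" for y using that sg_pr by auto
  ultimately show "\<exists>A. open A \<and> u \<in> A \<and> (\<forall>y\<in>pr ` W. y \<in> A \<longrightarrow> sg y \<in> B)" by blast
qed

lemma sg_eq:
  assumes "u \<in> pr ` W" shows "sg u = N + tang u + f u *\<^sub>R m"
proof -
  have "fst u = (sg u - N) \<bullet> e1" "snd u = (sg u - N) \<bullet> e2"
    using pr_sg[OF assms, symmetric] by (simp_all add: pr_def prod_eq_iff)
  then have "sg u - N = tang u + f u *\<^sub>R m"
    unfolding tang_def f_def using orthonormal_frame_expand[OF frame, of "sg u - N"] by simp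
  then have "N + (sg u - N) = N + (tang u + f u *\<^sub>R m)" by simp
  then show ?thesis by (simp add: add.assoc)
qed

section \<open>The height of the graph\<close>

lemma norm_tang: "norm (tang u) = norm u"
proof -
  have "tang u \<bullet> tang u = (norm u)\<^sup>2"
    unfolding norm_pair_sq tang_def inner_add_left inner_add_right inner_scaleR_left inner_scaleR_right fr
    by (simp add: power2_eq_square)
  then have "(norm (tang u))\<^sup>2 = (norm u)\<^sup>2" by (simp only: power2_norm_eq_inner)
  then show ?thesis by simp
qed

lemma tang_m: "tang u \<bullet> m = 0" and tang_scale: "tang (t *\<^sub>R u) = t *\<^sub>R tang u"
  by (auto simp: tang_def inner_add_left fr scaleR_add_right)

text \<open>By definition of the normal v at the point Q over \<open>t0 *\<^sub>R u\<close>, v is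
  orthogonal to secants up to o(|Q' - Q|). Solving for the increment of \<open>f\<close> gives the
  slope -b/c, where b is v times the tangent direction and c \<ge> 1/2 is v times \<open>m\<close>.
  First |Q' - Q|, which contains that very increment, has to be bounded by a multiple of |t -
  t0|.\<close>

lemma ray_derivative:
  assumes E: "\<And>t. t \<in> {0..1} \<Longrightarrow> t *\<^sub>R u \<in> pr ` W" and u: "u \<noteq> 0" and t0: "t0 \<in> {0..1}"
  obtains D where "((\<lambda>t. f (t *\<^sub>R u)) has_real_derivative D) (at t0 within {0..1})"
    "\<bar>D\<bar> \<le> 2 * A * dist N (sg (t0 *\<^sub>R u)) powr l * norm u"
proof -
  define Q where "Q = sg (t0 *\<^sub>R u)"
  have Q: "Q \<in> S" "dist N Q < r0" using sg_in[OF E[OF t0]] W_sub by (auto simp: Q_def)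
  define v where "v = \<nu> Q"
  define c where "c = m \<bullet> v"
  have c: "c \<ge> 1 / 2" using nu_bounds(1)[OF Q] by (simp add: c_def v_def)
  define b where "b = v \<bullet> tang u"
  have v1: "norm v = 1" using unit_nu[OF Q(1)] by (simp add: v_def)
  have "m \<bullet> tang u = 0" using tang_m[of u] by (simp only: inner_commute)
  then have "b = (v - c *\<^sub>R m) \<bullet> tang u" by (simp add: b_def inner_diff_left)
  then have "\<bar>b\<bar> \<le> norm (v - c *\<^sub>R m) * norm (tang u)" using Cauchy_Schwarz_ineq2 by metis
  also have "\<dots> \<le> (A * dist N Q powr l) * norm u"
    unfolding norm_tang using nu_bounds(2)[OF Q] by (intro mult_right_mono) (auto simp: v_def c_def)
  finally have b: "\<bar>b\<bar> \<le> (A * dist N Q powr l) * norm u" .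
  have b1: "\<bar>b\<bar> \<le> norm u" using Cauchy_Schwarz_ineq2[of v "tang u"] v1 by (simp add: b_def norm_tang)
  let ?F = "at t0 within {0..1}"
  let ?R = "\<lambda>t. v \<bullet> (sg (t *\<^sub>R u) - Q)"
  let ?D = "\<lambda>t. norm (sg (t *\<^sub>R u) - Q)"
  have diff: "sg (t *\<^sub>R u) - Q = (t - t0) *\<^sub>R tang u + (f (t *\<^sub>R u) - f (t0 *\<^sub>R u)) *\<^sub>R m" if "t \<in> {0..1}" for t
    using sg_eq[OF E[OF that]] sg_eq[OF E[OF t0]] by (simp add: Q_def tang_scale algebra_simps)
  have cont: "continuous_on {0..1} (\<lambda>t. sg (t *\<^sub>R u))"
    by (rule continuous_on_compose2[OF continuous_sg]) (use E in \<open>auto intro!: continuous_intros\<close>)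
  have "filterlim (\<lambda>t. sg (t *\<^sub>R u)) (at Q within S) ?F"
    unfolding filterlim_at
  proof
    show "((\<lambda>t. sg (t *\<^sub>R u)) \<longlongrightarrow> Q) ?F"
      using cont t0 unfolding continuous_on_def Q_def by blast
    have "sg (t *\<^sub>R u) \<in> S \<and> sg (t *\<^sub>R u) \<noteq> Q" if "t \<in> {0..1}" "t \<noteq> t0" for t
    proof -
      have "t *\<^sub>R u \<noteq> t0 *\<^sub>R u" using that u by simp
      then have "sg (t *\<^sub>R u) \<noteq> Q" unfolding Q_def using pr_sg[OF E[OF that(1)]] pr_sg[OF E[OF t0]] by metis
      then show ?thesis using sg_in[OF E[OF that(1)]] W_sub by auto
    qed
    then show "\<forall>\<^sub>F t in ?F. sg (t *\<^sub>R u) \<in> S \<and> sg (t *\<^sub>R u) \<noteq> Q"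
      unfolding eventually_at by (intro exI[of _ 1]) auto
  qed
  then have lim: "((\<lambda>t. ?R t / ?D t) \<longlongrightarrow> 0) ?F"
    using normal[OF Q(1)] unfolding unit_normal_def v_def by (auto intro: filterlim_compose[rotated])
  then have "\<forall>\<^sub>F t in ?F. \<bar>?R t / ?D t\<bar> < 1 / 4"
    by (auto dest!: tendstoD[of _ _ _ "1/4"])
  moreover have "\<forall>\<^sub>F t in ?F. t \<in> {0..1} \<and> t \<noteq> t0" by (simp add: eventually_at_filter)
  ultimately have "\<forall>\<^sub>F t in ?F. norm (?R t / (t - t0)) \<le> norm (?R t / ?D t) * (6 * norm u)"
  proof eventually_elim
    case (elim t)
    \<comment> \<open>The threshold 1/4 lies below c \<ge> 1/2, so the increment \<open>dl\<close>
      on the right is absorbed by the left: |dl| is at most 5 s |u|, and the secant is at most 6 s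
      |u|.\<close>
    define dl where "dl = f (t *\<^sub>R u) - f (t0 *\<^sub>R u)"
    define s where "s = \<bar>t - t0\<bar>"
    have s: "s > 0" using elim by (simp add: s_def)
    have RD: "\<bar>?R t\<bar> = \<bar>?R t / ?D t\<bar> * ?D t" by (cases "?D t = 0") (auto simp: abs_divide)
    also have "\<dots> \<le> 1 / 4 * ?D t" using elim by (intro mult_right_mono) auto
    finally have R4: "\<bar>?R t\<bar> \<le> 1 / 4 * ?D t" .
    have "?D t \<le> norm ((t - t0) *\<^sub>R tang u) + norm (dl *\<^sub>R m)"
      using diff[of t] elim unfolding dl_def by (metis norm_triangle_ineq)
    also have "\<dots> = s * norm u + \<bar>dl\<bar>" using unit_nu[OF N] by (simp add: s_def norm_tang)
    finally have D: "?D t \<le> s * norm u + \<bar>dl\<bar>" .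
    have "?R t = (t - t0) * b + dl * c"
      using diff[of t] elim by (simp add: dl_def b_def c_def inner_add_right inner_commute)
    then have 0: "\<bar>dl * c\<bar> \<le> \<bar>?R t\<bar> + \<bar>(t - t0) * b\<bar>" by linarith
    have 00: "\<bar>(t - t0) * b\<bar> \<le> s * norm u" unfolding abs_mult s_def using b1 by (intro mult_left_mono) auto
    have 1: "\<bar>dl * c\<bar> \<le> 1 / 4 * (s * norm u + \<bar>dl\<bar>) + s * norm u"
      by (rule quarter_bound[OF order_trans[OF 0 add_left_mono[OF 00]] R4 D])
    have "\<bar>dl\<bar> * (1 / 2) \<le> \<bar>dl * c\<bar>" unfolding abs_mult using c by (intro mult_left_mono) auto
    then have "?D t \<le> 6 * (s * norm u)" using 1 D by (rule quarter_absorb)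
    then have D6: "?D t \<le> 6 * norm u * s" by (simp add: mult.commute)
    have "\<bar>?R t / ?D t\<bar> * ?D t \<le> \<bar>?R t / ?D t\<bar> * (6 * norm u * s)"
      using D6 by (rule mult_left_mono) simp
    then have "\<bar>?R t\<bar> \<le> \<bar>?R t / ?D t\<bar> * (6 * norm u * s)"
      using RD by (rule ord_eq_le_trans[rotated])
    then have "\<bar>?R t\<bar> / s \<le> \<bar>?R t / ?D t\<bar> * (6 * norm u)" using s by (simp add: field_simps)
    then show ?case by (simp add: s_def abs_divide)
  qed
  from tendsto_0_le[OF lim this] have R0: "((\<lambda>t. ?R t / (t - t0)) \<longlongrightarrow> 0) ?F" .
  have "((\<lambda>t. (?R t / (t - t0) - b) / c) \<longlongrightarrow> (0 - b) / c) ?F"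
    by (intro tendsto_intros R0) (use c in auto)
  moreover have "\<forall>\<^sub>F t in ?F. (?R t / (t - t0) - b) / c = (f (t *\<^sub>R u) - f (t0 *\<^sub>R u)) / (t - t0)"
    unfolding eventually_at
  proof (intro exI[of _ 1] conjI ballI impI)
    fix t :: real assume t: "t \<in> {0..1}" "t \<noteq> t0 \<and> dist t t0 < 1"
    have "?R t = (t - t0) * b + (f (t *\<^sub>R u) - f (t0 *\<^sub>R u)) * c"
      using diff[of t] t by (simp add: b_def c_def inner_add_right inner_commute)
    then show "(?R t / (t - t0) - b) / c = (f (t *\<^sub>R u) - f (t0 *\<^sub>R u)) / (t - t0)"
      using t c by (simp add: add_divide_distrib)
  qed simp
  ultimately have "((\<lambda>t. (f (t *\<^sub>R u) - f (t0 *\<^sub>R u)) / (t - t0)) \<longlongrightarrow> - b / c) ?F"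
    by (simp add: filterlim_cong)
  then have "((\<lambda>t. f (t *\<^sub>R u)) has_real_derivative - b / c) ?F"
    by (simp add: has_field_derivative_iff)
  moreover have "\<bar>- b / c\<bar> \<le> 2 * A * dist N (sg (t0 *\<^sub>R u)) powr l * norm u"
  proof -
    have "\<bar>b\<bar> / c \<le> \<bar>b\<bar> / (1 / 2)" using c by (intro divide_left_mono) auto
    then show ?thesis using b c by (simp add: abs_divide Q_def)
  qed
  ultimately show ?thesis by (rule that)
qed

lemma f_bound_from_derivative:
  assumes E: "\<And>t. t \<in> {0..1} \<Longrightarrow> t *\<^sub>R u \<in> pr ` W"
    and K: "\<And>t. t \<in> {0..1} \<Longrightarrow> 2 * A * dist N (sg (t *\<^sub>R u)) powr l \<le> K"
  shows "\<bar>f u\<bar> \<le> K * norm u"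
proof (cases "u = 0")
  case True
  have "f (pr N) = 0" using sg_pr[OF N_W] by (simp add: f_def)
  then show ?thesis using True by (simp add: pr_def zero_prod_def)
next
  case False
  have "\<exists>D. \<forall>t\<in>{0..1}. ((\<lambda>t. f (t *\<^sub>R u)) has_real_derivative D t) (at t within {0..1}) \<and> norm (D t) \<le> K * norm u"
  proof (rule bchoice, rule ballI)
    fix t :: real assume t: "t \<in> {0..1}"
    obtain D where D: "((\<lambda>t. f (t *\<^sub>R u)) has_real_derivative D) (at t within {0..1})"
      "\<bar>D\<bar> \<le> 2 * A * dist N (sg (t *\<^sub>R u)) powr l * norm u"
      using ray_derivative[OF E False t] by blast
    have "2 * A * dist N (sg (t *\<^sub>R u)) powr l * norm u \<le> K * norm u"
      using K[OF t] by (intro mult_right_mono) auto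
    then show "\<exists>D. ((\<lambda>t. f (t *\<^sub>R u)) has_real_derivative D) (at t within {0..1}) \<and> norm D \<le> K * norm u"
      using D by (intro exI[of _ D]) auto
  qed
  then obtain D where D: "\<And>t. t \<in> {0..1} \<Longrightarrow> ((\<lambda>t. f (t *\<^sub>R u)) has_real_derivative D t) (at t within {0..1})"
    "\<And>t. t \<in> {0..1} \<Longrightarrow> norm (D t) \<le> K * norm u" by blast
  have "norm (f (1 *\<^sub>R u) - f (0 *\<^sub>R u)) \<le> K * norm u * norm (1 - 0 :: real)"
    by (rule field_differentiable_bound[of "{0..1}" "\<lambda>t. f (t *\<^sub>R u)" D]) (use D in auto)
  moreover have "f 0 = 0" using sg_pr[OF N_W] by (simp add: f_def pr_def zero_prod_def)
  ultimately show ?thesis by simp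
qed

text \<open>Two passes. The choice of \<open>r0\<close> first bounds the slope by 1, hence |f| by
  |u| along the whole ray, so points of the graph are within 2 |u| of \<open>N\<close>. With this
  distance the slope bound becomes 2 A (2 |u|)^l |u|, and 2^l \<le> 2 gives the constant 4
  A.\<close>

lemma f_bound:
  assumes E: "\<And>t. t \<in> {0..1} \<Longrightarrow> t *\<^sub>R u \<in> pr ` W"
  shows "\<bar>f u\<bar> \<le> 4 * A * norm u powr (1 + l)"
proof -
  have tt: "s *\<^sub>R t *\<^sub>R u \<in> pr ` W" if "t \<in> {0..1}" "s \<in> {0..1}" for s t
  proof -
    have "s * t \<in> {0..1}" using that by (auto intro: mult_le_one)
    then show ?thesis using E by simp
  qed
  have f1: "\<bar>f (t *\<^sub>R u)\<bar> \<le> norm (t *\<^sub>R u)" if t: "t \<in> {0..1}" for t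
  proof -
    have "\<bar>f (t *\<^sub>R u)\<bar> \<le> 1 * norm (t *\<^sub>R u)"
    proof (rule f_bound_from_derivative)
      fix s :: real assume s: "s \<in> {0..1}"
      show "s *\<^sub>R t *\<^sub>R u \<in> pr ` W" using tt[OF t s] .
      then have "dist N (sg (s *\<^sub>R t *\<^sub>R u)) < r0" using sg_in W_sub by (meson mem_ball subsetD)
      from r0_angle[OF this] show "2 * A * dist N (sg (s *\<^sub>R t *\<^sub>R u)) powr l \<le> 1" by linarith
    qed
    then show ?thesis by simp
  qed
  have "\<bar>f u\<bar> \<le> (2 * A * (2 * norm u) powr l) * norm u"
  proof (rule f_bound_from_derivative[OF E])
    fix t :: real assume t: "t \<in> {0..1}"
    have "dist N (sg (t *\<^sub>R u)) = norm (sg (t *\<^sub>R u) - N)" by (metis dist_commute dist_norm)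
    also have "\<dots> = norm (tang (t *\<^sub>R u) + f (t *\<^sub>R u) *\<^sub>R m)"
      using sg_eq[OF E[OF t]] by simp
    also have "\<dots> \<le> norm (t *\<^sub>R u) + \<bar>f (t *\<^sub>R u)\<bar>"
      using norm_triangle_ineq[of "tang (t *\<^sub>R u)" "f (t *\<^sub>R u) *\<^sub>R m"] unit_nu[OF N] by (simp add: norm_tang)
    also have "\<dots> \<le> 2 * norm (t *\<^sub>R u)" using f1[OF t] by simp
    also have "\<dots> \<le> 2 * norm u" using t by (auto intro: mult_left_le_one_le)
    finally have "dist N (sg (t *\<^sub>R u)) powr l \<le> (2 * norm u) powr l" using pos by (intro powr_mono2) auto
    then show "2 * A * dist N (sg (t *\<^sub>R u)) powr l \<le> 2 * A * (2 * norm u) powr l"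
      using pos by (intro mult_left_mono) auto
  qed
  also have "(2 * norm u) powr l = 2 powr l * norm u powr l" by (simp add: powr_mult)
  also have "2 * A * (2 powr l * norm u powr l) * norm u = 2 * A * 2 powr l * (norm u powr l * norm u)" by simp
  also have "norm u powr l * norm u = norm u powr (1 + l)" by (cases "u = 0") (auto simp: powr_add)
  also have "2 * A * 2 powr l * norm u powr (1 + l) \<le> 4 * A * norm u powr (1 + l)"
  proof (intro mult_right_mono)
    have "2 powr l \<le> 2 powr 1" using pos by (intro powr_mono) auto
    then show "2 * A * 2 powr l \<le> 4 * A" using pos by simp
  qed simp
  finally show ?thesis .
qed

lemma square_exists: "\<exists>d>0. square d \<subseteq> pr ` W"
proof -
  have "open (pr ` W)" using open_pr_image[OF openin_W] by simp
  moreover have "0 \<in> pr ` W" using N_W by (force simp: pr_def zero_prod_def)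
  ultimately obtain e where e: "e > 0" "ball 0 e \<subseteq> pr ` W" by (meson open_contains_ball)
  have "cbox (- (e/4), - (e/4)) (e/4, e/4) \<subseteq> ball 0 e"
  proof
    fix u assume "u \<in> cbox (- (e/4), - (e/4)) (e/4, e/4)"
    then have "\<bar>fst u\<bar> \<le> e / 4" "\<bar>snd u\<bar> \<le> e / 4" by (cases u; auto simp: cbox_Pair_eq)+
    then have "norm u \<le> e / 4 + e / 4" using norm_Pair_le[of "fst u" "snd u"] by simp
    then show "u \<in> ball 0 e" using e by simp
  qed
  then show ?thesis using e by (intro exI[of _ "e/4"]) auto
qed

lemma square_star:
  assumes "u \<in> square d" "t \<in> {0..1}"
  shows "t *\<^sub>R u \<in> cbox (-d, -d) (d, d :: real)"
proof -
  have d: "d \<ge> 0" using assms by (cases u) (auto simp: cbox_Pair_eq)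
  then have "0 \<in> square d" by (simp add: zero_prod_def cbox_Pair_eq)
  then have "(1 - t) *\<^sub>R 0 + t *\<^sub>R u \<in> square d"
    using assms convex_box(1) by (intro convexD) auto
  then show ?thesis by simp
qed

text \<open>Ensures that parameters not mapped over the square stay at a fixed distance from
  \<open>N\<close>: the part of the patch over the open square is a neighbourhood of
  \<open>N\<close> in \<open>S\<close>.\<close>

lemma square_covers:
  assumes d: "d > 0" "square d \<subseteq> pr ` W"
  shows "\<exists>\<kappa>>0. S \<inter> ball N \<kappa> \<subseteq> sg ` square d"
proof -
  define T where "T = W \<inter> pr -` box (-d, -d) (d, d)"
  have "open (pr -` box (-d, -d) (d, d))"
    by (rule open_vimage[OF open_box continuous_pr])
  then have "openin (top_of_set S) T"
    unfolding T_def using openin_W by (meson openin_Int_open)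
  moreover have "N \<in> T" using N_W d by (auto simp: T_def pr_def mem_box Basis_prod_def)
  ultimately obtain \<kappa> where "\<kappa> > 0" "S \<inter> ball N \<kappa> \<subseteq> T"
    by (metis openin_contains_ball inf_commute)
  moreover have "T \<subseteq> sg ` square d"
  proof
    fix Q assume "Q \<in> T"
    then show "Q \<in> sg ` square d"
      using sg_pr[of Q] box_subset_cbox[of "(-d,-d)" "(d,d)"] by (force simp: T_def)
  qed
  ultimately show ?thesis by blast
qed

text \<open>Identifies a prescribed normal with that of the field up to sign. At \<open>N\<close>
  every ray has slope 0, so its lift to the surface has tangent \<open>tang u\<close>; a normal is
  orthogonal to all of these and therefore a multiple of \<open>m\<close>.\<close>

lemma normal_unique:
  assumes n: "unit_normal S N n"
  shows "n = m \<or> n = - m"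
proof -
  obtain d where d: "d > 0" "square d \<subseteq> pr ` W" using square_exists by blast
  have zero: "n \<bullet> tang u = 0" if u: "u \<in> square d" "u \<noteq> 0" for u
  proof -
    have E: "t *\<^sub>R u \<in> pr ` W" if "t \<in> {0..1}" for t using square_star[OF u(1) that] d by auto
    have E0: "sg (0 *\<^sub>R u) = N" using sg_pr[OF N_W] by (simp add: pr_def zero_prod_def)
    obtain D where D: "((\<lambda>t. f (t *\<^sub>R u)) has_real_derivative D) (at 0 within {0..1})"
      "\<bar>D\<bar> \<le> 2 * A * dist N (sg (0 *\<^sub>R u)) powr l * norm u"
      using ray_derivative[OF E u(2), of 0] by auto
    \<comment> \<open>At t = 0 the bound is a multiple of \<open>0 powr l\<close>, which is
      0.\<close>
    then have "D = 0" using E0 pos by simp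
    then have "((\<lambda>t. N + t *\<^sub>R tang u + f (t *\<^sub>R u) *\<^sub>R m) has_vector_derivative tang u) (at 0 within {0..1})"
      using D(1) by (auto intro!: derivative_eq_intros)
    then have der: "((\<lambda>t. sg (t *\<^sub>R u)) has_vector_derivative tang u) (at 0 within {0..1})"
      by (rule has_vector_derivative_transform[rotated 2]) (use sg_eq E tang_scale in auto)
    have "\<forall>\<^sub>F t in at 0 within {0..1}. sg (t *\<^sub>R u) \<in> S"
      unfolding eventually_at using sg_in[OF E] W_sub by (intro exI[of _ 1]) auto
    moreover have "at (0::real) within {0..1} \<noteq> bot" by (simp add: at_within_Icc_at_right)
    ultimately show ?thesis using unit_normal_tangent[OF der] n E0 by simp
  qed
  have "n \<bullet> tang (d, 0) = 0" "n \<bullet> tang (0, d) = 0"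
    using d by (auto intro!: zero simp: cbox_Pair_eq zero_prod_def)
  then have "n \<bullet> e1 = 0" "n \<bullet> e2 = 0" using d by (auto simp: tang_def)
  then have nm: "n = (n \<bullet> m) *\<^sub>R m" using orthonormal_frame_expand[OF frame, of n] by simp
  have "norm n = \<bar>n \<bullet> m\<bar> * norm m" by (subst nm) simp
  then have "\<bar>n \<bullet> m\<bar> = 1" using n unit_nu[OF N] by (simp add: unit_normal_def)
  then have "n \<bullet> m = 1 \<or> n \<bullet> m = -1" by linarith
  then show ?thesis using nm by (metis scaleR_minus_left scaleR_one)
qed

end

text \<open>The chord between two unit vectors at angle \<theta> is 2 sin (\<theta>/2), at most
  \<theta>, so the bound on angles gives Hoelder continuity.\<close>

lemma continuous_on_normal_field:
  assumes unit: "\<And>P. P \<in> S \<Longrightarrow> norm (\<nu> P) = 1" and A: "0 < A" "0 < l"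
    and angle: "\<And>P Q. P \<in> S \<Longrightarrow> Q \<in> S \<Longrightarrow> arccos (\<nu> P \<bullet> \<nu> Q) \<le> A * dist P Q powr l"
  shows "continuous_on S (\<nu> :: real^3 \<Rightarrow> real^3)"
proof -
  have bound: "norm (\<nu> Q - \<nu> P) \<le> A * dist P Q powr l" if PQ: "P \<in> S" "Q \<in> S" for P Q
  proof -
    define c where "c = \<nu> P \<bullet> \<nu> Q"
    have c: "-1 \<le> c" "c \<le> 1"
      using Cauchy_Schwarz_ineq2[of "\<nu> P" "\<nu> Q"] unit[OF PQ(1)] unit[OF PQ(2)] by (auto simp: c_def)
    define th where "th = arccos c"
    have th: "0 \<le> th" "cos th = c" using c by (auto simp: th_def arccos_lbound)
    have "(norm (\<nu> Q - \<nu> P))\<^sup>2 = \<nu> Q \<bullet> \<nu> Q - 2 * c + \<nu> P \<bullet> \<nu> P"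
      unfolding power2_norm_eq_inner by (simp add: c_def algebra_simps inner_commute)
    also have "\<dots> = 2 - 2 * cos (2 * (th / 2))" using unit[OF PQ(1)] unit[OF PQ(2)] th(2) by (simp add: norm_eq_1)
    also have "\<dots> = (2 * sin (th / 2))\<^sup>2" unfolding cos_double_sin by (simp add: power2_eq_square)
    also have "\<dots> \<le> th\<^sup>2"
    proof -
      have "\<bar>2 * sin (th / 2)\<bar> \<le> \<bar>th\<bar>" using abs_sin_x_le_abs_x[of "th / 2"] by simp
      then show ?thesis by (rule abs_le_square_iff[THEN iffD1])
    qed
    finally have "norm (\<nu> Q - \<nu> P) \<le> th" using th(1) by (rule power2_le_imp_le)
    then show ?thesis using angle[OF PQ] by (simp add: th_def c_def)
  qed
  show ?thesis
    unfolding continuous_on_def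
  proof
    fix P assume P: "P \<in> S"
    have "((\<lambda>Q. A * dist P Q powr l) \<longlongrightarrow> A * dist P P powr l) (at P within S)"
      using A by (intro tendsto_intros tendsto_powr') (auto intro: eventually_mono)
    then have "((\<lambda>Q. A * dist P Q powr l) \<longlongrightarrow> 0) (at P within S)" using A by simp
    then have "((\<lambda>Q. \<nu> Q - \<nu> P) \<longlongrightarrow> 0) (at P within S)"
      by (rule Lim_null_comparison[rotated]) (use bound P in \<open>auto simp: eventually_at_filter\<close>)
    then show "(\<nu> \<longlongrightarrow> \<nu> P) (at P within S)" by (simp add: LIM_zero_iff)
  qed
qed


section \<open>The parametrized surface\<close>

text \<open>The cross product of two vectors orthogonal to \<nu> is a multiple of \<nu>, also when
  they are dependent and it vanishes. It makes a Jacobian equal to the area element times the cosine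
  between normals.\<close>

lemma parallel_to_normal:
  fixes a b \<nu> :: "real^3"
  assumes "\<nu> \<bullet> a = 0" "\<nu> \<bullet> b = 0" "norm \<nu> = 1"
  shows "\<bar>cross3 a b \<bullet> w\<bar> = norm (cross3 a b) * \<bar>\<nu> \<bullet> w\<bar>"
proof -
  let ?x = "cross3 a b"
  have "cross3 \<nu> ?x = 0" using assms by (simp add: Lagrange)
  then have "(\<nu> \<bullet> ?x) *\<^sub>R \<nu> - (\<nu> \<bullet> \<nu>) *\<^sub>R ?x = 0" using Lagrange[of \<nu> \<nu> ?x] by simp
  then have x: "?x = (\<nu> \<bullet> ?x) *\<^sub>R \<nu>" using assms(3) by (simp add: norm_eq_1)
  have "norm ?x = \<bar>\<nu> \<bullet> ?x\<bar> * norm \<nu>" using norm_scaleR[of "\<nu> \<bullet> ?x" \<nu>] x by metis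
  then have "norm ?x = \<bar>\<nu> \<bullet> ?x\<bar>" using assms(3) by simp
  moreover have "?x \<bullet> w = (\<nu> \<bullet> ?x) * (\<nu> \<bullet> w)" using x by (metis inner_scaleR_left)
  ultimately show ?thesis by (simp add: abs_mult)
qed

context lyapunov_domain
begin

abbreviation "R \<equiv> {s1..s2} \<times> {t1..t2}"
abbreviation "ps \<equiv> param_ds s1 s2 \<phi>"
abbreviation "pt \<equiv> param_dt t1 t2 \<phi>"
abbreviation "J \<equiv> area_element s1 s2 t1 t2 \<phi>"

lemma R_cbox: "R = cbox (s1, t1) (s2, t2)" by (simp add: cbox_Pair_eq)

lemma compact_R: "compact R" unfolding R_cbox by (rule compact_cbox)

lemma vector_derivative_ds:
  "p \<in> R \<Longrightarrow> ((\<lambda>s. \<phi> (s, snd p)) has_vector_derivative ps p) (at (fst p) within {s1..s2})"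
  using diff_s[of "fst p" "snd p"] unfolding param_ds_def by (auto simp: vector_derivative_works)

lemma vector_derivative_dt:
  "p \<in> R \<Longrightarrow> ((\<lambda>t. \<phi> (fst p, t)) has_vector_derivative pt p) (at (snd p) within {t1..t2})"
  using diff_t[of "fst p" "snd p"] unfolding param_dt_def by (auto simp: vector_derivative_works)

text \<open>Partial derivatives, one of them continuous, give the total derivative; taken within
  \<open>R\<close>, it also covers parameters on the edges.\<close>

lemma has_derivative_phi:
  assumes p: "p \<in> R"
  shows "(\<phi> has_derivative (\<lambda>h. fst h *\<^sub>R ps p + snd h *\<^sub>R pt p)) (at p within R)"
proof -
  obtain x y where xy: "p = (x, y)" "x \<in> {s1..s2}" "y \<in> {t1..t2}" using p by auto
  have "((\<lambda>(x, y). \<phi> (x, y)) has_derivative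
      (\<lambda>(tx, ty). tx *\<^sub>R ps (x, y) + blinfun_apply (blinfun_scaleR_left (pt (x, y))) ty)) (at (x, y) within {s1..s2} \<times> {t1..t2})"
  proof (rule has_derivative_partialsI[where fy = "\<lambda>x y. blinfun_scaleR_left (pt (x, y))"])
    show "((\<lambda>x. \<phi> (x, y)) has_derivative (\<lambda>tx. tx *\<^sub>R ps (x, y))) (at x within {s1..s2})"
      using vector_derivative_ds[OF p] by (simp add: xy has_vector_derivative_def)
    show "((\<lambda>y. \<phi> (x, y)) has_derivative blinfun_apply (blinfun_scaleR_left (pt (x, y)))) (at y within {t1..t2})"
      if "x \<in> {s1..s2}" "y \<in> {t1..t2}" for x y
      using vector_derivative_dt[of "(x, y)"] that by (simp add: has_vector_derivative_def)
    have "continuous_on R (\<lambda>p. blinfun_scaleR_left (pt p))"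
      using cont_dt by (intro bounded_linear.continuous_on[OF bounded_linear_blinfun_scaleR_left])
    then show "continuous (at (x, y) within {s1..s2} \<times> {t1..t2}) (\<lambda>(x, y). blinfun_scaleR_left (pt (x, y)))"
      using p by (simp add: continuous_on_eq_continuous_within xy split_def)
  qed (use xy in auto)
  moreover have "(\<lambda>(x, y). \<phi> (x, y)) = \<phi>" by auto
  moreover have "(\<lambda>(tx, ty). tx *\<^sub>R ps (x, y) + blinfun_apply (blinfun_scaleR_left (pt (x, y))) ty)
     = (\<lambda>h. fst h *\<^sub>R ps p + snd h *\<^sub>R pt p)" by (auto simp: xy)
  ultimately show ?thesis by (simp add: xy)
qed

lemma continuous_phi: "continuous_on R \<phi>"
  using has_derivative_phi has_derivative_continuous continuous_on_eq_continuous_within by blast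

lemma continuous_J: "continuous_on R J"
  unfolding area_element_def[abs_def] using cont_ds cont_dt
  by (intro continuous_on_norm continuous_on_cross)

lemma gamma_plane: "P \<in> \<gamma> \<Longrightarrow> P $ 1 = 0"
  using curve_parametrization t0_plane by auto

text \<open>The closure adds only the boundary curve, which lies in the plane x = 0. Near an
  interior point a positive first coordinate is therefore the test for membership in
  \<open>\<Gamma>\<close>.\<close>

lemma closure_surface: "P \<in> closure \<Gamma> \<Longrightarrow> P $ 1 \<noteq> 0 \<Longrightarrow> P \<in> \<Gamma>"
  using gamma_plane curve_surface by auto

lemma closure_surface_nonneg: "P \<in> closure \<Gamma> \<Longrightarrow> P $ 1 \<ge> 0"
  using surface_pos gamma_plane curve_surface by force

lemma phi_closure: "p \<in> R \<Longrightarrow> \<phi> p \<in> closure \<Gamma>"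
  using parametrization by auto

lemma compact_closure_surface: "compact (closure \<Gamma>)"
  using compact_continuous_image[OF continuous_phi compact_R] parametrization by simp

text \<open>The coordinate curves through \<open>p\<close> stay in \<open>\<Gamma>\<close> near it
  because their first coordinate remains positive, so \<open>unit_normal_tangent\<close> applies to
  them, one-sidedly on the edges of the rectangle.\<close>

lemma tangents_orthogonal:
  assumes p: "p \<in> R" "\<phi> p \<in> \<Gamma>" and n: "unit_normal \<Gamma> (\<phi> p) n"
  shows "n \<bullet> ps p = 0" "n \<bullet> pt p = 0"
proof -
  obtain x y where xy: "p = (x, y)" "x \<in> {s1..s2}" "y \<in> {t1..t2}" using p by auto
  have pos: "\<phi> (x, y) $ 1 > 0" using p xy surface_pos by auto
  have nb: "at x within {s1..s2} \<noteq> bot" "at y within {t1..t2} \<noteq> bot"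
    using xy rectangle by (auto simp: trivial_limit_within islimpt_Icc)
  have ev: "\<forall>\<^sub>F z in at w within I. c z \<in> \<Gamma>"
    if c: "(c has_vector_derivative v) (at w within I)" and cw: "c w = \<phi> (x, y)"
      and cl: "\<And>z. z \<in> I \<Longrightarrow> c z \<in> closure \<Gamma>" for c v w and I :: "real set"
  proof -
    have "(c \<longlongrightarrow> c w) (at w within I)"
      using has_vector_derivative_continuous[OF c] by (simp add: continuous_within)
    then have "((\<lambda>z. c z $ 1) \<longlongrightarrow> c w $ 1) (at w within I)" by (rule tendsto_vec_nth)
    then have "\<forall>\<^sub>F z in at w within I. c z $ 1 > 0" using pos cw by (simp add: order_tendstoD(1))
    moreover have "\<forall>\<^sub>F z in at w within I. z \<in> I" by (simp add: eventually_at_filter)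
    ultimately show ?thesis
      by eventually_elim (use cl closure_surface in force)
  qed
  have 1: "((\<lambda>s. \<phi> (s, y)) has_vector_derivative ps p) (at x within {s1..s2})"
    using vector_derivative_ds[OF p(1)] by (simp add: xy)
  have 2: "((\<lambda>t. \<phi> (x, t)) has_vector_derivative pt p) (at y within {t1..t2})"
    using vector_derivative_dt[OF p(1)] by (simp add: xy)
  show "n \<bullet> ps p = 0"
    by (rule unit_normal_tangent[OF 1 ev[OF 1]]) (use xy n nb phi_closure in auto)
  show "n \<bullet> pt p = 0"
    by (rule unit_normal_tangent[OF 2 ev[OF 2]]) (use xy n nb phi_closure in auto)
qed

text \<open>The map \<open>pr\<close> after \<open>\<phi>\<close> sends the full preimage of the
  patch onto the square, with Jacobian \<open>J\<close> times the cosine between the normals; this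
  explains the denominator. Injectivity holds after removing the parameters with
  \<open>J = 0\<close> and those counted twice, and the image then misses only a null set of the
  square.\<close>

lemma surface_change_of_variables:
  assumes chart: "lyapunov_chart \<Gamma> \<nu> d0 A l \<kappa>0 N e1 e2 U"
  defines "W \<equiv> lyapunov_chart.W d0 A l \<kappa>0 N U" and "pr \<equiv> lyapunov_chart.pr N e1 e2"
    and "sg \<equiv> lyapunov_chart.sg d0 A l \<kappa>0 N e1 e2 U"
  assumes d: "d > 0" "square d \<subseteq> pr ` W"
    and G: "(\<lambda>u. G (sg u) / (\<nu> N \<bullet> \<nu> (sg u))) absolutely_integrable_on square d"
  shows "compact {p \<in> R. \<phi> p \<in> sg ` square d}"
    and "(\<lambda>p. G (\<phi> p) * J p) absolutely_integrable_on {p \<in> R. \<phi> p \<in> sg ` square d}"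
    and "integral {p \<in> R. \<phi> p \<in> sg ` square d} (\<lambda>p. G (\<phi> p) * J p)
       = integral (square d) (\<lambda>u. G (sg u) / (\<nu> N \<bullet> \<nu> (sg u)))"
proof -
  interpret C: lyapunov_chart \<Gamma> \<nu> d0 A l \<kappa>0 N e1 e2 U by (rule chart)
  define E where "E = square d"
  define RW where "RW = {p \<in> R. \<phi> p \<in> sg ` E}"
  have E: "E \<subseteq> pr ` W" using d by (simp add: E_def)
  have sg_in: "sg u \<in> W" "pr (sg u) = u" if "u \<in> E" for u
    using subsetD[OF E that] C.sg_in[of u] C.pr_sg[of u] unfolding W_def pr_def sg_def by blast+
  have sg_pr: "sg (pr Q) = Q" if "Q \<in> W" for Q
    using C.sg_pr that unfolding W_def pr_def sg_def by blast
  have W_sub: "W \<subseteq> \<Gamma>" "Q \<in> W \<Longrightarrow> dist N Q < lyapunov_chart.r0 d0 A l \<kappa>0" for Q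
    using C.W_sub unfolding W_def by auto
  have sgE: "sg ` E \<subseteq> W" using sg_in by auto
  have "compact (sg ` E)"
    using continuous_on_subset[OF C.continuous_sg] E unfolding W_def pr_def sg_def E_def
    by (intro compact_continuous_image compact_cbox) auto
  then have "closed (sg ` E)" by (rule compact_imp_closed)
  then have "closed (R \<inter> \<phi> -` (sg ` E))"
    by (rule continuous_closed_preimage[OF continuous_phi compact_imp_closed[OF compact_R]])
  from compact_Int_closed[OF compact_R this] have "compact (R \<inter> (R \<inter> \<phi> -` (sg ` E)))" .
  moreover have "R \<inter> (R \<inter> \<phi> -` (sg ` E)) = RW" unfolding RW_def by blast
  ultimately have cRW: "compact RW" by (simp only:)
  have RW: "p \<in> R" "\<phi> p \<in> W" "\<phi> p \<in> \<Gamma>" if "p \<in> RW" for p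
    using that sgE W_sub(1) by (auto simp: RW_def)
  define g where "g p = pr (\<phi> p)" for p
  define g' where "g' p = (\<lambda>h :: real \<times> real. ((fst h *\<^sub>R ps p + snd h *\<^sub>R pt p) \<bullet> e1, (fst h *\<^sub>R ps p + snd h *\<^sub>R pt p) \<bullet> e2))" for p
  have der: "(g has_derivative g' p) (at p within T)" if "p \<in> R" "T \<subseteq> R" for p T
  proof -
    have "(\<phi> has_derivative (\<lambda>h. fst h *\<^sub>R ps p + snd h *\<^sub>R pt p)) (at p within T)"
      using has_derivative_phi[OF that(1)] that(2) by (rule has_derivative_subset)
    then show ?thesis
      unfolding g_def g'_def pr_def C.pr_def by (auto intro!: derivative_eq_intros)
  qed
  have det: "\<bar>det_pair (g' p)\<bar> = J p * (\<nu> N \<bullet> \<nu> (\<phi> p))" if p: "p \<in> RW" for p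
  proof -
    let ?x = "cross3 (ps p) (pt p)"
    \<comment> \<open>The 2 by 2 minor of inner products is an inner product of cross products; both
      are then projected on normals, at \<open>N\<close> and at \<open>\<phi> p\<close>.\<close>
    have "det_pair (g' p) = ?x \<bullet> cross3 e1 e2"
      unfolding dot_cross by (simp add: det_pair_def g'_def)
    also have "\<bar>\<dots>\<bar> = \<bar>cross3 e1 e2 \<bullet> ?x\<bar>" by (simp add: inner_commute)
    also have "\<dots> = norm (cross3 e1 e2) * \<bar>\<nu> N \<bullet> ?x\<bar>"
      by (rule parallel_to_normal) (use C.fr C.unit_nu[OF C.N] in auto)
    also have "norm (cross3 e1 e2) = 1"
    proof -
      have norms: "norm e1 = 1" "norm e2 = 1" using C.fr by (simp_all add: norm_eq_1)
      have "(norm (cross3 e1 e2))\<^sup>2 = 1"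
        using norm_cross_dot[of e1 e2] C.fr(4) norms by simp
      then show ?thesis by (intro power2_eq_imp_eq[of _ 1]) simp_all
    qed
    also have "\<bar>\<nu> N \<bullet> ?x\<bar> = \<bar>?x \<bullet> \<nu> N\<bar>" by (simp add: inner_commute)
    also have "\<dots> = norm ?x * \<bar>\<nu> (\<phi> p) \<bullet> \<nu> N\<bar>"
      using tangents_orthogonal[OF RW(1,3)[OF p] C.normal[OF RW(3)[OF p]]] C.unit_nu[OF RW(3)[OF p]]
      by (intro parallel_to_normal)
    also have "\<bar>\<nu> (\<phi> p) \<bullet> \<nu> N\<bar> = \<nu> N \<bullet> \<nu> (\<phi> p)"
      using C.nu_bounds(1)[OF RW(3)[OF p] W_sub(2)[OF RW(2)[OF p]]] by (simp add: inner_commute)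
    finally show ?thesis by (simp add: area_element_def)
  qed
  have nu_pos: "\<nu> N \<bullet> \<nu> Q > 0" if "Q \<in> W" for Q
    using C.nu_bounds(1)[OF subsetD[OF W_sub(1) that] W_sub(2)[OF that]] by linarith
  define Z where "Z = {p \<in> R. J p \<noteq> 0 \<and> (\<exists>q \<in> R. q \<noteq> p \<and> \<phi> q = \<phi> p)}"
  have Z: "negligible Z" using simple_cover by (simp add: Z_def)
  \<comment> \<open>On \<open>S\<close> the projection is injective: equal projections come from the
    same surface point, as \<open>pr\<close> is injective on \<open>W\<close>, and two such
    parameters with nonzero area element would belong to \<open>Z\<close>.\<close>
  define S where "S = {p \<in> RW. J p \<noteq> 0} - Z"
  have S_RW: "S \<subseteq> RW" by (auto simp: S_def)
  have "RW \<subseteq> R" by (auto simp: RW_def)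
  then have "closed {p \<in> RW. J p = 0}"
    using continuous_closed_preimage_constant[OF continuous_on_subset[OF continuous_J]] cRW compact_imp_closed by blast
  then have "RW - {p \<in> RW. J p = 0} \<in> sets lebesgue"
    using cRW by (intro sets.Diff) (auto intro: lmeasurable_compact fmeasurableD)
  moreover have "RW - {p \<in> RW. J p = 0} = {p \<in> RW. J p \<noteq> 0}" by auto
  ultimately have S_meas: "S \<in> sets lebesgue"
    unfolding S_def using Z by (auto intro: negligible_imp_sets)
  have S_bdd: "bounded S" using bounded_subset[OF compact_imp_bounded[OF cRW] S_RW] .
  have g_E: "g p \<in> E" "sg (g p) = \<phi> p" if p: "p \<in> RW" for p
  proof -
    obtain u where u: "u \<in> E" "\<phi> p = sg u" using p unfolding RW_def by blast
    then show "g p \<in> E" using sg_in by (simp add: g_def)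
    show "sg (g p) = \<phi> p" using sg_pr RW(2)[OF p] by (simp add: g_def)
  qed
  have gSE: "g ` S \<subseteq> E" using g_E(1) S_RW by blast
  have gS_bdd: "bounded (g ` S)"
    using bounded_subset[OF bounded_cbox gSE[unfolded E_def]] .
  have inj: "inj_on g S"
  proof (rule inj_onI)
    fix p q assume pq: "p \<in> S" "q \<in> S" "g p = g q"
    then have pq': "p \<in> RW" "q \<in> RW" using S_RW by blast+
    then have "\<phi> p = \<phi> q" using g_E(2) pq(3) by metis
    then show "p = q" using pq RW(1)[OF pq'(1)] RW(1)[OF pq'(2)] unfolding S_def Z_def by blast
  qed
  define F where "F u = G (sg u) / (\<nu> N \<bullet> \<nu> (sg u))" for u
  have E_sub: "E \<subseteq> g ` RW"
  proof
    fix u assume u: "u \<in> E"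
    then have "sg u \<in> W" using sgE by blast
    then have "sg u \<in> closure \<Gamma>" using W_sub(1) closure_subset by auto
    then obtain p where p: "p \<in> R" "\<phi> p = sg u" using parametrization by (metis imageE)
    then have "p \<in> RW" using u unfolding RW_def by blast
    moreover have "g p = u" using p sg_in u by (simp add: g_def)
    ultimately show "u \<in> g ` RW" by blast
  qed
  \<comment> \<open>The set where \<open>J\<close> vanishes may have positive measure; only its
    image is null, since the Jacobian vanishes together with \<open>J\<close>.\<close>
  have "negligible (g ` {p \<in> RW. J p = 0})"
  proof (rule Sard_pair[of _ _ g'])
    fix p assume p: "p \<in> {p \<in> RW. J p = 0}"
    show "(g has_derivative g' p) (at p within {p \<in> RW. J p = 0})"
      by (rule der) (use p RW(1) in blast)+
    show "det_pair (g' p) = 0" using det[of p] p by simp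
  qed
  moreover have "negligible (g ` (RW \<inter> Z))"
  proof (rule negligible_differentiable_image_negligible)
    show "negligible (RW \<inter> Z)" using Z by (rule negligible_subset) auto
    show "g differentiable_on RW \<inter> Z"
      unfolding differentiable_on_def differentiable_def using der RW by (meson IntD1 subsetI)
  qed simp
  moreover have "E - g ` S \<subseteq> g ` {p \<in> RW. J p = 0} \<union> g ` (RW \<inter> Z)"
    using E_sub unfolding S_def by blast
  ultimately have neg: "negligible (E - g ` S)" by (meson negligible_Un negligible_subset)
  have n1: "negligible {x \<in> g ` S - E. F x \<noteq> 0}" using gSE by (simp add: Diff_eq_empty_iff[THEN iffD2])
  have n2: "negligible {x \<in> E - g ` S. F x \<noteq> 0}" using neg by (rule negligible_subset) auto
  have F_int: "F absolutely_integrable_on g ` S"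
    using absolutely_integrable_spike_set_eq[OF n1 n2] G by (simp add: F_def[abs_def] E_def)
  have F_eq: "integral (g ` S) F = integral E F" by (rule integral_spike_set[OF n1 n2])
  have derS: "(g has_derivative g' p) (at p within S)" if "p \<in> S" for p
    by (rule der) (use that S_RW RW(1) in blast)+
  note cv = change_of_variables_pair[OF S_meas S_bdd gS_bdd derS inj F_int]
  have eq: "\<bar>det_pair (g' p)\<bar> * F (g p) = G (\<phi> p) * J p" if "p \<in> S" for p
  proof -
    have p: "p \<in> RW" using that S_RW by blast
    have "\<nu> N \<bullet> \<nu> (\<phi> p) \<noteq> 0" using nu_pos[OF RW(2)[OF p]] by simp
    then show ?thesis unfolding det[OF p] F_def g_E(2)[OF p] by simp
  qed
  have a1: "(\<lambda>p. G (\<phi> p) * J p) absolutely_integrable_on S"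
    by (rule set_integrable_cong[OF refl refl, THEN iffD1, OF _ cv(1)]) (rule eq)
  have a2: "integral S (\<lambda>p. G (\<phi> p) * J p) = integral E F"
    by (rule trans[OF trans[OF sym[OF integral_cong[OF eq]] cv(2)] F_eq])
  have m1: "negligible {x \<in> S - RW. G (\<phi> x) * J x \<noteq> 0}" using S_RW by (simp add: Diff_eq_empty_iff[THEN iffD2])
  have m2: "negligible {x \<in> RW - S. G (\<phi> x) * J x \<noteq> 0}"
    using Z by (rule negligible_subset) (auto simp: S_def)
  have b: "compact RW" "(\<lambda>p. G (\<phi> p) * J p) absolutely_integrable_on RW"
    "integral RW (\<lambda>p. G (\<phi> p) * J p) = integral E F"
    using cRW a1 a2 absolutely_integrable_spike_set_eq[OF m1 m2] integral_spike_set[OF m1 m2] by auto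
  show "compact {p \<in> R. \<phi> p \<in> sg ` square d}"
    and "(\<lambda>p. G (\<phi> p) * J p) absolutely_integrable_on {p \<in> R. \<phi> p \<in> sg ` square d}"
    and "integral {p \<in> R. \<phi> p \<in> sg ` square d} (\<lambda>p. G (\<phi> p) * J p)
       = integral (square d) (\<lambda>u. G (sg u) / (\<nu> N \<bullet> \<nu> (sg u)))"
    using b unfolding RW_def E_def F_def[abs_def] by auto
qed

end


section \<open>Differentiation under the integral sign\<close>

lemma q2_wt_aux:
  fixes A k X r r1 S :: real
  assumes "A \<noteq> 0"
  shows "k * X / (r * r1 * S) = inverse A * (A * k * X / (r1 * S) / r)"
  using assms by (simp add: mult.commute[of r] mult.assoc)

lemma q2_eq_wt:
  assumes "2 * \<alpha> < 1" "Q$1 \<ge> 0" "M$1 > 0"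
  shows "q2 \<alpha> Q M = (M$1) powr (- (2 * \<alpha>)) * (weight \<alpha> Q M / norm (M - Q))"
proof -
  have "(M$1) powr (2*\<alpha>) \<noteq> 0" using assms by simp
  then show ?thesis
    unfolding q2_closed_form[OF assms] weight_def powr_minus by (rule q2_wt_aux)
qed

context lyapunov_domain
begin

lemma measurable_R: "R \<in> sets lebesgue"
  unfolding R_cbox by simp

lemma surface_integral_eq:
  assumes "surface_integrable s1 s2 t1 t2 \<phi> f"
  shows "surface_integral s1 s2 t1 t2 \<phi> f = integral R (\<lambda>p. f p * J p)"
  using assms unfolding surface_integrable_def surface_integral_def
  by (rule set_lebesgue_integral_eq_integral(2))

text \<open>A ball around \<open>M\<close> avoids the closed surface and the plane x = 0, so along
  each axis the integrand and its derivative are continuous on a compact product and the Leibniz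
  rule gives the partial derivatives. Linearity of \<open>kern\<close> recombines them.\<close>

lemma single_layer_conormal:
  assumes \<alpha>: "0 < 2 * \<alpha>" "2 * \<alpha> < 1" and \<rho>: "continuous_on R \<rho>"
    and M: "M $ 1 > 0" "M \<notin> closure \<Gamma>"
  shows "conormal \<alpha> n (single_layer \<alpha> s1 s2 t1 t2 \<phi> \<rho>) M = integral R (\<lambda>p. \<rho> p * kern \<alpha> n (\<phi> p) M * J p)"
proof -
  let ?v = "single_layer \<alpha> s1 s2 t1 t2 \<phi> \<rho>"
  have "open (- closure \<Gamma> \<inter> {P. P $ 1 > 0})"
    by (intro open_Int open_Compl closed_closure open_Collect_less continuous_intros)
  moreover have "M \<in> - closure \<Gamma> \<inter> {P. P $ 1 > 0}" using M by auto
  ultimately obtain e where e: "e > 0" "ball M e \<subseteq> - closure \<Gamma> \<inter> {P. P $ 1 > 0}"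
    by (meson open_contains_ball)
  have eM: "P $ 1 > 0" "p \<in> R \<Longrightarrow> P \<noteq> \<phi> p" if "P \<in> ball M e" for P p
    using e(2) that phi_closure[of p] by auto
  have kc: "continuous_on R (\<lambda>p. \<rho> p * kern \<alpha> v (\<phi> p) M * J p)" for v
    using e(1) eM[of M] closure_surface_nonneg phi_closure M
    by (intro continuous_on_mult \<rho> continuous_J continuous_on_kern[OF \<alpha>] continuous_phi continuous_on_const) auto
  have pd: "partial_deriv i ?v M = (M$1) powr (- (2 * \<alpha>)) * integral R (\<lambda>p. \<rho> p * kern \<alpha> (axis i 1) (\<phi> p) M * J p)" for i
  proof -
    let ?M = "\<lambda>h :: real. M + h *\<^sub>R axis i 1"
    let ?I = "{-(e/2)..e/2}"
    have I: "?M h \<in> ball M e" if "h \<in> ?I" for h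
      using that e(1) by (auto simp: dist_norm)
    define F where "F h p = \<rho> p * q2 \<alpha> (\<phi> p) (?M h) * J p" for h p
    define F' where "F' h p = \<rho> p * ((?M h $ 1) powr (- (2 * \<alpha>)) * kern \<alpha> (axis i 1) (\<phi> p) (?M h)) * J p" for h p
    have der: "((\<lambda>h. F h p) has_field_derivative F' h p) (at h within ?I)" if h: "h \<in> ?I" and p: "p \<in> R" for h p
    proof -
      have "((\<lambda>k. q2 \<alpha> (\<phi> p) (?M h + k *\<^sub>R axis i 1)) has_real_derivative
          (?M h $ 1) powr (- (2 * \<alpha>)) * kern \<alpha> (axis i 1) (\<phi> p) (?M h)) (at (h - h))"
        using q2_has_derivative[OF \<alpha> closure_surface_nonneg[OF phi_closure[OF p]] eM(1)[OF I[OF h]] eM(2)[OF I[OF h] p]] by simp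
      then have "((\<lambda>k. q2 \<alpha> (\<phi> p) (?M h + (k - h) *\<^sub>R axis i 1)) has_real_derivative
          (?M h $ 1) powr (- (2 * \<alpha>)) * kern \<alpha> (axis i 1) (\<phi> p) (?M h)) (at h)"
        using DERIV_shift[of "\<lambda>k. q2 \<alpha> (\<phi> p) (?M h + (k - h) *\<^sub>R axis i 1)" _ 0 h] by (simp add: add.commute)
      moreover have "?M h + (k - h) *\<^sub>R axis i 1 = ?M k" for k by (simp add: algebra_simps)
      ultimately have "((\<lambda>k. q2 \<alpha> (\<phi> p) (?M k)) has_real_derivative
          (?M h $ 1) powr (- (2 * \<alpha>)) * kern \<alpha> (axis i 1) (\<phi> p) (?M h)) (at h)" by simp
      from DERIV_cmult_right[OF DERIV_cmult[OF this, of "\<rho> p"], of "J p"]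
      show ?thesis unfolding F_def F'_def by (rule has_field_derivative_at_within)
    qed
    have contF': "continuous_on (?I \<times> cbox (s1, t1) (s2, t2)) (\<lambda>(h, p). F' h p)"
    proof -
      let ?T = "?I \<times> R"
      have c: "continuous_on ?T (\<lambda>x. f (snd x))" if "continuous_on R f" for f :: "real \<times> real \<Rightarrow> 'z::topological_space"
        by (rule continuous_on_compose2[OF that]) (auto intro!: continuous_intros)
      have cM: "continuous_on ?T (\<lambda>x. ?M (fst x))" by (intro continuous_intros)
      have cM1: "continuous_on ?T (\<lambda>x. ?M (fst x) $ 1)" using cM by (rule continuous_on_component)
      have xI: "fst x \<in> ?I" "snd x \<in> R" if "x \<in> ?T" for x using that by auto
      have posM: "?M (fst x) $ 1 > 0" if "x \<in> ?T" for x by (rule eM(1)[OF I[OF xI(1)[OF that]]])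
      have "continuous_on ?T (\<lambda>x. (?M (fst x) $ 1) powr (- (2 * \<alpha>)))"
        using cM1 posM by (intro continuous_on_powr continuous_on_const) (assumption, blast dest: posM less_imp_neq[THEN not_sym])
      moreover have "continuous_on ?T (\<lambda>x. kern \<alpha> (axis i 1) (\<phi> (snd x)) (?M (fst x)))"
      proof (rule continuous_on_kern[OF \<alpha> c[OF continuous_phi] cM])
        fix x assume x: "x \<in> ?T"
        show "0 \<le> \<phi> (snd x) $ 1" by (rule closure_surface_nonneg[OF phi_closure[OF xI(2)[OF x]]])
        show "0 < ?M (fst x) $ 1" by (rule posM[OF x])
        show "?M (fst x) \<noteq> \<phi> (snd x)" by (rule eM(2)[OF I[OF xI(1)[OF x]] xI(2)[OF x]])
      qed
      ultimately have "continuous_on ?T (\<lambda>x. F' (fst x) (snd x))"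
        unfolding F'_def by (intro continuous_on_mult c \<rho> continuous_J)
      then show ?thesis by (simp add: split_def R_cbox)
    qed
    have contF: "continuous_on R (F h)" if h: "h \<in> ?I" for h
    proof -
      have "continuous_on R (\<lambda>p. q2 \<alpha> (\<phi> p) (?M h))"
      proof -
        have "continuous_on R (\<lambda>p. (?M h $ 1) powr (- (2 * \<alpha>)) * (weight \<alpha> (\<phi> p) (?M h) / norm (?M h - \<phi> p)))"
          using eM[OF I[OF h]] closure_surface_nonneg phi_closure
          by (intro continuous_on_mult continuous_on_const continuous_on_divide continuous_on_norm continuous_on_diff
              continuous_on_wt[OF \<alpha>] continuous_phi) auto
        moreover have "q2 \<alpha> (\<phi> p) (?M h) = (?M h $ 1) powr (- (2 * \<alpha>)) * (weight \<alpha> (\<phi> p) (?M h) / norm (?M h - \<phi> p))"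
          if "p \<in> R" for p
          using q2_eq_wt[OF \<alpha>(2) closure_surface_nonneg[OF phi_closure[OF that]] eM(1)[OF I[OF h]]] .
        ultimately show ?thesis by (simp cong: continuous_on_cong)
      qed
      then show ?thesis
        unfolding F_def by (intro continuous_on_mult \<rho> continuous_J)
    qed
    then have int: "F h integrable_on cbox (s1, t1) (s2, t2)" if "h \<in> ?I" for h
      using that unfolding R_cbox by (intro integrable_continuous)
    have "((\<lambda>h. integral R (F h)) has_field_derivative integral R (F' 0)) (at 0 within ?I)"
      unfolding R_cbox
      by (rule leibniz_rule_field_derivative[OF _ int contF']) (use der e(1) in \<open>auto simp: R_cbox\<close>)
    moreover have "at 0 within ?I = at 0" using e(1) by (intro at_within_interior) auto
    ultimately have D: "((\<lambda>h. integral R (F h)) has_field_derivative integral R (F' 0)) (at 0)" by simp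
    have ev: "\<forall>\<^sub>F h in nhds 0. ?v (?M h) = integral R (F h)"
    proof -
      have "?v (?M h) = integral R (F h)" if "h \<in> ?I" for h
      proof -
        have "F h absolutely_integrable_on R"
          using contF[OF that] unfolding R_cbox by (rule absolutely_integrable_continuous)
        then show ?thesis
          unfolding single_layer_def
          by (subst surface_integral_eq) (simp_all add: surface_integrable_def F_def[abs_def])
      qed
      moreover have "\<forall>\<^sub>F h in nhds 0. h \<in> {-(e/2)<..<e/2}"
        using e(1) by (intro eventually_nhds_in_open) auto
      ultimately show ?thesis by (rule eventually_mono[rotated]) auto
    qed
    have "((\<lambda>h. ?v (?M h)) has_field_derivative integral R (F' 0)) (at 0)"
      using D DERIV_cong_ev[OF refl ev refl] by simp
    then have "partial_deriv i ?v M = integral R (F' 0)"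
      unfolding partial_deriv_def by (rule DERIV_imp_deriv)
    also have "F' 0 = (\<lambda>p. (M$1) powr (- (2 * \<alpha>)) * (\<rho> p * kern \<alpha> (axis i 1) (\<phi> p) M * J p))"
      by (simp add: F'_def fun_eq_iff)
    finally show ?thesis by simp
  qed
  have int: "(\<lambda>p. \<rho> p * kern \<alpha> v (\<phi> p) M * J p) integrable_on R" for v
    using kc[of v] unfolding R_cbox by (rule integrable_continuous)
  have "(M$1) powr (2*\<alpha>) \<noteq> 0" using M by simp
  then have one: "(M$1) powr (2*\<alpha>) * (M$1) powr (- (2*\<alpha>)) = 1"
    unfolding powr_minus by (rule right_inverse)
  let ?K = "\<lambda>i. integral R (\<lambda>p. \<rho> p * kern \<alpha> (axis i 1) (\<phi> p) M * J p)"
  have "conormal \<alpha> n ?v M = n$1 * ?K 1 + n$2 * ?K 2 + n$3 * ?K 3"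
    unfolding conormal_def pd by (rule conormal_aux[OF one])
  also have "\<dots> = integral R (\<lambda>p. n$1 * (\<rho> p * kern \<alpha> (axis 1 1) (\<phi> p) M * J p)
      + n$2 * (\<rho> p * kern \<alpha> (axis 2 1) (\<phi> p) M * J p) + n$3 * (\<rho> p * kern \<alpha> (axis 3 1) (\<phi> p) M * J p))"
    using int by (subst integral_add integral_mult_right | intro integrable_add integrable_on_mult_right | simp)+
  also have "(\<lambda>p. n$1 * (\<rho> p * kern \<alpha> (axis 1 1) (\<phi> p) M * J p)
      + n$2 * (\<rho> p * kern \<alpha> (axis 2 1) (\<phi> p) M * J p) + n$3 * (\<rho> p * kern \<alpha> (axis 3 1) (\<phi> p) M * J p))
     = (\<lambda>p. \<rho> p * kern \<alpha> n (\<phi> p) M * J p)"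
  proof
    fix p
    show "n$1 * (\<rho> p * kern \<alpha> (axis 1 1) (\<phi> p) M * J p)
      + n$2 * (\<rho> p * kern \<alpha> (axis 2 1) (\<phi> p) M * J p) + n$3 * (\<rho> p * kern \<alpha> (axis 3 1) (\<phi> p) M * J p)
     = \<rho> p * kern \<alpha> n (\<phi> p) M * J p"
      unfolding kern_linear[of \<alpha> n] by (simp add: distrib_left distrib_right)
  qed
  finally show ?thesis .
qed

end


section \<open>The limits on the normal\<close>

lemma kern_split:
  "kern \<alpha> v Q M + weight \<alpha> Q M * k = weight \<alpha> Q M * (regular_part \<alpha> v Q M / norm (M - Q)) - weight \<alpha> Q M * ((v \<bullet> (M - Q)) / norm (M - Q) ^ 3 - k)"
  by (simp add: kern_def algebra_simps)

lemma factor_weight: "a / b * (w * X - w * Y) = a * w / b * (X - Y)" for a b w X Y :: real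
  by (simp add: right_diff_distrib mult.assoc)

context lyapunov_domain
begin

abbreviation layer :: "real \<Rightarrow> (real^3 \<Rightarrow> real) \<Rightarrow> real^3 \<Rightarrow> real^3 \<Rightarrow> real \<times> real \<Rightarrow> real" where
  "layer \<alpha> \<mu> n M \<equiv> (\<lambda>p. \<mu> (\<phi> p) * kern \<alpha> n (\<phi> p) M * J p)"

text \<open>The normal field of the Lyapunov condition agrees with \<open>n\<close> at
  \<open>N\<close> only up to sign. Reversing the whole field changes neither the angles nor the
  lines, so the field may be taken to extend \<open>n\<close>.\<close>

lemma chart_exists:
  assumes N: "N \<in> \<Gamma>" and n: "unit_normal \<Gamma> N n" and \<kappa>0: "\<kappa>0 > 0"
  obtains \<nu> d0 A l e1 e2 U where "lyapunov_chart \<Gamma> \<nu> d0 A l \<kappa>0 N e1 e2 U" "\<nu> N = n" "continuous_on \<Gamma> \<nu>"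
proof -
  obtain \<nu>0 d0 A l where \<nu>0: "\<And>Q. Q \<in> \<Gamma> \<Longrightarrow> unit_normal \<Gamma> Q (\<nu>0 Q)"
    and line: "d0 > 0" "\<And>N P Q c. N \<in> \<Gamma> \<Longrightarrow> P \<in> \<Gamma> \<inter> ball N d0 \<Longrightarrow> Q \<in> \<Gamma> \<inter> ball N d0 \<Longrightarrow> Q = P + c *\<^sub>R \<nu>0 N \<Longrightarrow> Q = P"
    and angle: "A > 0" "0 < l" "l \<le> 1" "\<And>P Q. P \<in> \<Gamma> \<Longrightarrow> Q \<in> \<Gamma> \<Longrightarrow> arccos (\<nu>0 P \<bullet> \<nu>0 Q) \<le> A * dist P Q powr l"
    using surface_lyapunov unfolding lyapunov_surface_def by metis
  obtain U where U: "openin (top_of_set \<Gamma>) U" "N \<in> U" "U homeomorphic (ball 0 1 :: (real^2) set)"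
    using surface_lyapunov N unfolding lyapunov_surface_def topological_surface_def by blast
  have chart: "\<exists>e1 e2. lyapunov_chart \<Gamma> \<nu> d0 A l \<kappa>0 N e1 e2 U"
    if \<nu>: "\<And>Q. Q \<in> \<Gamma> \<Longrightarrow> unit_normal \<Gamma> Q (\<nu> Q)"
      and li: "\<And>P Q c. P \<in> \<Gamma> \<inter> ball N d0 \<Longrightarrow> Q \<in> \<Gamma> \<inter> ball N d0 \<Longrightarrow> Q = P + c *\<^sub>R \<nu> N \<Longrightarrow> Q = P"
      and an: "\<And>P Q. P \<in> \<Gamma> \<Longrightarrow> Q \<in> \<Gamma> \<Longrightarrow> arccos (\<nu> P \<bullet> \<nu> Q) \<le> A * dist P Q powr l" for \<nu>
  proof -
    have "norm (\<nu> N) = 1" using \<nu>[OF N] by (simp add: unit_normal_def)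
    then obtain e1 e2 where "orthonormal_frame e1 e2 (\<nu> N)" by (rule orthonormal_frame_exists)
    then have "lyapunov_chart \<Gamma> \<nu> d0 A l \<kappa>0 N e1 e2 U"
      using N \<nu> li an line(1) angle \<kappa>0 U by unfold_locales blast+
    then show ?thesis by blast
  qed
  have "\<exists>e1 e2. lyapunov_chart \<Gamma> \<nu>0 d0 A l \<kappa>0 N e1 e2 U"
    by (rule chart) (erule \<nu>0, erule (2) line(2)[OF N], erule (1) angle(4))
  then obtain e1 e2 where c0: "lyapunov_chart \<Gamma> \<nu>0 d0 A l \<kappa>0 N e1 e2 U" by blast
  have cont: "continuous_on \<Gamma> \<nu>0"
    using \<nu>0 angle by (intro continuous_on_normal_field[of _ _ A l]) (auto simp: unit_normal_def)
  consider "n = \<nu>0 N" | "n = - \<nu>0 N" using lyapunov_chart.normal_unique[OF c0 n] by blast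
  then show ?thesis
  proof cases
    case 1
    then show ?thesis using that[OF c0] cont by simp
  next
    case 2
    have "\<exists>e1 e2. lyapunov_chart \<Gamma> (\<lambda>Q. - \<nu>0 Q) d0 A l \<kappa>0 N e1 e2 U"
    proof (rule chart)
      show "unit_normal \<Gamma> Q (- \<nu>0 Q)" if "Q \<in> \<Gamma>" for Q using \<nu>0[OF that] by (simp add: unit_normal_minus)
      show "Q = P" if "P \<in> \<Gamma> \<inter> ball N d0" "Q \<in> \<Gamma> \<inter> ball N d0" "Q = P + c *\<^sub>R - \<nu>0 N" for P Q c
        using line(2)[OF N that(1,2), of "- c"] that(3) by simp
      show "arccos (- \<nu>0 P \<bullet> - \<nu>0 Q) \<le> A * dist P Q powr l" if "P \<in> \<Gamma>" "Q \<in> \<Gamma>" for P Q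
        using angle(4)[OF that] by simp
    qed
    then obtain e1 e2 where "lyapunov_chart \<Gamma> (\<lambda>Q. - \<nu>0 Q) d0 A l \<kappa>0 N e1 e2 U" by blast
    then show ?thesis using that[of "\<lambda>Q. - \<nu>0 Q"] 2 cont by (simp add: continuous_on_minus)
  qed
qed

text \<open>The contribution of the parameters over a square of the tangent plane at
  \<open>N\<close>: there the surface is a graph and \<open>local_jump\<close> applies with
  \<open>m0 = \<mu> N / (4 * pi)\<close>. The other conclusions hand over what is needed to treat
  the rest of the rectangle.\<close>

lemma near_limit:
  assumes \<alpha>: "0 < 2 * \<alpha>" "2 * \<alpha> < 1" and \<mu>: "continuous_on (closure \<Gamma>) \<mu>"
    and N: "N \<in> \<Gamma>" and n: "unit_normal \<Gamma> N n"
  obtains T \<kappa> where "compact T" "T \<subseteq> R" "\<kappa> > 0" "\<kappa> \<le> N$1 / 2"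
    "\<And>p. p \<in> R - T \<Longrightarrow> \<kappa> \<le> dist N (\<phi> p)"
    "\<And>h. 0 < \<bar>h\<bar> \<Longrightarrow> \<bar>h\<bar> < \<kappa> \<Longrightarrow> N + h *\<^sub>R n \<notin> closure \<Gamma>"
    "(layer \<alpha> \<mu> n N) absolutely_integrable_on T"
    "((\<lambda>h. integral T (layer \<alpha> \<mu> n (N + h *\<^sub>R n))) \<longlongrightarrow>
        integral T (layer \<alpha> \<mu> n N) - \<mu> N / 2) (at_right 0)"
    "((\<lambda>h. integral T (layer \<alpha> \<mu> n (N + h *\<^sub>R n))) \<longlongrightarrow>
        integral T (layer \<alpha> \<mu> n N) + \<mu> N / 2) (at_left 0)"
proof -
  define x where "x = N$1"
  have x: "x > 0" using N surface_pos by (auto simp: x_def)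
  then have "x / 2 > 0" by simp
  from chart_exists[OF N n this]
  obtain \<nu> d0 A l e1 e2 U where chart: "lyapunov_chart \<Gamma> \<nu> d0 A l (x/2) N e1 e2 U"
    and \<nu>N: "\<nu> N = n" and \<nu>c: "continuous_on \<Gamma> \<nu>" .
  interpret C: lyapunov_chart \<Gamma> \<nu> d0 A l "x/2" N e1 e2 U by (rule chart)
  obtain d where d: "d > 0" "square d \<subseteq> C.pr ` C.W" using C.square_exists by blast
  define E where "E = square d"
  obtain \<kappa>1 where \<kappa>1: "\<kappa>1 > 0" "\<Gamma> \<inter> ball N \<kappa>1 \<subseteq> C.sg ` E"
    using C.square_covers[OF d] by (auto simp: E_def)
  \<comment> \<open>Heights below \<kappa> stay where all of \<open>\<Gamma>\<close> lies over the
    square and where first coordinates exceed \<open>x / 2\<close>.\<close>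
  define \<kappa> where "\<kappa> = min \<kappa>1 (x / 2)"
  have \<kappa>: "\<kappa> > 0" "\<kappa> \<le> \<kappa>1" "\<kappa> \<le> x / 2" using \<kappa>1 x by (auto simp: \<kappa>_def)
  have n1: "norm n = 1" using n by (simp add: unit_normal_def)
  have nn: "n \<bullet> n = 1" using n1 by (simp add: norm_eq_1)
  define M where "M h = N + h *\<^sub>R n" for h
  have M1: "M h $ 1 > x / 2" if "\<bar>h\<bar> < \<kappa>" for h
    using first_coordinate_on_normal[OF n1 that] \<kappa>(3) unfolding M_def x_def by blast
  have EW: "u \<in> C.pr ` C.W" if "u \<in> E" for u using that d by (auto simp: E_def)
  have sg: "C.sg u \<in> \<Gamma>" "C.sg u $ 1 > x / 2" "n \<bullet> \<nu> (C.sg u) \<ge> 1 / 2" "C.sg u \<in> closure \<Gamma>" if "u \<in> E" for u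
  proof -
    have W: "C.sg u \<in> C.W" using C.sg_in[OF EW[OF that]] .
    then show 1: "C.sg u \<in> \<Gamma>" using C.W_sub by auto
    then show "C.sg u \<in> closure \<Gamma>" using closure_subset by auto
    have d: "dist N (C.sg u) < C.r0" using W C.W_sub by (auto simp: subset_iff)
    then have "norm (N - C.sg u) < x / 2" using C.r0_pos by (simp add: dist_norm)
    moreover have "\<bar>(N - C.sg u) $ 1\<bar> \<le> norm (N - C.sg u)" by (rule component_le_norm_cart)
    ultimately show "C.sg u $ 1 > x / 2" by (simp add: x_def)
    show "n \<bullet> \<nu> (C.sg u) \<ge> 1 / 2" using C.nu_bounds(1)[OF 1 d] by (simp add: \<nu>N)
  qed
  have sgc: "continuous_on E C.sg"
    by (rule continuous_on_subset[OF C.continuous_sg]) (use EW in blast)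
  have sg0: "C.sg 0 = N" using C.sg_pr[OF C.N_W] by (simp add: C.pr_def zero_prod_def)
  have E0: "0 \<in> E" using d by (simp add: E_def zero_prod_def cbox_Pair_eq)
  have prM: "C.pr (M h) = 0" for h
    using C.fr \<nu>N by (simp add: C.pr_def M_def zero_prod_def)
  \<comment> \<open>The normal line projects to 0, so it meets the graph over the square only at
    \<open>N\<close>.\<close>
  have ne: "M h \<noteq> C.sg u" if "u \<in> E" "h \<noteq> 0 \<or> u \<noteq> 0" for h u
  proof
    assume eq: "M h = C.sg u"
    then have "u = 0" using C.pr_sg[OF EW[OF that(1)]] prM[of h] by simp
    then have "h *\<^sub>R n = 0" using eq sg0 by (simp add: M_def)
    then show False using that \<open>u = 0\<close> n1 by auto
  qed
  have Mnot: "M h \<notin> closure \<Gamma>" if h: "0 < \<bar>h\<bar>" "\<bar>h\<bar> < \<kappa>" for h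
  proof
    assume a: "M h \<in> closure \<Gamma>"
    have "M h \<in> \<Gamma>" using closure_surface[OF a] M1[OF h(2)] x by simp
    moreover have "dist N (M h) < \<kappa>1" using h \<kappa> n1 by (simp add: M_def dist_norm)
    ultimately have "M h \<in> C.sg ` E" using \<kappa>1(2) by auto
    then show False using ne h by auto
  qed
  \<comment> \<open>\<open>I\<close> is the integrand carried to the tangent plane; division by the
    cosine between the normals is the area factor of the graph. The flat kernel times
    \<open>mm\<close>, defined next, is what has to be added to make \<open>I\<close>
    dominated.\<close>
  define I where "I h u = \<mu> (C.sg u) * kern \<alpha> n (C.sg u) (M h) / (n \<bullet> \<nu> (C.sg u))" for h u
  define mm where "mm h u = \<mu> (C.sg u) * weight \<alpha> (C.sg u) (M h) / (n \<bullet> \<nu> (C.sg u))" for h u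
  have \<mu>sg: "continuous_on E (\<lambda>u. \<mu> (C.sg u))"
    by (rule continuous_on_compose2[OF \<mu> sgc]) (use sg in auto)
  have \<nu>sg: "continuous_on E (\<lambda>u. n \<bullet> \<nu> (C.sg u))"
    by (intro continuous_intros continuous_on_compose2[OF \<nu>c sgc]) (use sg in auto)
  have nz: "n \<bullet> \<nu> (C.sg u) \<noteq> 0" if "u \<in> E" for u using sg(3)[OF that] by auto
  obtain B0 where B0: "\<And>Q. Q \<in> closure \<Gamma> \<Longrightarrow> \<bar>\<mu> Q\<bar> \<le> B0"
    using compact_imp_bounded[OF compact_continuous_image[OF \<mu> compact_closure_surface]]
    unfolding bounded_iff by auto
  have B0_nn: "B0 \<ge> 0" using B0[of N] N closure_subset by force
  define B where "B = 2 * B0"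
  have mmB: "\<bar>mm h u\<bar> \<le> B" if h: "\<bar>h\<bar> < \<kappa>" and u: "u \<in> E" for h u
  proof -
    have w: "0 \<le> weight \<alpha> (C.sg u) (M h)" "weight \<alpha> (C.sg u) (M h) \<le> 1 / (2 * pi)"
      using weight_bounds[OF \<alpha>, of "C.sg u" "M h"] sg(2)[OF u] M1[OF h] x by auto
    have "1 / (2 * pi) \<le> 1" using pi_gt3 by simp
    then have w1: "\<bar>weight \<alpha> (C.sg u) (M h)\<bar> \<le> 1" using w by linarith
    have "\<bar>\<mu> (C.sg u)\<bar> * \<bar>weight \<alpha> (C.sg u) (M h)\<bar> \<le> B0 * 1"
      using B0[OF sg(4)[OF u]] w1 B0_nn by (intro mult_mono) auto
    moreover have "\<bar>mm h u\<bar> = \<bar>\<mu> (C.sg u)\<bar> * \<bar>weight \<alpha> (C.sg u) (M h)\<bar> / (n \<bullet> \<nu> (C.sg u))"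
      using sg(3)[OF u] by (simp add: mm_def abs_mult)
    moreover have "\<dots> \<le> (B0 * 1) / (1 / 2)"
      using calculation(1) sg(3)[OF u] B0_nn by (intro frac_le) auto
    ultimately show ?thesis by (simp add: B_def)
  qed
  \<comment> \<open>8 / x is the 4 of \<open>regular_part_bound\<close> over the lower bound x / 2
    of the first coordinate; 8 A is the 2 of \<open>plane_kernel_diff_bound\<close> times the 4 A of
    \<open>f_bound\<close>. Both exponents exceed -2, so \<open>g\<close> is integrable.\<close>
  define g where "g u = B * (8 / x) * norm u powr (- 1) + B * (8 * A) * norm u powr (- (2 - l))" for u :: "real \<times> real"
  have Icont: "continuous_on E (I h)" if h: "0 < \<bar>h\<bar>" "\<bar>h\<bar> < \<kappa>" for h
    unfolding I_def
  proof (intro continuous_on_divide continuous_on_mult \<mu>sg \<nu>sg continuous_on_kern[OF \<alpha> sgc continuous_on_const] ballI nz)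
    fix u assume u: "u \<in> E"
    show "0 \<le> C.sg u $ 1" using sg(2)[OF u] x by simp
    show "0 < M h $ 1" using M1[OF h(2)] x by simp
    show "M h \<noteq> C.sg u" using ne[OF u] h by auto
  qed
  have lj: "I 0 absolutely_integrable_on E"
    "((\<lambda>h. integral E (I h)) \<longlongrightarrow> integral E (I 0) - 2 * pi * (\<mu> N / (4 * pi))) (at_right 0)"
    "((\<lambda>h. integral E (I h)) \<longlongrightarrow> integral E (I 0) + 2 * pi * (\<mu> N / (4 * pi))) (at_left 0)"
  proof -
    have a2: "continuous_on E (mm h)" if h: "0 < \<bar>h\<bar>" "\<bar>h\<bar> < \<kappa>" for h
      unfolding mm_def
    proof (intro continuous_on_divide continuous_on_mult \<mu>sg \<nu>sg continuous_on_wt[OF \<alpha> sgc continuous_on_const] ballI nz)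
      fix u assume u: "u \<in> E"
      show "0 \<le> C.sg u $ 1" using sg(2)[OF u] x by simp
      show "0 < M h $ 1" using M1[OF h(2)] x by simp
    qed
    have a3: "g integrable_on E"
      unfolding g_def E_def using C.pos d
      by (intro integrable_add integrable_on_mult_right integrable_norm_powr_square) auto
    have a4: "\<bar>I h u + mm h u * plane_kernel h u\<bar> \<le> g u" if h: "0 < \<bar>h\<bar>" "\<bar>h\<bar> < \<kappa>" and u: "u \<in> E" "u \<noteq> 0" for h u
    proof -
      define Q where "Q = C.sg u"
      have nu: "norm u > 0" using u by simp
      have Q: "Q = N + C.tang u + C.f u *\<^sub>R n" using C.sg_eq[OF EW[OF u(1)]] by (simp add: Q_def \<nu>N)
      \<comment> \<open>Normal and tangential parts are orthogonal, so the squared distance is |u|^2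
        + (h - f u)^2 and the singular term is the flat kernel with h replaced by h - f u.\<close>
      have MQ: "M h - Q = (h - C.f u) *\<^sub>R n - C.tang u" by (simp add: M_def Q algebra_simps)
      have tn: "C.tang u \<bullet> n = 0" "n \<bullet> C.tang u = 0" using C.tang_m[of u] \<nu>N by (auto simp: inner_commute)
      have nMQ: "n \<bullet> (M h - Q) = h - C.f u" unfolding MQ by (simp add: inner_diff_right tn nn)
      have "(M h - Q) \<bullet> (M h - Q) = (norm u)\<^sup>2 + (h - C.f u)\<^sup>2"
        unfolding MQ inner_diff_left inner_diff_right inner_scaleR_left inner_scaleR_right tn nn
        using C.norm_tang[of u] by (simp add: power2_eq_square flip: power2_norm_eq_inner)
      then have r: "norm (M h - Q) = sqrt ((norm u)\<^sup>2 + (h - C.f u)\<^sup>2)" by (simp add: norm_eq_sqrt_inner)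
      have r_ge: "norm (M h - Q) \<ge> norm u" unfolding r by (rule real_le_rsqrt) simp
      have pk: "plane_kernel h u = h / sqrt ((norm u)\<^sup>2 + h\<^sup>2) ^ 3" by (simp add: plane_kernel_def)
      have "I h u + mm h u * plane_kernel h u
          = \<mu> Q / (n \<bullet> \<nu> Q) * (kern \<alpha> n Q (M h) + weight \<alpha> Q (M h) * plane_kernel h u)"
        by (simp add: I_def mm_def Q_def distrib_left)
      also have "\<dots> = mm h u * (regular_part \<alpha> n Q (M h) / norm (M h - Q)
          - ((h - C.f u) / sqrt ((norm u)\<^sup>2 + (h - C.f u)\<^sup>2) ^ 3 - h / sqrt ((norm u)\<^sup>2 + h\<^sup>2) ^ 3))"
        unfolding kern_split nMQ pk r mm_def Q_def[symmetric] by (rule factor_weight)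
      finally have eq: "\<bar>I h u + mm h u * plane_kernel h u\<bar> = \<bar>mm h u\<bar> * \<bar>regular_part \<alpha> n Q (M h) / norm (M h - Q)
          - ((h - C.f u) / sqrt ((norm u)\<^sup>2 + (h - C.f u)\<^sup>2) ^ 3 - h / sqrt ((norm u)\<^sup>2 + h\<^sup>2) ^ 3)\<bar>"
        by (simp only: abs_mult)
      have "\<bar>regular_part \<alpha> n Q (M h)\<bar> \<le> 4 / M h $ 1"
        using regular_part_bound[OF \<alpha> _ _ n1] sg(2)[OF u(1)] M1[OF h(2)] x by (simp add: Q_def)
      also have "4 / M h $ 1 \<le> 8 / x"
        using frac_le[of 4 4 "x/2" "M h $ 1"] M1[OF h(2)] x by simp
      finally have "\<bar>regular_part \<alpha> n Q (M h)\<bar> / norm (M h - Q) \<le> (8 / x) / norm u"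
        using r_ge nu x by (intro frac_le) auto
      then have b1: "\<bar>regular_part \<alpha> n Q (M h) / norm (M h - Q)\<bar> \<le> (8 / x) * norm u powr (- 1)"
        using nu by (simp add: powr_minus divide_inverse abs_mult)
      have "\<bar>C.f u\<bar> \<le> 4 * A * norm u powr (1 + l)"
      proof (rule C.f_bound)
        fix t :: real assume "t \<in> {0..1}"
        then show "t *\<^sub>R u \<in> C.pr ` C.W" using C.square_star[of u d t] u(1) EW by (simp add: E_def)
      qed
      then have "2 * \<bar>C.f u\<bar> / norm u ^ 3 \<le> 2 * (4 * A * norm u powr (1 + l)) / norm u ^ 3"
        using nu by (intro divide_right_mono mult_left_mono) auto
      also have "norm u ^ 3 = norm u powr 3" using nu by (simp add: powr_numeral)
      also have "2 * (4 * A * norm u powr (1 + l)) / norm u powr 3 = 8 * A * (norm u powr (1 + l) / norm u powr 3)" by simp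
      also have "norm u powr (1 + l) / norm u powr 3 = norm u powr (- (2 - l))"
        unfolding powr_diff[of "norm u" "1 + l" 3, symmetric] by simp
      finally have "2 * \<bar>C.f u\<bar> / norm u ^ 3 \<le> 8 * A * norm u powr (- (2 - l))"
        using nu by (simp add: powr_numeral)
      then have b2: "\<bar>(h - C.f u) / sqrt ((norm u)\<^sup>2 + (h - C.f u)\<^sup>2) ^ 3 - h / sqrt ((norm u)\<^sup>2 + h\<^sup>2) ^ 3\<bar>
          \<le> 8 * A * norm u powr (- (2 - l))"
        using plane_kernel_diff_bound[OF nu, of h "C.f u"] by (rule order_trans[rotated])
      have "\<bar>regular_part \<alpha> n Q (M h) / norm (M h - Q)
          - ((h - C.f u) / sqrt ((norm u)\<^sup>2 + (h - C.f u)\<^sup>2) ^ 3 - h / sqrt ((norm u)\<^sup>2 + h\<^sup>2) ^ 3)\<bar>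
          \<le> (8 / x) * norm u powr (- 1) + 8 * A * norm u powr (- (2 - l))"
        by (rule order_trans[OF abs_triangle_ineq4 add_mono[OF b1 b2]])
      then have "\<bar>I h u + mm h u * plane_kernel h u\<bar>
          \<le> B * ((8 / x) * norm u powr (- 1) + 8 * A * norm u powr (- (2 - l)))"
        unfolding eq using mmB[OF h(2) u(1)] by (intro mult_mono) auto
      also have "\<dots> = g u" by (simp only: g_def distrib_left mult.assoc)
      finally show ?thesis .
    qed
    have a5: "((\<lambda>h. I h u) \<longlongrightarrow> I 0 u) (at 0)" if u: "u \<in> E" "u \<noteq> 0" for u
    proof -
      have "N $ 1 > 0" "0 \<le> C.sg u $ 1" using x sg(2)[OF u(1)] by (simp_all add: x_def)
      moreover have "N \<noteq> C.sg u" using ne[OF u(1), of 0] u(2) by (simp add: M_def)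
      ultimately have "((\<lambda>h. kern \<alpha> n (C.sg u) (M h)) \<longlongrightarrow> kern \<alpha> n (C.sg u) (M 0)) (at 0)"
        using kern_tendsto[OF \<alpha>] by (simp add: M_def)
      then show ?thesis unfolding I_def by (intro tendsto_intros nz[OF u(1)])
    qed
    \<comment> \<open>\<open>weight\<close> is regular on the diagonal, so \<open>mm\<close> is
      jointly continuous in h and u, including h = 0, and its value at the origin is the required
      one.\<close>
    have a6: "\<exists>\<eta>>0. \<forall>h u. 0 < \<bar>h\<bar> \<longrightarrow> \<bar>h\<bar> < \<eta> \<longrightarrow> u \<in> E \<longrightarrow> norm u < \<eta> \<longrightarrow> \<bar>mm h u - \<mu> N / (4 * pi)\<bar> \<le> e"
      if e: "e > 0" for e
    proof -
      let ?T = "{-\<kappa><..<\<kappa>} \<times> E"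
      have c: "continuous_on ?T (\<lambda>y. f (snd y))" if "continuous_on E f" for f :: "real \<times> real \<Rightarrow> 'z::topological_space"
        by (rule continuous_on_compose2[OF that]) (auto intro!: continuous_intros)
      have Mc: "continuous_on ?T (\<lambda>y. M (fst y))" unfolding M_def by (intro continuous_intros)
      have "continuous_on ?T (\<lambda>y. mm (fst y) (snd y))"
        unfolding mm_def
      proof (intro continuous_on_divide continuous_on_mult c \<mu>sg \<nu>sg continuous_on_wt[OF \<alpha> c[OF sgc] Mc] ballI)
        fix y assume "y \<in> ?T"
        then have y: "\<bar>fst y\<bar> < \<kappa>" "snd y \<in> E" by (auto simp: abs_less_iff)
        show "0 \<le> C.sg (snd y) $ 1" using sg(2)[OF y(2)] x by simp
        show "0 < M (fst y) $ 1" using M1[OF y(1)] x by simp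
        show "n \<bullet> \<nu> (C.sg (snd y)) \<noteq> 0" by (rule nz[OF y(2)])
      qed
      moreover have "(0, 0) \<in> ?T" using \<kappa>(1) E0 by simp
      ultimately obtain \<eta> where \<eta>: "\<eta> > 0" "\<And>y. y \<in> ?T \<Longrightarrow> dist y (0, 0) < \<eta> \<Longrightarrow> dist (mm (fst y) (snd y)) (mm 0 0) < e"
        unfolding continuous_on_iff using e by (metis fst_conv snd_conv)
      have mm0: "mm 0 0 = \<mu> N / (4 * pi)"
      proof -
        have "weight \<alpha> N N = 1 / (4 * pi)" using x unfolding x_def by (rule weight_diag)
        then show ?thesis using nn by (simp add: mm_def sg0 M_def \<nu>N)
      qed
      show ?thesis
      proof (intro exI[of _ "min (\<eta>/2) \<kappa>"] conjI allI impI)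
        show "min (\<eta>/2) \<kappa> > 0" using \<eta>(1) \<kappa>(1) by simp
        fix h u assume hu: "0 < \<bar>h\<bar>" "\<bar>h\<bar> < min (\<eta>/2) \<kappa>" "u \<in> E" "norm u < min (\<eta>/2) \<kappa>"
        have "norm (h, u) \<le> norm h + norm u" by (rule norm_Pair_le)
        also have "\<dots> < \<eta>" using hu by simp
        finally have "dist (h, u) (0, 0) < \<eta>" by (simp add: dist_norm)
        moreover have "(h, u) \<in> ?T" using hu by (auto simp: abs_less_iff)
        ultimately have "dist (mm h u) (mm 0 0) < e" using \<eta>(2)[of "(h, u)"] by simp
        then show "\<bar>mm h u - \<mu> N / (4 * pi)\<bar> \<le> e" by (simp add: mm0 dist_real_def)
      qed
    qed
    note L = local_jump[of d \<kappa> I mm B g "I 0" "\<mu> N / (4 * pi)", folded E_def, OF d(1) \<kappa>(1) Icont a2 mmB a3 a4 a5 a6]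
    show "I 0 absolutely_integrable_on E" by (rule L(1))
    show "((\<lambda>h. integral E (I h)) \<longlongrightarrow> integral E (I 0) - 2 * pi * (\<mu> N / (4 * pi))) (at_right 0)" by (rule L(2))
    show "((\<lambda>h. integral E (I h)) \<longlongrightarrow> integral E (I 0) + 2 * pi * (\<mu> N / (4 * pi))) (at_left 0)" by (rule L(3))
  qed
  \<comment> \<open>The full preimage of the patch, not a neighbourhood of one parameter: every
    parameter mapped near \<open>N\<close> contributes to the singular integral.\<close>
  define T where "T = {p \<in> R. \<phi> p \<in> C.sg ` E}"
  define K where "K h p = \<mu> (\<phi> p) * kern \<alpha> n (\<phi> p) (M h) * J p" for h p
  have cv: "compact T" "K h absolutely_integrable_on T" "integral T (K h) = integral E (I h)"
    if "I h absolutely_integrable_on E" for h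
  proof -
    have G: "(\<lambda>u. \<mu> (C.sg u) * kern \<alpha> n (C.sg u) (M h) / (\<nu> N \<bullet> \<nu> (C.sg u))) absolutely_integrable_on square d"
      using that by (simp add: I_def[abs_def] \<nu>N E_def)
    note cv = surface_change_of_variables[OF chart d, of "\<lambda>Q. \<mu> Q * kern \<alpha> n Q (M h)", OF G]
    show "compact T" "K h absolutely_integrable_on T" "integral T (K h) = integral E (I h)"
      using cv unfolding T_def E_def K_def[abs_def] I_def[abs_def] \<nu>N by auto
  qed
  have Ih: "I h absolutely_integrable_on E" if "0 < \<bar>h\<bar>" "\<bar>h\<bar> < \<kappa>" for h
    using Icont[OF that] unfolding E_def by (rule absolutely_integrable_continuous)
  have half: "2 * pi * (\<mu> N / (4 * pi)) = \<mu> N / 2" by simp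
  have ev: "\<forall>\<^sub>F h in at 0. integral E (I h) = integral T (K h)"
    unfolding eventually_at using \<kappa>(1) cv(3)[OF Ih] by (intro exI[of _ \<kappa>]) auto
  have T: "compact T" "K 0 absolutely_integrable_on T" "integral T (K 0) = integral E (I 0)" using cv[OF lj(1)] by auto
  have evr: "\<forall>\<^sub>F h in at_right 0. integral E (I h) = integral T (K h)"
    and evl: "\<forall>\<^sub>F h in at_left 0. integral E (I h) = integral T (K h)"
    using ev by (auto simp: eventually_at_split)
  have lr: "((\<lambda>h. integral T (K h)) \<longlongrightarrow> integral T (K 0) - \<mu> N / 2) (at_right 0)"
    using Lim_transform_eventually[OF lj(2) evr] unfolding half T(3) .
  have ll: "((\<lambda>h. integral T (K h)) \<longlongrightarrow> integral T (K 0) + \<mu> N / 2) (at_left 0)"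
    using Lim_transform_eventually[OF lj(3) evl] unfolding half T(3) .
  have far: "\<kappa> \<le> dist N (\<phi> p)" if p: "p \<in> R - T" for p
  proof (rule ccontr)
    assume "\<not> ?thesis"
    then have dd: "dist N (\<phi> p) < \<kappa>" by simp
    have "\<bar>(N - \<phi> p) $ 1\<bar> \<le> norm (N - \<phi> p)" by (rule component_le_norm_cart)
    then have "\<phi> p $ 1 > 0" using dd \<kappa>(3) x by (simp add: dist_norm x_def)
    then have "\<phi> p \<in> \<Gamma>" using closure_surface phi_closure p by auto
    then have "\<phi> p \<in> C.sg ` E" using dd \<kappa>(2) \<kappa>1(2) by auto
    then show False using p by (auto simp: T_def)
  qed
  show ?thesis
  proof (rule that[of T \<kappa>])
    show "T \<subseteq> R" by (auto simp: T_def)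
    show "\<kappa> \<le> N $ 1 / 2" using \<kappa>(3) by (simp add: x_def)
    show "N + h *\<^sub>R n \<notin> closure \<Gamma>" if "0 < \<bar>h\<bar>" "\<bar>h\<bar> < \<kappa>" for h using Mnot[OF that] by (simp add: M_def)
  qed (use T \<kappa>(1) far lr ll in \<open>auto simp: K_def[abs_def] M_def\<close>)
qed

end

context lyapunov_domain
begin

text \<open>On \<open>F\<close> the surface stays at distance \<kappa> from \<open>N\<close>, so for
  |h| < \<kappa>/2 it stays at distance \<kappa>/2 from the moving point and a constant majorant
  works; hence no jump. The last claim serves to split the integral over the rectangle for h
  \<noteq> 0.\<close>

lemma far_limit:
  assumes \<alpha>: "0 < 2 * \<alpha>" "2 * \<alpha> < 1" and \<mu>: "continuous_on (closure \<Gamma>) \<mu>"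
    and N: "N $ 1 > 0" and n: "norm n = 1"
    and F: "F \<in> sets lebesgue" "F \<subseteq> R" and \<kappa>: "\<kappa> > 0" "\<kappa> \<le> N$1 / 2"
    and far: "\<And>p. p \<in> F \<Longrightarrow> \<kappa> \<le> dist N (\<phi> p)"
    and ne: "\<And>h. 0 < \<bar>h\<bar> \<Longrightarrow> \<bar>h\<bar> < \<kappa> \<Longrightarrow> N + h *\<^sub>R n \<notin> closure \<Gamma>"
  shows "(layer \<alpha> \<mu> n N) absolutely_integrable_on F"
    and "((\<lambda>h. integral F (layer \<alpha> \<mu> n (N + h *\<^sub>R n))) \<longlongrightarrow>
        integral F (layer \<alpha> \<mu> n N)) (at 0)"
    and "\<And>h. 0 < \<bar>h\<bar> \<Longrightarrow> \<bar>h\<bar> < \<kappa> \<Longrightarrow> S \<subseteq> R \<Longrightarrow> S \<in> sets lebesgue \<Longrightarrow>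
      (layer \<alpha> \<mu> n (N + h *\<^sub>R n)) absolutely_integrable_on S"
proof -
  define x where "x = N$1"
  have x: "x > 0" using N by (simp add: x_def)
  define M where "M h = N + h *\<^sub>R n" for h
  define K where "K h p = \<mu> (\<phi> p) * kern \<alpha> n (\<phi> p) (M h) * J p" for h p
  have M1: "M h $ 1 > x / 2" if "\<bar>h\<bar> < \<kappa>" for h
    using first_coordinate_on_normal[OF n that \<kappa>(2)] by (simp add: M_def x_def)
  have \<mu>\<phi>: "continuous_on R (\<lambda>p. \<mu> (\<phi> p))"
    by (rule continuous_on_compose2[OF \<mu> continuous_phi]) (use phi_closure in blast)
  have int: "K h absolutely_integrable_on S" if h: "0 < \<bar>h\<bar>" "\<bar>h\<bar> < \<kappa>" and S: "S \<subseteq> R" "S \<in> sets lebesgue" for h S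
  proof -
    have "continuous_on R (K h)"
      unfolding K_def
    proof (intro continuous_on_mult \<mu>\<phi> continuous_J continuous_on_kern[OF \<alpha> continuous_phi continuous_on_const])
      fix p assume p: "p \<in> R"
      show "0 \<le> \<phi> p $ 1" by (rule closure_surface_nonneg[OF phi_closure[OF p]])
      show "0 < M h $ 1" using M1[OF h(2)] x by simp
      show "M h \<noteq> \<phi> p" using ne[OF h] phi_closure[OF p] unfolding M_def by metis
    qed
    then have "K h absolutely_integrable_on R"
      unfolding R_cbox by (rule absolutely_integrable_continuous)
    then show ?thesis by (rule set_integrable_subset[OF _ S(2,1)])
  qed
  obtain B0 where B0: "\<And>p. p \<in> R \<Longrightarrow> \<bar>\<mu> (\<phi> p)\<bar> \<le> B0"
    using compact_imp_bounded[OF compact_continuous_image[OF \<mu>\<phi> compact_R]]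
    unfolding bounded_iff by auto
  obtain B1 where B1: "\<And>p. p \<in> R \<Longrightarrow> \<bar>J p\<bar> \<le> B1"
    using compact_imp_bounded[OF compact_continuous_image[OF continuous_J compact_R]]
    unfolding bounded_iff by auto
  \<comment> \<open>The value of \<open>kern_bound\<close> for first coordinate \<open>x / 2\<close>
    and distance \<open>\<kappa> / 2\<close>.\<close>
  define c where "c = 8 / x / (\<kappa> / 2) + 1 / (\<kappa> / 2)\<^sup>2"
  have sep: "norm (M h - \<phi> p) \<ge> \<kappa> / 2" if h: "\<bar>h\<bar> < \<kappa> / 2" and p: "p \<in> F" for h p
  proof -
    have "\<kappa> \<le> norm (N - \<phi> p)" using far[OF p] by (simp add: dist_norm)
    also have "N - \<phi> p = (M h - \<phi> p) - h *\<^sub>R n" by (simp add: M_def)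
    also have "norm \<dots> \<le> norm (M h - \<phi> p) + norm (h *\<^sub>R n)" by (rule norm_triangle_ineq4)
    finally show ?thesis using h n by simp
  qed
  have bound: "\<bar>K h p\<bar> \<le> B0 * c * B1" if h: "0 < \<bar>h\<bar>" "\<bar>h\<bar> < \<kappa> / 2" and p: "p \<in> F" for h p
  proof -
    have pR: "p \<in> R" using p F(2) by blast
    have m1: "M h $ 1 > x / 2" using M1 h \<kappa>(1) by simp
    have "\<bar>kern \<alpha> n (\<phi> p) (M h)\<bar> \<le> 4 / M h $ 1 / norm (M h - \<phi> p) + 1 / (norm (M h - \<phi> p))\<^sup>2"
      using kern_bound[OF \<alpha> closure_surface_nonneg[OF phi_closure[OF pR]] _ n] m1 x by simp
    also have "\<dots> \<le> c"
      unfolding c_def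
    proof (rule add_mono)
      have "4 / M h $ 1 \<le> 8 / x"
        using frac_le[of 4 4 "x/2" "M h $ 1"] m1 x by simp
      then show "4 / M h $ 1 / norm (M h - \<phi> p) \<le> 8 / x / (\<kappa> / 2)"
        by (rule frac_le[rotated]) (use sep[OF h(2) p] \<kappa>(1) x in auto)
      show "1 / (norm (M h - \<phi> p))\<^sup>2 \<le> 1 / (\<kappa> / 2)\<^sup>2"
        using sep[OF h(2) p] \<kappa>(1) by (intro frac_le power_mono) auto
    qed
    finally have k: "\<bar>kern \<alpha> n (\<phi> p) (M h)\<bar> \<le> c" .
    have nonneg: "0 \<le> B0" "0 \<le> c" using B0[OF pR] k by linarith+
    have "\<bar>\<mu> (\<phi> p)\<bar> * \<bar>kern \<alpha> n (\<phi> p) (M h)\<bar> \<le> B0 * c"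
      by (rule mult_mono[OF B0[OF pR] k nonneg(1)]) simp
    then show ?thesis
      unfolding K_def abs_mult by (rule mult_mono[OF _ B1[OF pR]]) (use nonneg in simp_all)
  qed
  have lim: "((\<lambda>h. K h p) \<longlongrightarrow> K 0 p) (at 0)" if p: "p \<in> F" for p
  proof -
    have "N \<noteq> \<phi> p" using far[OF p] \<kappa>(1) by auto
    then have "((\<lambda>h. kern \<alpha> n (\<phi> p) (M h)) \<longlongrightarrow> kern \<alpha> n (\<phi> p) (M 0)) (at 0)"
      using kern_tendsto[OF \<alpha> closure_surface_nonneg[OF phi_closure[OF subsetD[OF F(2) p]]] N]
      by (simp add: M_def)
    then show ?thesis unfolding K_def by (intro tendsto_intros)
  qed
  have "bounded F" by (rule bounded_subset[OF compact_imp_bounded[OF compact_R] F(2)])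
  then have "F \<in> lmeasurable" using F(1) by (rule bounded_set_imp_lmeasurable)
  then have const: "(\<lambda>p. B0 * c * B1) integrable_on F" by (rule integrable_on_const)
  have intF: "K h integrable_on F" if "0 < \<bar>h\<bar>" "\<bar>h\<bar> < \<kappa> / 2" for h
    by (rule set_lebesgue_integral_eq_integral(1)[OF int]) (use that F \<kappa>(1) in auto)
  have "\<kappa> / 2 > 0" using \<kappa>(1) by simp
  note dc = dominated_convergence_at_0[where I = K and L = "K 0", OF this _ const]
  have K0: "K 0 = (layer \<alpha> \<mu> n N)" by (simp add: K_def fun_eq_iff M_def)
  show "(layer \<alpha> \<mu> n N) absolutely_integrable_on F"
    unfolding K0[symmetric] by (rule dc(1)) (erule (1) intF, erule (2) bound, erule lim)
  show "((\<lambda>h. integral F (layer \<alpha> \<mu> n (N + h *\<^sub>R n))) \<longlongrightarrow>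
        integral F (layer \<alpha> \<mu> n N)) (at 0)"
    unfolding K0[symmetric] unfolding M_def[symmetric] K_def[symmetric]
    by (rule dc(2)) (erule (1) intF, erule (2) bound, erule lim)
  show "\<And>h. 0 < \<bar>h\<bar> \<Longrightarrow> \<bar>h\<bar> < \<kappa> \<Longrightarrow> S \<subseteq> R \<Longrightarrow> S \<in> sets lebesgue \<Longrightarrow>
      (layer \<alpha> \<mu> n (N + h *\<^sub>R n)) absolutely_integrable_on S"
    unfolding M_def[symmetric] K_def[symmetric] by (rule int)
qed

text \<open>Adds the near part, which jumps, and the far part, which is continuous. Here
  \<open>n\<close> is any unit normal and a side is the sign of h; inside and outside of
  \<open>D\<close> come in only afterwards.\<close>

lemma normal_derivative_limits:
  assumes \<alpha>: "0 < 2 * \<alpha>" "2 * \<alpha> < 1" and \<mu>: "continuous_on (closure \<Gamma>) \<mu>"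
    and \<rho>: "\<And>p. p \<in> R \<Longrightarrow> \<rho> p = \<mu> (\<phi> p)"
    and p0: "p0 \<in> R" "\<phi> p0 \<in> \<Gamma>" and n: "unit_normal \<Gamma> (\<phi> p0) n"
  defines "v \<equiv> single_layer \<alpha> s1 s2 t1 t2 \<phi> \<rho>"
    and "K \<equiv> \<lambda>\<tau>. \<rho> \<tau> * kernel_K2 \<alpha> \<phi> n \<tau> p0"
  shows "surface_integrable s1 s2 t1 t2 \<phi> K"
    and "((\<lambda>h. conormal \<alpha> n v (\<phi> p0 + h *\<^sub>R n)) \<longlongrightarrow> - 1/2 * \<rho> p0 + surface_integral s1 s2 t1 t2 \<phi> K) (at_right 0)"
    and "((\<lambda>h. conormal \<alpha> n v (\<phi> p0 + h *\<^sub>R n)) \<longlongrightarrow> 1/2 * \<rho> p0 + surface_integral s1 s2 t1 t2 \<phi> K) (at_left 0)"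
proof -
  define N where "N = \<phi> p0"
  have N: "N \<in> \<Gamma>" "N $ 1 > 0" using p0 surface_pos by (auto simp: N_def)
  have n1: "norm n = 1" using n by (simp add: unit_normal_def)
  define G where "G h p = \<mu> (\<phi> p) * kern \<alpha> n (\<phi> p) (N + h *\<^sub>R n) * J p" for h p
  obtain T \<kappa> where T: "compact T" "T \<subseteq> R" and \<kappa>: "\<kappa> > 0" "\<kappa> \<le> N$1 / 2"
    and far: "\<And>p. p \<in> R - T \<Longrightarrow> \<kappa> \<le> dist N (\<phi> p)"
    and ne: "\<And>h. 0 < \<bar>h\<bar> \<Longrightarrow> \<bar>h\<bar> < \<kappa> \<Longrightarrow> N + h *\<^sub>R n \<notin> closure \<Gamma>"
    and near: "(layer \<alpha> \<mu> n N) absolutely_integrable_on T"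
      "((\<lambda>h. integral T (layer \<alpha> \<mu> n (N + h *\<^sub>R n))) \<longlongrightarrow>
          integral T (layer \<alpha> \<mu> n N) - \<mu> N / 2) (at_right 0)"
      "((\<lambda>h. integral T (layer \<alpha> \<mu> n (N + h *\<^sub>R n))) \<longlongrightarrow>
          integral T (layer \<alpha> \<mu> n N) + \<mu> N / 2) (at_left 0)"
    by (rule near_limit[OF \<alpha> \<mu> N(1) n[folded N_def]]) (rule that; (assumption | blast))
  have Tm: "T \<in> sets lebesgue" using T(1) by (auto intro: lmeasurable_compact fmeasurableD)
  have Fm: "R - T \<in> sets lebesgue" using measurable_R Tm by auto
  have G0: "G 0 = (layer \<alpha> \<mu> n N)" by (simp add: G_def fun_eq_iff)
  have nearG: "G 0 absolutely_integrable_on T"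
      "((\<lambda>h. integral T (G h)) \<longlongrightarrow> integral T (G 0) - \<mu> N / 2) (at_right 0)"
      "((\<lambda>h. integral T (G h)) \<longlongrightarrow> integral T (G 0) + \<mu> N / 2) (at_left 0)"
    using near unfolding G0 unfolding G_def by auto
  have farG: "G 0 absolutely_integrable_on R - T"
    unfolding G0 by (rule far_limit(1)[OF \<alpha> \<mu> N(2) n1 Fm Diff_subset \<kappa>]) (erule far, erule (1) ne)
  have farG2: "((\<lambda>h. integral (R - T) (G h)) \<longlongrightarrow> integral (R - T) (G 0)) (at 0)"
    unfolding G0 unfolding G_def
    by (rule far_limit(2)[OF \<alpha> \<mu> N(2) n1 Fm Diff_subset \<kappa>]) (erule far, erule (1) ne)
  have intG: "G h absolutely_integrable_on S" if "0 < \<bar>h\<bar>" "\<bar>h\<bar> < \<kappa>" "S \<subseteq> R" "S \<in> sets lebesgue" for h S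
    unfolding G_def
    by (rule far_limit(3)[OF \<alpha> \<mu> N(2) n1 Fm Diff_subset \<kappa> _ _ that]) (erule far, erule (1) ne)
  have RU: "T \<union> (R - T) = R" using T(2) by blast
  have split: "integral R f = integral T f + integral (R - T) f"
    if "f absolutely_integrable_on T" "f absolutely_integrable_on R - T" for f :: "real \<times> real \<Rightarrow> real"
  proof -
    have "(f has_integral integral T f + integral (R - T) f) (T \<union> (R - T))"
      using that by (intro has_integral_Un integrable_integral set_lebesgue_integral_eq_integral(1)) auto
    then show ?thesis unfolding RU by (rule integral_unique)
  qed
  have G0R: "G 0 absolutely_integrable_on R"
    using set_integrable_Un[OF nearG(1) farG Tm Fm] unfolding RU .
  have farG': "((\<lambda>h. integral (R - T) (G h)) \<longlongrightarrow> integral (R - T) (G 0)) (at_right 0)"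
    "((\<lambda>h. integral (R - T) (G h)) \<longlongrightarrow> integral (R - T) (G 0)) (at_left 0)"
    using farG2 by (auto simp: filterlim_at_split)
  \<comment> \<open>The kernel has a junk value where \<open>\<phi> \<tau> = N\<close>, but these parameters do not contribute to the integral.\<close>
  define Z where "Z = {\<tau> \<in> R. J \<tau> \<noteq> 0 \<and> (\<exists>q \<in> R. q \<noteq> \<tau> \<and> \<phi> q = \<phi> \<tau>)} \<union> {p0}"
  have Z: "negligible Z" unfolding Z_def using simple_cover by (intro negligible_Un) auto
  have KG: "K \<tau> * J \<tau> = G 0 \<tau>" if \<tau>: "\<tau> \<in> R - Z" for \<tau>
  proof (cases "J \<tau> = 0")
    case False
    have "\<phi> \<tau> \<noteq> N"
    proof
      assume "\<phi> \<tau> = N"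
      then have "\<phi> p0 = \<phi> \<tau>" by (simp add: N_def)
      moreover have "p0 \<noteq> \<tau>" using \<tau> unfolding Z_def by blast
      ultimately have "\<tau> \<in> Z" using \<tau> p0(1) False unfolding Z_def by blast
      then show False using \<tau> by blast
    qed
    then have "kernel_K2 \<alpha> \<phi> n \<tau> p0 = kern \<alpha> n (\<phi> \<tau>) N"
      unfolding kernel_K2_def N_def[symmetric]
      using conormal_q2[OF \<alpha> closure_surface_nonneg[OF phi_closure] N(2)] \<tau> by auto
    then show ?thesis using \<rho>[of \<tau>] \<tau> by (simp add: K_def G0)
  qed (simp add: G_def)
  have KR: "(\<lambda>\<tau>. K \<tau> * J \<tau>) absolutely_integrable_on R"
    by (rule absolutely_integrable_spike[OF G0R Z]) (erule KG)
  then show S: "surface_integrable s1 s2 t1 t2 \<phi> K" by (simp add: surface_integrable_def)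
  have "integral R (\<lambda>\<tau>. K \<tau> * J \<tau>) = integral R (G 0)"
    by (rule integral_spike[OF Z, symmetric]) (erule KG)
  then have SI: "surface_integral s1 s2 t1 t2 \<phi> K = integral T (G 0) + integral (R - T) (G 0)"
    unfolding surface_integral_eq[OF S] using split[OF nearG(1) farG] by simp
  have \<rho>c: "continuous_on R \<rho>"
  proof -
    have "continuous_on R (\<lambda>p. \<mu> (\<phi> p))"
      by (rule continuous_on_compose2[OF \<mu> continuous_phi]) (use phi_closure in blast)
    then show ?thesis by (rule continuous_on_cong[OF refl, THEN iffD1, rotated]) (simp only: \<rho>)
  qed
  have con: "conormal \<alpha> n v (N + h *\<^sub>R n) = integral T (G h) + integral (R - T) (G h)"
    if h: "0 < \<bar>h\<bar>" "\<bar>h\<bar> < \<kappa>" for h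
  proof -
    have "(N + h *\<^sub>R n) $ 1 > 0"
      using first_coordinate_on_normal[OF n1 h(2) \<kappa>(2)] N(2) by linarith
    then have "conormal \<alpha> n v (N + h *\<^sub>R n) = integral R (\<lambda>p. \<rho> p * kern \<alpha> n (\<phi> p) (N + h *\<^sub>R n) * J p)"
      unfolding v_def by (rule single_layer_conormal[OF \<alpha> \<rho>c _ ne[OF h]])
    also have "\<dots> = integral R (G h)" by (rule integral_cong) (simp add: G_def \<rho>)
    also have "\<dots> = integral T (G h) + integral (R - T) (G h)"
      using intG[OF h T(2) Tm] intG[OF h Diff_subset Fm] by (rule split)
    finally show ?thesis .
  qed
  have ev: "\<forall>\<^sub>F h in at 0. integral T (G h) + integral (R - T) (G h) = conormal \<alpha> n v (N + h *\<^sub>R n)"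
    unfolding eventually_at using \<kappa>(1) con by (intro exI[of _ \<kappa>]) auto
  then have ev': "\<forall>\<^sub>F h in at_right 0. integral T (G h) + integral (R - T) (G h) = conormal \<alpha> n v (N + h *\<^sub>R n)"
    "\<forall>\<^sub>F h in at_left 0. integral T (G h) + integral (R - T) (G h) = conormal \<alpha> n v (N + h *\<^sub>R n)"
    by (auto simp: eventually_at_split)
  have \<rho>N: "\<rho> p0 = \<mu> N" using \<rho>[OF p0(1)] by (simp add: N_def)
  have "((\<lambda>h. conormal \<alpha> n v (N + h *\<^sub>R n)) \<longlongrightarrow> (integral T (G 0) - \<mu> N / 2) + integral (R - T) (G 0)) (at_right 0)"
    by (rule Lim_transform_eventually[OF tendsto_add[OF nearG(2) farG'(1)] ev'(1)])
  then show "((\<lambda>h. conormal \<alpha> n v (\<phi> p0 + h *\<^sub>R n)) \<longlongrightarrow> - 1/2 * \<rho> p0 + surface_integral s1 s2 t1 t2 \<phi> K) (at_right 0)"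
    unfolding SI \<rho>N N_def[symmetric] by (simp add: algebra_simps)
  have "((\<lambda>h. conormal \<alpha> n v (N + h *\<^sub>R n)) \<longlongrightarrow> (integral T (G 0) + \<mu> N / 2) + integral (R - T) (G 0)) (at_left 0)"
    by (rule Lim_transform_eventually[OF tendsto_add[OF nearG(3) farG'(2)] ev'(2)])
  then show "((\<lambda>h. conormal \<alpha> n v (\<phi> p0 + h *\<^sub>R n)) \<longlongrightarrow> 1/2 * \<rho> p0 + surface_integral s1 s2 t1 t2 \<phi> K) (at_left 0)"
    unfolding SI \<rho>N N_def[symmetric] by (simp add: algebra_simps)
qed

end

text \<open>The map taking \<open>M\<close> to \<open>(M - N) \<bullet> n\<close> inverts the
  parametrization of the line by h, so a limit in h becomes a limit over points of the line,
  provided the points of \<open>A\<close> near \<open>N\<close> have h in \<open>I\<close>.\<close>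

lemma tendsto_along_normal_line:
  fixes N n :: "real^3" and f :: "real^3 \<Rightarrow> real"
  assumes n: "norm n = 1" and b: "b > 0"
    and side: "\<And>h. 0 < \<bar>h\<bar> \<Longrightarrow> \<bar>h\<bar> < b \<Longrightarrow> N + h *\<^sub>R n \<in> A \<Longrightarrow> h \<in> I"
    and lim: "((\<lambda>h. f (N + h *\<^sub>R n)) \<longlongrightarrow> L) (at 0 within I)"
    and A: "A \<subseteq> normal_line N n"
  shows "(f \<longlongrightarrow> L) (at N within A)"
proof -
  define p where "p M = (M - N) \<bullet> n" for M
  have nn: "n \<bullet> n = 1" using n by (simp add: norm_eq_1)
  have pM: "N + p M *\<^sub>R n = M" if "M \<in> A" for M
    using that A nn by (auto simp: normal_line_def p_def)
  have "(p \<longlongrightarrow> p N) (at N within A)"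
    unfolding p_def by (intro tendsto_intros)
  then have p0: "(p \<longlongrightarrow> 0) (at N within A)" by (simp add: p_def)
  have "\<forall>\<^sub>F M in at N within A. p M \<in> I \<and> p M \<noteq> 0"
    unfolding eventually_at
  proof (intro exI[of _ b] conjI b ballI impI)
    fix M assume M: "M \<in> A" "M \<noteq> N \<and> dist M N < b"
    show ne: "p M \<noteq> 0" using pM[OF M(1)] M(2) by auto
    have "M - N = p M *\<^sub>R n" using pM[OF M(1)] by (metis add_diff_cancel_left')
    then have "dist M N = \<bar>p M\<bar>" using n by (simp add: dist_norm)
    then show "p M \<in> I" using side[of "p M"] ne M pM[OF M(1)] by simp
  qed
  with p0 have "filterlim p (at 0 within I) (at N within A)" by (simp add: filterlim_at)
  from filterlim_compose[OF lim this]
  have "((\<lambda>M. f (N + p M *\<^sub>R n)) \<longlongrightarrow> L) (at N within A)" .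
  moreover have "\<forall>\<^sub>F M in at N within A. f (N + p M *\<^sub>R n) = f M"
    unfolding eventually_at using pM by (intro exI[of _ 1]) auto
  ultimately show ?thesis by (rule Lim_transform_eventually)
qed

text \<open>The density is the pullback of a function on the closed surface, so it has one value at
  parameters mapped to the same point. Integrability is asserted because a non-integrable integrand
  would give the integral the default value 0. By \<open>outer_normal\<close> the points of the
  normal line in \<open>D\<close>, and those off its closure, accumulate at the surface point, so
  neither limit is vacuous.\<close>

theorem theorem4:
  fixes \<alpha> s1 s2 t1 t2 t0 s t :: real
    and D X \<Gamma> \<gamma> :: "(real^3) set"
    and \<phi> :: "real \<times> real \<Rightarrow> real^3"
    and \<mu> :: "real^3 \<Rightarrow> real"
    and \<rho>2 :: "real \<times> real \<Rightarrow> real"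
    and v2 :: "real^3 \<Rightarrow> real"
    and n :: "real^3"
  assumes "0 < 2 * \<alpha>" and "2 * \<alpha> < 1"
    and "lyapunov_domain D X \<Gamma> \<gamma> \<phi> s1 s2 t1 t2 t0"
    and "continuous_on (closure \<Gamma>) \<mu>"
    and "\<And>p. p \<in> {s1..s2} \<times> {t1..t2} \<Longrightarrow> \<rho>2 p = \<mu> (\<phi> p)"
    and "v2 = single_layer \<alpha> s1 s2 t1 t2 \<phi> \<rho>2"
    and "s \<in> {s1..s2}" and "t \<in> {t1..t2}" and "\<phi> (s, t) \<in> \<Gamma>"
    and "outer_normal D \<Gamma> (\<phi> (s, t)) n"
  shows "surface_integrable s1 s2 t1 t2 \<phi> (\<lambda>\<tau>. \<rho>2 \<tau> * kernel_K2 \<alpha> \<phi> n \<tau> (s, t)) \<and>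
    ((\<lambda>M. conormal \<alpha> n v2 M) \<longlongrightarrow>
       1/2 * \<rho>2 (s, t) +
       surface_integral s1 s2 t1 t2 \<phi> (\<lambda>\<tau>. \<rho>2 \<tau> * kernel_K2 \<alpha> \<phi> n \<tau> (s, t)))
      (at (\<phi> (s, t)) within (normal_line (\<phi> (s, t)) n \<inter> D)) \<and>
    ((\<lambda>M. conormal \<alpha> n v2 M) \<longlongrightarrow>
       - 1/2 * \<rho>2 (s, t) +
       surface_integral s1 s2 t1 t2 \<phi> (\<lambda>\<tau>. \<rho>2 \<tau> * kernel_K2 \<alpha> \<phi> n \<tau> (s, t)))
      (at (\<phi> (s, t)) within (normal_line (\<phi> (s, t)) n - closure D))"
proof -
  interpret lyapunov_domain D X \<Gamma> \<gamma> \<phi> s1 s2 t1 t2 t0 by fact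
  have p0: "(s, t) \<in> {s1..s2} \<times> {t1..t2}" using assms by simp
  have n: "unit_normal \<Gamma> (\<phi> (s, t)) n" and n1: "norm n = 1"
    using \<open>outer_normal D \<Gamma> (\<phi> (s, t)) n\<close> by (auto simp: outer_normal_def unit_normal_def)
  note \<rho> = assms(5) and \<Gamma> = \<open>\<phi> (s, t) \<in> \<Gamma>\<close>
  note lims = normal_derivative_limits[OF assms(1,2,4) _ p0 \<Gamma> n, of \<rho>2, folded assms(6)]
  obtain b where b: "b > 0" "\<And>h. 0 < h \<Longrightarrow> h < b \<Longrightarrow> \<phi> (s, t) - h *\<^sub>R n \<in> D \<and> \<phi> (s, t) + h *\<^sub>R n \<notin> closure D"
    using \<open>outer_normal D \<Gamma> (\<phi> (s, t)) n\<close> unfolding outer_normal_def eventually_at_right_field by auto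
  \<comment> \<open>For small h the outer normal puts positive h outside the closure of
    \<open>D\<close> and negative h inside \<open>D\<close>, so membership decides the sign of
    h.\<close>
  have inside: "h < 0" if "0 < \<bar>h\<bar>" "\<bar>h\<bar> < b" "\<phi> (s, t) + h *\<^sub>R n \<in> D" for h
    using b(2)[of h] that closure_subset[of D] by (cases "h > 0") auto
  have outside: "h > 0" if "0 < \<bar>h\<bar>" "\<bar>h\<bar> < b" "\<phi> (s, t) + h *\<^sub>R n \<notin> closure D" for h
    using b(2)[of "- h"] that closure_subset[of D] by (cases "h < 0") auto
  show ?thesis
  proof (intro conjI)
    show "surface_integrable s1 s2 t1 t2 \<phi> (\<lambda>\<tau>. \<rho>2 \<tau> * kernel_K2 \<alpha> \<phi> n \<tau> (s, t))" by (rule lims(1)[OF \<rho>])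
    show "((\<lambda>M. conormal \<alpha> n v2 M) \<longlongrightarrow>
       1/2 * \<rho>2 (s, t) + surface_integral s1 s2 t1 t2 \<phi> (\<lambda>\<tau>. \<rho>2 \<tau> * kernel_K2 \<alpha> \<phi> n \<tau> (s, t)))
      (at (\<phi> (s, t)) within (normal_line (\<phi> (s, t)) n \<inter> D))"
      by (rule tendsto_along_normal_line[OF n1 b(1) _ lims(3)[OF \<rho>]]) (use inside in auto)
    show "((\<lambda>M. conormal \<alpha> n v2 M) \<longlongrightarrow>
       - 1/2 * \<rho>2 (s, t) + surface_integral s1 s2 t1 t2 \<phi> (\<lambda>\<tau>. \<rho>2 \<tau> * kernel_K2 \<alpha> \<phi> n \<tau> (s, t)))
      (at (\<phi> (s, t)) within (normal_line (\<phi> (s, t)) n - closure D))"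
      by (rule tendsto_along_normal_line[OF n1 b(1) _ lims(2)[OF \<rho>]]) (use outside in auto)
  qed
qed

end
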